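(* Let $p$ be a prime and let $G$ be a finite non-abelian $p$-group such that $\exp(G)=p^b$ and $\max \mathrm{cd}(G)=p^e$. Suppose $c(G)=a_1p+a_2p^2+\cdots+a_rp^r$ with integers $0\le a_i<p$ for all $i$ and $a_r\neq 0$. Then $b\le r$. Further, if $d(Z(G))<p$, then $b\le r\le b+e$. The bounds are best possible, i.e. there exist groups $G$ satisfying the hypotheses (with $d(Z(G))<p$) for which $r=b$, and there exist such groups for which $r=b+e$.
   Context: $\exp(G)$ is the exponent of $G$; $\mathrm{cd}(G)=\{\chi(1)\mid \chi\in\mathrm{Irr}(G)\}$ is the set of degrees of irreducible complex characters of $G$; $d(H)$ is the minimal number of generators of a finite group $H$; $Z(G)$ is the center of $G$. A quasi-permutation matrix is a square matrix over $\mathbb{C}$ with non-negative integral trace. $c(G)$ denotes the minimal degree of a faithful representation of $G$ by complex quasi-permutation matrices, i.e. the least $n$ such that there is an injective homomorphism $G\to \mathrm{GL}_n(\mathbb{C})$ all of whose image elements have non-negative integer trace. *)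

theory Defs
  imports Complex_Main "HOL-Algebra.Generated_Groups" "Jordan_Normal_Form.VS_Connect"
begin

definition nonabelian_p_group :: "nat \<Rightarrow> ('a, 'b) monoid_scheme \<Rightarrow> bool" where
  "nonabelian_p_group p G \<longleftrightarrow>
     group G \<and> finite (carrier G) \<and> (\<exists>k. card (carrier G) = p ^ k) \<and> \<not> comm_group G"

definition group_exponent :: "('a, 'b) monoid_scheme \<Rightarrow> nat" where
  "group_exponent G = (LEAST m. m > 0 \<and> (\<forall>x\<in>carrier G. x [^]\<^bsub>G\<^esub> m = \<one>\<^bsub>G\<^esub>))"

definition center_group :: "('a, 'b) monoid_scheme \<Rightarrow> ('a, 'b) monoid_scheme" where
  "center_group G =
     G\<lparr>carrier := {z \<in> carrier G. \<forall>x\<in>carrier G. z \<otimes>\<^bsub>G\<^esub> x = x \<otimes>\<^bsub>G\<^esub> z}\<rparr>"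

definition min_generators :: "('a, 'b) monoid_scheme \<Rightarrow> nat" where
  "min_generators H =
     (LEAST k. \<exists>S. S \<subseteq> carrier H \<and> finite S \<and> card S = k \<and> generate H S = carrier H)"

abbreviation GL :: "nat \<Rightarrow> complex mat monoid" where
  "GL n \<equiv> units_of (ring_mat TYPE(complex) n ())"

definition mat_trace :: "'a::comm_monoid_add mat \<Rightarrow> 'a" where
  "mat_trace A = (\<Sum>i<dim_row A. A $$ (i, i))"

definition irreducible_rep :: "('a, 'b) monoid_scheme \<Rightarrow> nat \<Rightarrow> ('a \<Rightarrow> complex mat) \<Rightarrow> bool" where
  "irreducible_rep G n \<rho> \<longleftrightarrow>
     \<rho> \<in> hom G (GL n) \<and> n > 0 \<and>
     (\<forall>W. VectorSpace.subspace class_ring W (module_vec TYPE(complex) n) \<and>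
          (\<forall>g\<in>carrier G. \<forall>w\<in>W. \<rho> g *\<^sub>v w \<in> W)
        \<longrightarrow> W = {0\<^sub>v n} \<or> W = carrier_vec n)"

definition Irr :: "('a, 'b) monoid_scheme \<Rightarrow> ('a \<Rightarrow> complex) set" where
  "Irr G = {\<lambda>g\<in>carrier G. mat_trace (\<rho> g) |\<rho>. \<exists>n. irreducible_rep G n \<rho>}"

definition cd :: "('a, 'b) monoid_scheme \<Rightarrow> nat set" where
  "cd G = {m. \<exists>\<chi>\<in>Irr G. \<chi> \<one>\<^bsub>G\<^esub> = of_nat m}"

definition quasi_permutation_matrix :: "complex mat \<Rightarrow> bool" where
  "quasi_permutation_matrix A \<longleftrightarrow> square_mat A \<and> mat_trace A \<in> \<nat>"

definition min_quasi_perm_degree :: "('a, 'b) monoid_scheme \<Rightarrow> nat" where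
  "min_quasi_perm_degree G =
     (LEAST n. \<exists>\<rho>\<in>mon G (GL n). \<forall>g\<in>carrier G. quasi_permutation_matrix (\<rho> g))"

text \<open>Base-\<open>p\<close> expansion with no constant term; the values of \<open>a\<close> outside \<open>{1..r}\<close> are irrelevant.\<close>

definition p_expansion :: "nat \<Rightarrow> nat \<Rightarrow> nat \<Rightarrow> (nat \<Rightarrow> nat) \<Rightarrow> bool" where
  "p_expansion p m r a \<longleftrightarrow>
     r \<ge> 1 \<and> (\<forall>i\<in>{1..r}. a i < p) \<and> a r \<noteq> 0 \<and> m = (\<Sum>i=1..r. a i * p ^ i)"

end

theory Submission
  imports Defs "Jordan_Normal_Form.Schur_Decomposition" "HOL-Algebra.Multiplicative_Group"
    "HOL-Library.Nat_Bijection"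
begin

text \<open>
  A quasi-permutation representation of \<open>G\<close> is a faithful complex representation whose character has
  values in \<open>\<nat>\<close>; let \<open>c\<close> be its least degree. If \<open>c\<close> has a base-\<open>p\<close> expansion whose top digit belongs
  to \<open>p ^ r\<close>, then \<open>p ^ r \<le> c < p ^ (r + 1)\<close>, so \<open>b \<le> r\<close> follows from \<open>p ^ b \<le> c\<close>, and \<open>r \<le> b + e\<close> follows
  from \<open>c < p ^ (b + e + 1)\<close>.

  Lower bound. Let \<open>x\<close> have order \<open>p ^ b\<close>, with \<open>b > 0\<close>. As the representation is faithful, some primitive root of
  unity of order \<open>p ^ b\<close> is an eigenvalue of \<open>x\<close>, say with multiplicity at least \<open>l\<close>. The traces of all
  powers of \<open>x\<close> are natural numbers, and roots of unity of order \<open>p ^ b\<close> satisfy only the obvious integer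
  relations (Eisenstein's criterion). Hence eigenvalues that differ by a \<open>p\<close>-th root of unity have
  equal multiplicities, with a possible excess at the eigenvalue 1. Passing from \<open>x\<close> to \<open>x ^ p\<close>
  therefore multiplies the multiplicity of a primitive eigenvalue by \<open>p\<close>. After \<open>b - 1\<close> such steps an
  element of order \<open>p\<close> is left, where non-negativity of the trace gives every \<open>p\<close>-th root of unity at
  least the same multiplicity. Altogether the degree is at least \<open>l * p ^ b\<close>. This is the
  combinatorial lemma \<open>eigenvalue_multiplicities_bound\<close>, applied to representations in
  \<open>cyclic_action.degree_lower_bound\<close>.

  Upper bound. For a central \<open>x \<noteq> 1\<close> there are a subgroup \<open>H\<close> and a linear character \<open>\<mu>\<close> of \<open>H\<close> with
  \<open>\<mu> x \<noteq> 1\<close> that satisfy Mackey's criterion, so that the monomial representation induced from \<open>\<mu>\<close> is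
  irreducible (\<open>mackey_pair_nontrivial_at_central\<close>, \<open>mackey_pair_irreducible\<close>). Its degree, the index of
  \<open>H\<close>, is at most \<open>p ^ e\<close>, and the kernel of \<open>\<mu>\<close> has index at most \<open>p ^ b\<close> in \<open>H\<close>. So some subgroup of index
  at most \<open>p ^ (b + e)\<close> avoids \<open>x\<close>. Choosing such subgroups greedily, \<open>d\<close> of them suffice to separate the
  central elements of order \<open>p\<close> from 1, where \<open>d\<close> is the number of generators of the centre, because there are at
  most \<open>p ^ d\<close> central elements with \<open>p\<close>-th power 1. A nontrivial normal subgroup of a
  \<open>p\<close>-group meets the centre nontrivially, hence \<open>G\<close> acts faithfully on the disjoint union of the coset spaces, and
  \<open>c \<le> d * p ^ (b + e)\<close>, which is less than \<open>p ^ (b + e + 1)\<close> for \<open>d < p\<close>.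

  Sharpness. Both examples have exponent \<open>p ^ 2\<close>, cyclic centre, and an abelian subgroup of index \<open>p\<close>,
  so that \<open>b = 2\<close> and \<open>e = 1\<close>. The central product of a cyclic group of order \<open>p ^ 2\<close> with an extraspecial
  group of order \<open>p ^ 3\<close> has \<open>c = p ^ 3\<close>: its centre has exponent \<open>p ^ 2\<close>, and every faithful eigenvalue of a
  central generator has multiplicity divisible by \<open>p\<close>, since the generator's \<open>p\<close>-th power is a
  commutator. It contains a nonabelian group of order \<open>p ^ 3\<close> (dihedral for \<open>p = 2\<close>) with elements of
  order \<open>p ^ 2\<close> and a core-free subgroup of order \<open>p\<close>, which therefore has \<open>c = p ^ 2\<close>.
\<close>

section \<open>Integer relations between roots of unity of prime power order\<close>

text \<open>
  One factor, say \<open>h\<close>, has constant term prime to \<open>p\<close>. Then the lowest coefficient of \<open>g\<close> that is prime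
  to \<open>p\<close> produces a coefficient of \<open>g * h\<close> prime to \<open>p\<close> below its degree.
\<close>

lemma eisenstein_criterion:
  fixes F g h :: "int poly" and p :: int
  assumes p: "Factorial_Ring.prime p" and F: "F = g * h"
    and lead: "\<not> p dvd lead_coeff F"
    and low: "\<And>i. i < degree F \<Longrightarrow> p dvd Polynomial.coeff F i"
    and const: "\<not> p ^ 2 dvd Polynomial.coeff F 0"
  shows "degree g = 0 \<or> degree h = 0"
proof (rule ccontr)
  assume neg: "\<not> ?thesis"
  have False if F: "F = g * h" and dh: "degree h > 0" and h0: "\<not> p dvd Polynomial.coeff h 0"
    for g h :: "int poly"
  proof -
    have nz: "g \<noteq> 0" "h \<noteq> 0" using lead F by auto
    have "\<not> p dvd lead_coeff g"
      using lead unfolding F lead_coeff_mult by auto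
    then have ex: "\<exists>i. \<not> p dvd Polynomial.coeff g i" by blast
    define i where "i = (LEAST i. \<not> p dvd Polynomial.coeff g i)"
    have i: "\<not> p dvd Polynomial.coeff g i" unfolding i_def by (rule LeastI_ex[OF ex])
    have lt: "p dvd Polynomial.coeff g j" if "j < i" for j
      using not_less_Least[of j "\<lambda>i. \<not> p dvd Polynomial.coeff g i"] that unfolding i_def by blast
    have "i \<le> degree g" using i by (metis dvd_0_right coeff_eq_0 not_le)
    then have "i < degree F" using dh nz unfolding F by (simp add: degree_mult_eq)
    then have "p dvd Polynomial.coeff F i" by (rule low)
    also have "Polynomial.coeff F i = (\<Sum>j\<le>i. Polynomial.coeff g j * Polynomial.coeff h (i - j))"
      unfolding F coeff_mult ..
    also have "\<dots> = (\<Sum>j<i. Polynomial.coeff g j * Polynomial.coeff h (i - j))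
        + Polynomial.coeff g i * Polynomial.coeff h 0"
      by (simp add: lessThan_Suc_atMost[symmetric])
    finally have "p dvd (\<Sum>j<i. Polynomial.coeff g j * Polynomial.coeff h (i - j))
        + Polynomial.coeff g i * Polynomial.coeff h 0" .
    moreover have "p dvd (\<Sum>j<i. Polynomial.coeff g j * Polynomial.coeff h (i - j))"
      by (intro dvd_sum dvd_mult2) (auto intro: lt)
    ultimately have "p dvd Polynomial.coeff g i * Polynomial.coeff h 0"
      by (simp add: dvd_add_right_iff)
    with p i h0 show False by (simp add: prime_dvd_mult_iff)
  qed
  note step = this
  have "\<not> p dvd Polynomial.coeff g 0 \<or> \<not> p dvd Polynomial.coeff h 0"
    using const unfolding F by (auto simp: coeff_mult power2_eq_square mult_dvd_mono)
  moreover have "F = h * g" using F by (simp add: mult.commute)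
  ultimately show False using step[OF F] step[of h g] neg by auto
qed

lemma prime_dvd_add_power_diff:
  fixes x y :: "'a::comm_ring_1"
  assumes "Factorial_Ring.prime p"
  shows "of_nat p dvd (x + y) ^ p - x ^ p - y ^ p"
proof -
  have p: "p > 1" using assms by (rule prime_gt_1_nat)
  have "(x + y) ^ p = (\<Sum>k\<le>p. of_nat (p choose k) * x ^ k * y ^ (p - k))"
    by (rule binomial_ring)
  also have "{..p} = insert 0 (insert p {1..<p})" using p by auto
  finally have "(x + y) ^ p - x ^ p - y ^ p = (\<Sum>k\<in>{1..<p}. of_nat (p choose k) * x ^ k * y ^ (p - k))"
    using p by simp
  also have "of_nat p dvd \<dots>"
  proof (intro dvd_sum dvd_mult2)
    fix k assume "k \<in> {1..<p}"
    then have "p dvd (p choose k)"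
      using assms by (intro dvd_choose_prime) auto
    then show "(of_nat p :: 'a) dvd of_nat (p choose k)" by (metis dvd_def of_nat_mult)
  qed
  finally show ?thesis .
qed

lemma dvd_power_diff:
  fixes a b d :: "'a::comm_ring_1"
  assumes "d dvd a - b"
  shows "d dvd a ^ n - b ^ n"
  using assms power_diff_sumr2[of a n b] by auto

text \<open>
  The Frobenius endomorphism modulo \<open>p\<close>, written as a divisibility between integer polynomials.
\<close>

lemma linear_power_prime_power:
  assumes p: "Factorial_Ring.prime p"
  shows "(of_nat p :: int poly) dvd [:1, 1:] ^ (p ^ k) - 1 - Polynomial.monom 1 (p ^ k)"
proof (induction k)
  case 0
  have "[:1, 1:] = 1 + Polynomial.monom (1::int) 1" by (simp add: monom_Suc monom_0 one_pCons)
  then show ?case by simp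
next
  case (Suc k)
  let ?q = "p ^ k" and ?u = "[:1, 1:] :: int poly"
  have "(of_nat p :: int poly) dvd (?u ^ ?q) ^ p - (1 + Polynomial.monom 1 ?q) ^ p"
    by (rule dvd_power_diff) (use Suc.IH in \<open>simp add: algebra_simps\<close>)
  moreover have "(of_nat p :: int poly) dvd
      (1 + Polynomial.monom 1 ?q) ^ p - 1 ^ p - Polynomial.monom 1 ?q ^ p"
    by (rule prime_dvd_add_power_diff[OF p])
  ultimately have "(of_nat p :: int poly) dvd ((?u ^ ?q) ^ p - (1 + Polynomial.monom 1 ?q) ^ p) +
      ((1 + Polynomial.monom 1 ?q) ^ p - 1 ^ p - Polynomial.monom 1 ?q ^ p)"
    by (rule dvd_add)
  also have "\<dots> = ?u ^ (p ^ Suc k) - 1 - Polynomial.monom 1 (p ^ Suc k)"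
    by (simp add: monom_power power_mult[symmetric] mult.commute)
  finally show ?case .
qed

text \<open>
  For \<open>q\<close> a power of the prime \<open>p\<close> this is the cyclotomic polynomial of order \<open>p * q\<close> evaluated at
  \<open>X + 1\<close>; the shift makes it an Eisenstein polynomial.
\<close>

definition shifted_cyclotomic :: "nat \<Rightarrow> nat \<Rightarrow> int poly" where
  "shifted_cyclotomic p q = (\<Sum>i<p. [:1, 1:] ^ (i * q))"

lemma coeff_shifted_cyclotomic:
  "Polynomial.coeff (shifted_cyclotomic p q) n = (\<Sum>i<p. int (i * q choose n))"
proof -
  have "Polynomial.coeff ([:1, 1:] ^ m) n = int (m choose n)" for m
  proof -
    have "Polynomial.coeff ([:1, 1:] ^ m) n = (if n \<le> m then int (m choose n) else 0)"
      using coeff_linear_poly_power[of n m "1::int" 1] degree_linear_power[of "1::int" m]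
      by (auto intro: coeff_eq_0)
    then show ?thesis by auto
  qed
  then show ?thesis unfolding shifted_cyclotomic_def by (simp add: coeff_sum)
qed

lemma shifted_cyclotomic_top:
  assumes "p > 1" "q > 0"
  shows "degree (shifted_cyclotomic p q) = (p - 1) * q" "lead_coeff (shifted_cyclotomic p q) = 1"
proof -
  let ?F = "shifted_cyclotomic p q"
  obtain r where r: "p = Suc r" using assms by (cases p) auto
  have z: "Polynomial.coeff ?F n = (if n = r * q then 1 else 0)" if "n \<ge> r * q" for n
  proof -
    have "i * q choose n = 0" if "i < r" for i
      using \<open>n \<ge> r * q\<close> that assms by (intro binomial_eq_0) (metis le_trans mult_less_cancel2 nat_less_le not_le)
    then have "Polynomial.coeff ?F n = int (r * q choose n)"
      unfolding coeff_shifted_cyclotomic r by (simp del: binomial_eq_0_iff)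
    then show ?thesis using that by (auto simp: binomial_eq_0)
  qed
  have "degree ?F \<le> r * q" by (rule degree_le) (use z in auto)
  moreover have "Polynomial.coeff ?F (r * q) = 1" using z[of "r*q"] by simp
  ultimately show "degree ?F = (p - 1) * q" using r
    by (metis diff_Suc_1 le_antisym le_degree zero_neq_one)
  then show "lead_coeff ?F = 1" using \<open>Polynomial.coeff ?F (r * q) = 1\<close> r by simp
qed

text \<open>
  With \<open>q = p ^ k\<close>, modulo \<open>p\<close> both \<open>(X + 1) ^ q - 1\<close> and \<open>(X + 1) ^ (p * q) - 1\<close> are powers of \<open>X\<close>, hence so is their quotient.
\<close>

lemma shifted_cyclotomic_low:
  assumes p: "Factorial_Ring.prime p" and i: "i < (p - 1) * p ^ k"
  shows "int p dvd Polynomial.coeff (shifted_cyclotomic p (p ^ k)) i"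
proof -
  let ?q = "p ^ k" and ?u = "[:1, 1:] :: int poly" and ?P = "of_nat p :: int poly"
  define F where "F = shifted_cyclotomic p ?q"
  define T where "T = (Polynomial.monom 1 ?q :: int poly)"
  have p1: "p > 1" using p by (rule prime_gt_1_nat)
  have F: "F * (?u ^ ?q - 1) = ?u ^ (p ^ Suc k) - 1"
    unfolding F_def shifted_cyclotomic_def
    using power_diff_1_eq[of "?u ^ ?q" p]
    by (simp add: power_mult[symmetric] mult.commute)
  have Tp: "T ^ p = Polynomial.monom 1 (p ^ Suc k)" unfolding T_def by (simp add: monom_power mult.commute)
  have a: "?P dvd F * (?u ^ ?q - 1 - T)"
    using linear_power_prime_power[OF p, of k] unfolding T_def by (rule dvd_mult)
  have b: "?P dvd ?u ^ (p ^ Suc k) - 1 - T ^ p"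
    unfolding Tp by (rule linear_power_prime_power[OF p])
  have "?P dvd (?u ^ (p ^ Suc k) - 1 - T ^ p) - F * (?u ^ ?q - 1 - T)" using b a by (rule dvd_diff)
  also have "\<dots> = T * (F - T ^ (p - 1))"
    using F power_eq_if[of T p] p1 by (simp add: algebra_simps)
  finally have "[:int p:] dvd T * (F - T ^ (p - 1))" by (simp add: of_nat_poly)
  then have "int p dvd Polynomial.coeff (T * (F - T ^ (p - 1))) (i + ?q)"
    unfolding const_poly_dvd_iff by blast
  also have "\<dots> = Polynomial.coeff (F - T ^ (p - 1)) i"
    unfolding T_def by (simp add: coeff_monom_mult)
  also have "\<dots> = Polynomial.coeff F i"
    using i unfolding T_def by (simp add: monom_power mult.commute)
  finally show ?thesis unfolding F_def .
qed

text \<open>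
  A nonzero integer polynomial of least degree that vanishes at \<open>w - 1\<close> divides a multiple of the
  shifted cyclotomic polynomial, hence, after passing to primitive parts, that polynomial itself.
  Eisenstein's criterion leaves only the full degree. The hypothesis on \<open>w\<close> says that \<open>w\<close> is a primitive
  root of unity of order \<open>p * p ^ k\<close>.
\<close>

lemma degree_vanishing_at_prime_power_root:
  fixes w :: complex and r :: "int poly"
  assumes p: "Factorial_Ring.prime p" and w: "(\<Sum>i<p. w ^ (i * p ^ k)) = 0"
    and r0: "r \<noteq> 0" and r: "poly (of_int_poly r) w = 0"
  shows "(p - 1) * p ^ k \<le> degree r"
proof -
  define F where "F = shifted_cyclotomic p (p ^ k)"
  have p1: "p > 1" using p by (rule prime_gt_1_nat)
  have top: "degree F = (p - 1) * p ^ k" "lead_coeff F = 1"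
    unfolding F_def using shifted_cyclotomic_top[of p "p ^ k"] p1 by auto
  define y where "y = w - 1"
  have lin: "poly (of_int_poly ([:1, 1:] ^ n)) y = w ^ n" for n
  proof -
    have "of_int_poly ([:1, 1:] ^ n) = ([:1, 1:] :: complex poly) ^ n"
      by (simp only: of_int_poly_hom.hom_power) simp
    then show ?thesis by (simp only: poly_power) (simp add: y_def)
  qed
  have Fy: "poly (of_int_poly F) y = 0"
  proof -
    have "of_int_poly F = (\<Sum>i<p. of_int_poly ([:1, 1:] ^ (i * p ^ k)) :: complex poly)"
      unfolding F_def shifted_cyclotomic_def by (rule of_int_poly_hom.hom_sum)
    then show ?thesis using w by (simp only: poly_sum lin)
  qed
  have min: "degree F \<le> degree s" if "s \<noteq> 0" "poly (of_int_poly s) y = 0" for s :: "int poly"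
  proof -
    let ?Z = "\<lambda>s :: int poly. s \<noteq> 0 \<and> poly (of_int_poly s) y = 0"
    have "?Z s" using that by simp
    from ex_has_least_nat[of ?Z, OF this, of degree]
    obtain g where g: "?Z g" and gmin: "\<And>s. ?Z s \<Longrightarrow> degree g \<le> degree s" by blast
    \<comment> \<open>Since \<open>g\<close> has least degree, pseudo-division by it leaves no remainder.\<close>
    obtain q t where qt: "pseudo_divmod F g = (q, t)" by force
    define c where "c = Polynomial.coeff g (degree g) ^ (Suc (degree F) - degree g)"
    from pseudo_divmod[OF _ qt] g have eq: "Polynomial.smult c F = g * q + t"
      and t: "t = 0 \<or> degree t < degree g" by (auto simp: c_def)
    have c0: "c \<noteq> 0" using g by (simp add: c_def)
    have "poly (of_int_poly (Polynomial.smult c F)) y = poly (of_int_poly (g * q + t)) y" unfolding eq ..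
    then have "poly (of_int_poly t) y = 0" using g Fy by (simp add: of_int_poly_hom.hom_mult hom_distribs)
    then have "t = 0" using gmin[of t] t by fastforce
    then have eq: "Polynomial.smult c F = g * q" using eq by simp
    have "content F dvd lead_coeff F" by (rule content_dvd_coeff)
    then have "is_unit (content F)" using top(2) by simp
    then have "normalize (content F) = 1" by (rule is_unit_normalize)
    then have "content F = 1" by (simp only: normalize_content)
    then have "primitive_part F = F" using content_times_primitive_part[of F] by simp
    then have pp: "Polynomial.smult (unit_factor c) F = primitive_part g * primitive_part q"
      using arg_cong[OF eq, of primitive_part] by (simp add: primitive_part_mult primitive_part_smult)
    have unit: "unit_factor c * unit_factor c = 1" using c0 by (simp add: sgn_if)
    have "Polynomial.smult (unit_factor c) (Polynomial.smult (unit_factor c) F)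
        = Polynomial.smult (unit_factor c) (primitive_part g) * primitive_part q"
      unfolding pp mult_smult_left ..
    then have fac: "F = Polynomial.smult (unit_factor c) (primitive_part g) * primitive_part q"
      unfolding smult_smult unit smult_1_left .
    have "degree (Polynomial.smult (unit_factor c) (primitive_part g)) = 0 \<or> degree (primitive_part q) = 0"
    proof (rule eisenstein_criterion[OF _ fac])
      show "Factorial_Ring.prime (int p)" using p by simp
      show "\<not> int p dvd lead_coeff F" using top p1 by simp
      show "int p dvd Polynomial.coeff F i" if "i < degree F" for i
        using shifted_cyclotomic_low[OF p] that top unfolding F_def by simp
      have "Polynomial.coeff F 0 = int p" unfolding F_def coeff_shifted_cyclotomic by simp
      then show "\<not> (int p)\<^sup>2 dvd Polynomial.coeff F 0"
        using p1 by (auto simp: power2_eq_square zdvd_mult_cancel1)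
    qed
    then have "degree g = 0 \<or> degree q = 0" using c0 sgn_eq_0_iff[of c] by simp
    moreover have "degree g \<noteq> 0"
    proof
      assume "degree g = 0"
      then obtain d where "g = [:d:]" by (rule degree_eq_zeroE)
      then show False using g by (simp add: of_int_hom.map_poly_pCons_hom)
    qed
    ultimately have "degree q = 0" by simp
    have "degree F = degree (g * q)" unfolding eq[symmetric] degree_smult_eq using c0 by simp
    also have "\<dots> \<le> degree g" using degree_mult_le[of g q] \<open>degree q = 0\<close> by simp
    also have "\<dots> \<le> degree s" by (intro gmin conjI that)
    finally show ?thesis .
  qed
  have "poly (of_int_poly (r \<circ>\<^sub>p [:1, 1:])) y = 0"
    using r by (simp add: of_int_hom.map_poly_pcompose poly_pcompose y_def)
  moreover have "r \<circ>\<^sub>p [:1, 1:] \<noteq> 0" using r0 by (simp add: pcompose_eq_0_iff)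
  ultimately have "degree F \<le> degree (r \<circ>\<^sub>p [:1, 1:])" by (intro min)
  then show ?thesis using top by (simp add: degree_pcompose)
qed

lemma sum_split_blocks:
  fixes f :: "nat \<Rightarrow> 'a::comm_monoid_add"
  shows "(\<Sum>j<n * q. f j) = (\<Sum>i<n. \<Sum>s<q. f (i * q + s))"
proof -
  have "(\<Sum>s<q. f (i * q + s)) = sum f {i * q..<i * q + q}" for i
    using sum.shift_bounds_nat_ivl[of f 0 "i * q" q] by (simp add: lessThan_atLeast0 add.commute)
  then show ?thesis by (simp add: sum.nat_group)
qed

text \<open>
  Subtracting multiples of the relation expressing that the \<open>p\<close>-th roots of unity sum to 0
  removes the last block of \<open>p ^ k\<close> coefficients; the remaining polynomial has too small a
  degree to vanish at \<open>w\<close> unless it is 0.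
\<close>

lemma prime_power_root_relations:
  fixes w :: complex and c :: "nat \<Rightarrow> int"
  assumes p: "Factorial_Ring.prime p" and w1: "w ^ p ^ Suc k = 1" and w2: "w ^ p ^ k \<noteq> 1"
    and c: "(\<Sum>j<p ^ Suc k. of_int (c j) * w ^ j) = 0" and i: "i < p" and s: "s < p ^ k"
  shows "c (i * p ^ k + s) = c ((p - 1) * p ^ k + s)"
proof -
  define q where "q = p ^ k"
  have p1: "p > 1" using p by (rule prime_gt_1_nat)
  have pS: "p = Suc (p - 1)" using p1 by simp
  have Phi: "(\<Sum>i<p. w ^ (i * q)) = 0"
  proof -
    have "(w ^ q - 1) * (\<Sum>i<p. (w ^ q) ^ i) = (w ^ q) ^ p - 1" by (rule power_diff_1_eq[symmetric])
    also have "\<dots> = 0" using w1 by (simp add: q_def power_mult[symmetric] mult.commute)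
    finally show ?thesis using w2 by (simp add: q_def power_mult[symmetric] mult.commute)
  qed
  define d where "d j = c j - c ((p - 1) * q + j mod q)" for j
  define r where "r = (\<Sum>j<(p - 1) * q. Polynomial.monom (d j) j)"
  have coeff_r: "Polynomial.coeff r n = (if n < (p - 1) * q then d n else 0)" for n
    unfolding r_def coeff_sum coeff_monom by simp
  have "poly (of_int_poly r) w = (\<Sum>j<(p - 1) * q. of_int (d j) * w ^ j)"
    unfolding r_def of_int_poly_hom.hom_sum by (simp add: poly_sum poly_monom)
  also have "\<dots> = (\<Sum>i<p - 1. \<Sum>s<q. of_int (d (i * q + s)) * w ^ (i * q + s))"
    by (rule sum_split_blocks)
  also have "\<dots> = (\<Sum>i<p. \<Sum>s<q. of_int (d (i * q + s)) * w ^ (i * q + s))"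
    by (subst (2) pS) (simp add: d_def)
  also have "\<dots> = (\<Sum>i<p. \<Sum>s<q. of_int (c (i * q + s)) * w ^ (i * q + s))
      - (\<Sum>i<p. \<Sum>s<q. of_int (c ((p - 1) * q + s)) * w ^ (i * q + s))"
    by (simp add: d_def sum_subtractf left_diff_distrib)
  also have "(\<Sum>i<p. \<Sum>s<q. of_int (c (i * q + s)) * w ^ (i * q + s)) = 0"
    using c sum_split_blocks[of "\<lambda>j. of_int (c j) * w ^ j" p q] by (simp add: q_def)
  also have "(\<Sum>i<p. \<Sum>s<q. of_int (c ((p - 1) * q + s)) * w ^ (i * q + s))
      = (\<Sum>s<q. \<Sum>i<p. (of_int (c ((p - 1) * q + s)) * w ^ s) * w ^ (i * q))"
    by (subst sum.swap) (simp add: power_add mult_ac)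
  also have "\<dots> = 0" by (simp only: sum_distrib_left[symmetric] Phi) simp
  finally have root: "poly (of_int_poly r) w = 0" by simp
  have "r = 0"
  proof (rule ccontr)
    assume r0: "r \<noteq> 0"
    then have "(p - 1) * q \<le> degree r"
      using degree_vanishing_at_prime_power_root[OF p, of w k r] Phi root unfolding q_def by blast
    then have "lead_coeff r = 0" by (simp add: coeff_r)
    then show False using r0 by simp
  qed
  show ?thesis
  proof (cases "i < p - 1")
    case True
    have "i * q + s < (p - 1) * q"
    proof -
      have "i * q + s < Suc i * q" using s by (simp add: q_def)
      also have "\<dots> \<le> (p - 1) * q" using True by (intro mult_le_mono1) simp
      finally show ?thesis .
    qed
    then have "d (i * q + s) = 0" using coeff_r[of "i * q + s"] \<open>r = 0\<close> by simp
    then show ?thesis using s unfolding d_def q_def by simp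
  next
    case False
    then have "i = p - 1" using i by simp
    then show ?thesis by simp
  qed
qed

text \<open>
  Here \<open>m j\<close> is the multiplicity of \<open>w ^ j\<close> as an eigenvalue, and the sums are the traces of the powers. The
  induction replaces \<open>w\<close> by \<open>w ^ p\<close> and \<open>m\<close> by the multiplicities of the \<open>p\<close>-th power, in which the
  multiplicity of a primitive eigenvalue is \<open>p\<close> times as large. That traces are non-negative, and not
  just integers, enters only in the base case.
\<close>

lemma eigenvalue_multiplicities_bound:
  fixes w :: complex and m :: "nat \<Rightarrow> nat"
  assumes p: "Factorial_Ring.prime p" and "w ^ p ^ Suc k = 1" and "w ^ p ^ k \<noteq> 1"
    and "\<And>t. (\<Sum>j<p ^ Suc k. of_nat (m j) * w ^ (j * t)) \<in> \<nat>"
    and "j0 < p ^ Suc k" and "\<not> p dvd j0" and "l \<le> m j0"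
  shows "l * p ^ Suc k \<le> (\<Sum>j<p ^ Suc k. m j)"
  using assms(2-)
proof (induction k arbitrary: w m j0 l)
  case (0 w m j0 l)
  have p0: "p > 0" using p by (simp add: prime_gt_0_nat)
  from 0(3)[of 1] obtain f where f: "(\<Sum>j<p. of_nat (m j) * w ^ j) = of_nat f"
    by (auto simp: Nats_def)
  define c where "c j = int (m j) - (if j = 0 then int f else 0)" for j
  have "(\<Sum>j<p. of_int (c j) * w ^ j) = (\<Sum>j<p. of_nat (m j) * w ^ j) - (\<Sum>j<p. if j = 0 then of_nat f else 0)"
    unfolding sum_subtractf[symmetric] by (intro sum.cong) (auto simp: c_def)
  also have "\<dots> = 0" using p0 f by simp
  finally have sm: "(\<Sum>j<p ^ Suc 0. of_int (c j) * w ^ j) = 0" by simp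
  have eq: "c j = c (p - 1)" if "j < p" for j
    using prime_power_root_relations[OF p 0(1,2) sm that, of 0] by simp
  have j0: "j0 < p" "j0 \<noteq> 0" using 0 by (auto intro: gr0I)
  have m: "m j \<ge> m j0" if "j < p" for j
    using eq[OF that] eq[OF j0(1)] j0 by (auto simp: c_def split: if_splits)
  have "(\<Sum>j<p. l) \<le> (\<Sum>j<p. m j)"
    by (intro sum_mono) (use m 0(6) in fastforce)
  then show ?case by (simp add: mult.commute)
next
  case (Suc k w m j0 l)
  define q where "q = p ^ Suc k"
  have pq: "p ^ Suc (Suc k) = p * q" by (simp add: q_def)
  have p0: "p > 0" using p by (simp add: prime_gt_0_nat)
  have q0: "q > 0" using p0 by (simp add: q_def)
  from Suc.prems(3)[of 1] obtain f where f: "(\<Sum>j<p * q. of_nat (m j) * w ^ j) = of_nat f"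
    by (auto simp: Nats_def q_def)
  define c where "c j = int (m j) - (if j = 0 then int f else 0)" for j
  have "(\<Sum>j<p * q. of_int (c j) * w ^ j) = (\<Sum>j<p * q. of_nat (m j) * w ^ j) - (\<Sum>j<p * q. if j = 0 then of_nat f else 0)"
    unfolding sum_subtractf[symmetric] by (intro sum.cong) (auto simp: c_def)
  also have "\<dots> = 0" using p0 q0 f by simp
  finally have sm: "(\<Sum>j<p ^ Suc (Suc k). of_int (c j) * w ^ j) = 0" by (simp add: q_def)
  define s0 where "s0 = j0 mod q"
  have s0: "s0 < q" unfolding s0_def using q0 by simp
  have nd: "\<not> p dvd s0"
    using Suc.prems(5) unfolding s0_def q_def by (metis dvd_mod_iff dvd_triv_left power_Suc)
  have j0: "j0 = (j0 div q) * q + s0" "j0 div q < p"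
    using Suc.prems(4) unfolding s0_def pq by (auto simp: less_mult_imp_div_less)
  have m: "m (i * q + s0) = m j0" if "i < p" for i
  proof -
    have "c (i * q + s0) = c j0"
      using prime_power_root_relations[OF p Suc.prems(1,2) sm that, of s0]
        prime_power_root_relations[OF p Suc.prems(1,2) sm j0(2), of s0] s0 j0(1)
      by (simp add: q_def)
    moreover have "s0 \<noteq> 0" using nd by (intro notI) simp
    ultimately show ?thesis using j0(1) by (auto simp: c_def split: if_splits)
  qed
  \<comment> \<open>The \<open>p\<close> eigenvalues \<open>w ^ (i * q + s)\<close> with \<open>i < p\<close> are those with \<open>p\<close>-th power \<open>(w ^ p) ^ s\<close>.\<close>
  define m' where "m' s = (\<Sum>i<p. m (i * q + s))" for s
  have wq: "w ^ (q * p) = 1" using Suc.prems(1) by (simp add: q_def mult.commute)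
  have "(l * p) * p ^ Suc k \<le> (\<Sum>s<p ^ Suc k. m' s)"
  proof (rule Suc.IH[of "w ^ p"])
    show "(w ^ p) ^ p ^ Suc k = 1" using wq by (simp add: power_mult[symmetric] q_def mult.commute)
    show "(w ^ p) ^ p ^ k \<noteq> 1" using Suc.prems(2) by (simp add: power_mult[symmetric])
    show "(\<Sum>s<p ^ Suc k. of_nat (m' s) * (w ^ p) ^ (s * t)) \<in> \<nat>" for t
    proof -
      have "(\<Sum>s<q. of_nat (m' s) * (w ^ p) ^ (s * t))
          = (\<Sum>s<q. \<Sum>i<p. of_nat (m (i * q + s)) * w ^ ((i * q + s) * (p * t)))"
      proof (intro sum.cong refl)
        fix s
        have "w ^ ((i * q + s) * (p * t)) = (w ^ p) ^ (s * t)" for i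
        proof -
          have "(i * q + s) * (p * t) = (q * p) * (i * t) + p * (s * t)" by (simp add: algebra_simps)
          then show ?thesis by (simp add: power_add power_mult wq[unfolded power_mult])
        qed
        then show "of_nat (m' s) * (w ^ p) ^ (s * t) = (\<Sum>i<p. of_nat (m (i * q + s)) * w ^ ((i * q + s) * (p * t)))"
          by (simp add: m'_def sum_distrib_right)
      qed
      also have "\<dots> = (\<Sum>j<p * q. of_nat (m j) * w ^ (j * (p * t)))"
        by (subst sum.swap) (simp add: sum_split_blocks)
      also have "\<dots> \<in> \<nat>" using Suc.prems(3)[of "p * t"] unfolding pq .
      finally show ?thesis unfolding q_def .
    qed
    show "s0 < p ^ Suc k" using s0 by (simp add: q_def)
    show "\<not> p dvd s0" by (rule nd)
    have "m' s0 = p * m j0" unfolding m'_def using m by simp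
    then show "l * p \<le> m' s0" using Suc.prems(6) by (simp add: mult.commute)
  qed
  also have "(\<Sum>s<p ^ Suc k. m' s) = (\<Sum>j<p * q. m j)"
    unfolding m'_def sum_split_blocks q_def by (rule sum.swap)
  finally show ?case unfolding pq q_def by (simp add: mult.assoc)
qed

section \<open>Traces and isotypic projections\<close>

lemma mat_trace_mult_commute:
  fixes A B :: "'a::comm_semiring_1 mat"
  assumes "A \<in> carrier_mat n m" "B \<in> carrier_mat m n"
  shows "mat_trace (A * B) = mat_trace (B * A)"
proof -
  have "mat_trace (A * B) = (\<Sum>i<n. \<Sum>j<m. A $$ (i, j) * B $$ (j, i))"
    using assms unfolding mat_trace_def
    by (auto simp: scalar_prod_def lessThan_atLeast0 intro!: sum.cong)
  also have "\<dots> = (\<Sum>j<m. \<Sum>i<n. B $$ (j, i) * A $$ (i, j))"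
    by (subst sum.swap) (simp add: mult.commute)
  also have "\<dots> = mat_trace (B * A)"
    using assms unfolding mat_trace_def
    by (auto simp: scalar_prod_def lessThan_atLeast0 intro!: sum.cong)
  finally show ?thesis .
qed

text \<open>
  In a triangular form of \<open>E\<close> the diagonal entries are 0 or 1, so the trace counts the ones; a nonzero
  column of \<open>E\<close> is an eigenvector for 1.
\<close>

lemma mat_trace_idempotent:
  fixes E :: "complex mat"
  assumes E: "E \<in> carrier_mat n n" and idem: "E * E = E"
  shows "mat_trace E \<in> \<nat>" "E \<noteq> 0\<^sub>m n n \<Longrightarrow> mat_trace E \<noteq> 0"
proof -
  obtain es where es: "char_poly E = (\<Prod>a\<leftarrow>es. [:- a, 1:])" "length es = n"
    using char_poly_factorized[OF E] by blast
  obtain B P Q where "schur_decomposition E es = (B, P, Q)" by (metis prod_cases3)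
  from schur_decomposition[OF E es(1) this]
  have wit: "similar_mat_wit E B P Q" and up: "upper_triangular B" and diag: "diag_mat B = es" by auto
  note w = similar_mat_witD2[OF E wit]
  have trB: "mat_trace E = mat_trace B"
  proof -
    have "mat_trace E = mat_trace (P * (B * Q))" using w by simp
    also have "\<dots> = mat_trace (B * Q * P)"
      by (rule mat_trace_mult_commute) (use w in auto)
    also have "B * Q * P = B * (Q * P)" using w(5,6,7) by (rule_tac assoc_mult_mat) auto
    also have "\<dots> = B" using w by simp
    finally show ?thesis .
  qed
  have BB: "B * B = B"
  proof -
    note assoc = assoc_mult_mat[of _ n n _ n _ n]
    have EP: "E * P = P * B"
    proof -
      have "E * P = P * B * (Q * P)" using w(5-7) by (subst w(3)) (simp add: assoc)
      then show ?thesis using w by simp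
    qed
    have "P * (B * B) = E * P * B" unfolding EP using w(5,6) by (simp add: assoc)
    also have "\<dots> = E * (E * P)" using w(4-6) by (simp add: assoc EP[symmetric])
    also have "\<dots> = E * E * P" using w(4,6) by (simp add: assoc)
    also have "\<dots> = P * B" unfolding idem by (rule EP)
    finally have "Q * P * (B * B) = Q * P * B" using w(5-7) by (simp add: assoc)
    then show ?thesis using w by simp
  qed
  have d01: "B $$ (i, i) \<in> {0, 1}" if i: "i < n" for i
  proof -
    have "B $$ (i, i) = (B * B) $$ (i, i)" using BB by simp
    also have "\<dots> = (\<Sum>j<n. B $$ (i, j) * B $$ (j, i))"
      using i w(5) by (simp add: scalar_prod_def lessThan_atLeast0)
    also have "\<dots> = (\<Sum>j<n. if j = i then B $$ (i, i) * B $$ (i, i) else 0)"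
    proof (intro sum.cong refl)
      fix j assume "j \<in> {..<n}"
      then show "B $$ (i, j) * B $$ (j, i) = (if j = i then B $$ (i, i) * B $$ (i, i) else 0)"
        using up i w(5) unfolding upper_triangular_def by (cases i j rule: linorder_cases) auto
    qed
    also have "\<dots> = B $$ (i, i) * B $$ (i, i)" using i by simp
    finally show ?thesis by auto
  qed
  have tr: "mat_trace E = of_nat (card {i. i < n \<and> B $$ (i, i) = 1})"
  proof -
    have "mat_trace B = (\<Sum>i<n. if B $$ (i, i) = 1 then 1 else 0)"
      unfolding mat_trace_def using w(5) d01 by (intro sum.cong) auto
    also have "\<dots> = of_nat (card {i. i < n \<and> B $$ (i, i) = 1})"
      by (subst sum.If_cases) (auto simp: Collect_conj_eq lessThan_def)
    finally show ?thesis using trB by simp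
  qed
  then show "mat_trace E \<in> \<nat>" by simp
  show "mat_trace E \<noteq> 0" if nz: "E \<noteq> 0\<^sub>m n n"
  proof -
    obtain i j where ij: "i < n" "j < n" "E $$ (i, j) \<noteq> 0" 
    proof -
      have "\<not> (\<forall>i<n. \<forall>j<n. E $$ (i, j) = 0)"
        using nz E by (auto intro!: eq_matI)
      then show ?thesis using that by blast
    qed
    have "eigenvector E (col E j) 1"
      unfolding eigenvector_def
    proof (intro conjI)
      show "col E j \<in> carrier_vec (dim_row E)" by (simp add: carrier_vecI)
      show "col E j \<noteq> 0\<^sub>v (dim_row E)"
      proof
        assume "col E j = 0\<^sub>v (dim_row E)"
        then have "col E j $ i = 0" using ij E by simp
        then show False using ij E by simp
      qed
      have "E *\<^sub>v col E j = col (E * E) j" using E ij by (intro eq_vecI) auto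
      then show "E *\<^sub>v col E j = 1 \<cdot>\<^sub>v col E j" using idem by simp
    qed
    then have "poly (char_poly E) 1 = 0"
      using eigenvalue_root_char_poly[OF E] unfolding eigenvalue_def by blast
    then have "1 \<in> set es" unfolding es poly_prod_list by (auto simp: prod_list_zero_iff)
    then have "1 \<in> set (diag_mat B)" using diag by simp
    then have "{i. i < n \<and> B $$ (i, i) = 1} \<noteq> {}" using w(5) unfolding diag_mat_def by auto
    then show ?thesis using tr by simp
  qed
qed

text \<open>
  Hides the module records, which the next two lemmas replace by closure conditions.
\<close>

definition vec_subspace :: "nat \<Rightarrow> complex vec set \<Rightarrow> bool" where
  "vec_subspace n W \<longleftrightarrow> VectorSpace.subspace class_ring W (module_vec TYPE(complex) n)"

lemma vec_subspaceD:
  assumes "vec_subspace n W"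
  shows "W \<subseteq> carrier_vec n" "0\<^sub>v n \<in> W"
    "\<And>v w. v \<in> W \<Longrightarrow> w \<in> W \<Longrightarrow> v + w \<in> W" "\<And>c w. w \<in> W \<Longrightarrow> c \<cdot>\<^sub>v w \<in> W"
proof -
  interpret vec_space "TYPE(complex)" n .
  have sub: "submodule class_ring W (module_vec TYPE(complex) n)"
    using assms unfolding vec_subspace_def VectorSpace.subspace_def by simp
  show "W \<subseteq> carrier_vec n" "0\<^sub>v n \<in> W" "\<And>v w. v \<in> W \<Longrightarrow> w \<in> W \<Longrightarrow> v + w \<in> W"
    "\<And>c w. w \<in> W \<Longrightarrow> c \<cdot>\<^sub>v w \<in> W"
    using sub unfolding submodule_def by (auto simp: module_vec_simps class_field_def class_ring_simps)
qed

lemma vec_subspaceI: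
  assumes "W \<subseteq> carrier_vec n" "0\<^sub>v n \<in> W"
    "\<And>v w. v \<in> W \<Longrightarrow> w \<in> W \<Longrightarrow> v + w \<in> W" "\<And>c w. w \<in> W \<Longrightarrow> c \<cdot>\<^sub>v w \<in> W"
  shows "vec_subspace n W"
proof -
  interpret vec_space "TYPE(complex)" n .
  show ?thesis unfolding vec_subspace_def VectorSpace.subspace_def submodule_def
    using assms vectorspace_axioms module_axioms by (auto simp: module_vec_simps class_ring_simps)
qed

lemma vec_subspace_sum:
  assumes W: "vec_subspace n W" and "finite I" and "\<And>i. i \<in> I \<Longrightarrow> f i \<in> W"
  shows "vec n (\<lambda>k. \<Sum>i\<in>I. f i $ k) \<in> W"
  using assms(2,3)
proof (induction I)
  case empty
  have "vec n (\<lambda>k. \<Sum>i\<in>{}. f i $ k) = 0\<^sub>v n" by auto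
  then show ?case using vec_subspaceD[OF W] by simp
next
  case (insert i I)
  have "f i \<in> carrier_vec n" using insert.prems vec_subspaceD(1)[OF W] by auto
  then have "vec n (\<lambda>k. \<Sum>i\<in>insert i I. f i $ k) = f i + vec n (\<lambda>k. \<Sum>i\<in>I. f i $ k)"
    using insert.hyps by (intro eq_vecI) auto
  then show ?case using insert vec_subspaceD(3)[OF W] by simp
qed

text \<open>
  The standard projection to the common eigenspace with eigenvalues \<open>\<chi>\<close>, for a finite group acting
  through \<open>\<rho>\<close>. The group is only an index set \<open>I\<close>, which allows residues modulo \<open>N\<close> and pairs of
  residues as well as subgroups.
\<close>

definition isotypic_projection ::
    "nat \<Rightarrow> 'i set \<Rightarrow> ('i \<Rightarrow> complex) \<Rightarrow> ('i \<Rightarrow> complex mat) \<Rightarrow> complex mat" where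
  "isotypic_projection n I \<chi> \<rho> = mat n n (\<lambda>(k, l). (\<Sum>i\<in>I. inverse (\<chi> i) * \<rho> i $$ (k, l)) / of_nat (card I))"

lemma isotypic_projection_carrier [simp]: "isotypic_projection n I \<chi> \<rho> \<in> carrier_mat n n"
  unfolding isotypic_projection_def by simp

lemma mat_trace_isotypic_projection:
  assumes "\<And>i. i \<in> I \<Longrightarrow> \<rho> i \<in> carrier_mat n n"
  shows "mat_trace (isotypic_projection n I \<chi> \<rho>) = (\<Sum>i\<in>I. inverse (\<chi> i) * mat_trace (\<rho> i)) / of_nat (card I)"
proof -
  have "mat_trace (isotypic_projection n I \<chi> \<rho>)
      = (\<Sum>k<n. \<Sum>i\<in>I. inverse (\<chi> i) * \<rho> i $$ (k, k)) / of_nat (card I)"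
    unfolding mat_trace_def isotypic_projection_def by (simp add: sum_divide_distrib)
  also have "(\<Sum>k<n. \<Sum>i\<in>I. inverse (\<chi> i) * \<rho> i $$ (k, k)) = (\<Sum>i\<in>I. inverse (\<chi> i) * mat_trace (\<rho> i))"
    using assms unfolding mat_trace_def
    by (subst sum.swap) (auto simp: sum_distrib_left intro!: sum.cong)
  finally show ?thesis .
qed

lemma isotypic_projection_mult_vec:
  assumes "\<And>i. i \<in> I \<Longrightarrow> \<rho> i \<in> carrier_mat n n" and w: "w \<in> carrier_vec n" and fin: "finite I"
  shows "isotypic_projection n I \<chi> \<rho> *\<^sub>v w
    = vec n (\<lambda>k. \<Sum>i\<in>I. ((inverse (\<chi> i) / of_nat (card I)) \<cdot>\<^sub>v (\<rho> i *\<^sub>v w)) $ k)"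
proof (rule eq_vecI)
  fix k assume "k < dim_vec (vec n (\<lambda>k. \<Sum>i\<in>I. ((inverse (\<chi> i) / of_nat (card I)) \<cdot>\<^sub>v (\<rho> i *\<^sub>v w)) $ k))"
  then have k: "k < n" by simp
  have "(isotypic_projection n I \<chi> \<rho> *\<^sub>v w) $ k
      = (\<Sum>l<n. (\<Sum>i\<in>I. inverse (\<chi> i) * \<rho> i $$ (k, l)) / of_nat (card I) * w $ l)"
    using k w unfolding isotypic_projection_def by (simp add: scalar_prod_def lessThan_atLeast0)
  also have "\<dots> = (\<Sum>i\<in>I. \<Sum>l<n. (inverse (\<chi> i) / of_nat (card I)) * (\<rho> i $$ (k, l) * w $ l))"
    by (subst sum.swap) (simp add: sum_distrib_right sum_divide_distrib sum_distrib_left mult_ac)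
  also have "\<dots> = (\<Sum>i\<in>I. ((inverse (\<chi> i) / of_nat (card I)) \<cdot>\<^sub>v (\<rho> i *\<^sub>v w)) $ k)"
  proof (intro sum.cong refl)
    fix i assume "i \<in> I"
    then have "\<rho> i \<in> carrier_mat n n" by (rule assms(1))
    then show "(\<Sum>l<n. (inverse (\<chi> i) / of_nat (card I)) * (\<rho> i $$ (k, l) * w $ l))
      = ((inverse (\<chi> i) / of_nat (card I)) \<cdot>\<^sub>v (\<rho> i *\<^sub>v w)) $ k"
      using k w by (simp add: scalar_prod_def lessThan_atLeast0 sum_distrib_left)
  qed
  finally show "(isotypic_projection n I \<chi> \<rho> *\<^sub>v w) $ k
    = vec n (\<lambda>k. \<Sum>i\<in>I. ((inverse (\<chi> i) / of_nat (card I)) \<cdot>\<^sub>v (\<rho> i *\<^sub>v w)) $ k) $ k" using k by simp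
qed (simp add: isotypic_projection_def)

lemma isotypic_projection_in_subspace:
  assumes W: "vec_subspace n W" and "finite I" and "\<And>i. i \<in> I \<Longrightarrow> \<rho> i \<in> carrier_mat n n"
    and w: "w \<in> W" and inv: "\<And>i. i \<in> I \<Longrightarrow> \<rho> i *\<^sub>v w \<in> W"
  shows "isotypic_projection n I \<chi> \<rho> *\<^sub>v w \<in> W"
proof -
  have "w \<in> carrier_vec n" using w vec_subspaceD(1)[OF W] by auto
  then show ?thesis using assms
    by (subst isotypic_projection_mult_vec) (auto intro!: vec_subspace_sum vec_subspaceD(4)[OF W])
qed

text \<open>
  The group structure on \<open>I\<close> enters through its translations: they map \<open>I\<close> injectively, hence
  bijectively, to itself.
\<close>

locale averaging =
  fixes n :: nat and I :: "'i set" and opr :: "'i \<Rightarrow> 'i \<Rightarrow> 'i"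
    and \<chi> :: "'i \<Rightarrow> complex" and \<rho> :: "'i \<Rightarrow> complex mat"
  assumes fin: "finite I" and nonempty: "I \<noteq> {}"
    and opr_closed: "\<And>i j. i \<in> I \<Longrightarrow> j \<in> I \<Longrightarrow> opr i j \<in> I"
    and opr_inj: "\<And>i. i \<in> I \<Longrightarrow> inj_on (opr i) I"
    and rho_carrier: "\<And>i. i \<in> I \<Longrightarrow> \<rho> i \<in> carrier_mat n n"
    and rho_mult: "\<And>i j. i \<in> I \<Longrightarrow> j \<in> I \<Longrightarrow> \<rho> (opr i j) = \<rho> i * \<rho> j"
    and chi_mult: "\<And>i j. i \<in> I \<Longrightarrow> j \<in> I \<Longrightarrow> \<chi> (opr i j) = \<chi> i * \<chi> j"
    and chi_nonzero: "\<And>i. i \<in> I \<Longrightarrow> \<chi> i \<noteq> 0"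
begin

abbreviation "E \<equiv> isotypic_projection n I \<chi> \<rho>"

lemma rho_E:
  assumes i: "i \<in> I" shows "\<rho> i * E = \<chi> i \<cdot>\<^sub>m E"
proof (rule eq_matI)
  fix k l assume "k < dim_row (\<chi> i \<cdot>\<^sub>m E)" "l < dim_col (\<chi> i \<cdot>\<^sub>m E)"
  then have kl: "k < n" "l < n" by (auto simp: isotypic_projection_def)
  have "(\<rho> i * E) $$ (k, l) = (\<Sum>s<n. \<rho> i $$ (k, s) * ((\<Sum>j\<in>I. inverse (\<chi> j) * \<rho> j $$ (s, l)) / of_nat (card I)))"
    using kl rho_carrier[OF i] unfolding isotypic_projection_def
    by (simp add: scalar_prod_def lessThan_atLeast0)
  also have "\<dots> = (\<Sum>j\<in>I. \<Sum>s<n. inverse (\<chi> j) * (\<rho> i $$ (k, s) * \<rho> j $$ (s, l))) / of_nat (card I)"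
    by (subst sum.swap) (simp add: sum_distrib_left sum_divide_distrib mult_ac)
  also have "(\<Sum>j\<in>I. \<Sum>s<n. inverse (\<chi> j) * (\<rho> i $$ (k, s) * \<rho> j $$ (s, l)))
      = (\<Sum>j\<in>I. \<chi> i * (inverse (\<chi> (opr i j)) * \<rho> (opr i j) $$ (k, l)))"
  proof (intro sum.cong refl)
    fix j assume j: "j \<in> I"
    have "\<rho> (opr i j) $$ (k, l) = (\<Sum>s<n. \<rho> i $$ (k, s) * \<rho> j $$ (s, l))"
      unfolding rho_mult[OF i j] using kl rho_carrier[OF i] rho_carrier[OF j]
      by (simp add: scalar_prod_def lessThan_atLeast0)
    then show "(\<Sum>s<n. inverse (\<chi> j) * (\<rho> i $$ (k, s) * \<rho> j $$ (s, l)))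
        = \<chi> i * (inverse (\<chi> (opr i j)) * \<rho> (opr i j) $$ (k, l))"
      using chi_nonzero[OF i] chi_nonzero[OF j] unfolding chi_mult[OF i j]
      by (simp add: sum_distrib_left field_simps)
  qed
  also have "\<dots> = \<chi> i * (\<Sum>j\<in>I. inverse (\<chi> j) * \<rho> j $$ (k, l))"
  proof -
    have "opr i ` I = I" using endo_inj_surj[OF fin _ opr_inj[OF i]] opr_closed[OF i] by auto
    then have "bij_betw (opr i) I I" using opr_inj[OF i] unfolding bij_betw_def by simp
    then show ?thesis
      unfolding sum_distrib_left
      by (rule sum.reindex_bij_betw[of "opr i" I I "\<lambda>j. \<chi> i * (inverse (\<chi> j) * \<rho> j $$ (k, l))"])
  qed
  finally show "(\<rho> i * E) $$ (k, l) = (\<chi> i \<cdot>\<^sub>m E) $$ (k, l)"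
    using kl unfolding isotypic_projection_def by simp
qed (use rho_carrier[OF i] in \<open>auto simp: isotypic_projection_def\<close>)

lemma rho_E_vec:
  assumes i: "i \<in> I" and w: "w \<in> carrier_vec n"
  shows "\<rho> i *\<^sub>v (E *\<^sub>v w) = \<chi> i \<cdot>\<^sub>v (E *\<^sub>v w)"
proof -
  have "\<rho> i *\<^sub>v (E *\<^sub>v w) = (\<rho> i * E) *\<^sub>v w"
    using rho_carrier[OF i] w by (intro assoc_mult_mat_vec[symmetric, of _ n n _ n]) auto
  also have "\<dots> = \<chi> i \<cdot>\<^sub>v (E *\<^sub>v w)"
    unfolding rho_E[OF i] using w
    by (intro eq_vecI) (simp_all add: scalar_prod_def sum_distrib_left mult.assoc carrier_matD[OF isotypic_projection_carrier])
  finally show ?thesis .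
qed

lemma E_idempotent: "E * E = E"
proof (rule eq_matI)
  fix k l assume "k < dim_row E" "l < dim_col E"
  then have kl: "k < n" "l < n" by (auto simp: isotypic_projection_def)
  have "(E * E) $$ (k, l) = (\<Sum>s<n. ((\<Sum>j\<in>I. inverse (\<chi> j) * \<rho> j $$ (k, s)) / of_nat (card I)) * E $$ (s, l))"
    using kl by (simp add: scalar_prod_def lessThan_atLeast0 isotypic_projection_def)
  also have "\<dots> = (\<Sum>j\<in>I. inverse (\<chi> j) * (\<Sum>s<n. \<rho> j $$ (k, s) * E $$ (s, l))) / of_nat (card I)"
    unfolding sum_distrib_left by (subst sum.swap) (simp add: sum_distrib_right sum_divide_distrib sum_distrib_left mult_ac)
  also have "(\<Sum>j\<in>I. inverse (\<chi> j) * (\<Sum>s<n. \<rho> j $$ (k, s) * E $$ (s, l))) = (\<Sum>j\<in>I. E $$ (k, l))"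
  proof (intro sum.cong refl)
    fix j assume j: "j \<in> I"
    have "(\<Sum>s<n. \<rho> j $$ (k, s) * E $$ (s, l)) = (\<rho> j * E) $$ (k, l)"
      using kl rho_carrier[OF j] by (simp add: scalar_prod_def lessThan_atLeast0 isotypic_projection_def)
    also have "\<dots> = \<chi> j * E $$ (k, l)" unfolding rho_E[OF j] using kl by (simp add: isotypic_projection_def)
    finally show "inverse (\<chi> j) * (\<Sum>s<n. \<rho> j $$ (k, s) * E $$ (s, l)) = E $$ (k, l)"
      using chi_nonzero[OF j] by simp
  qed
  also have "\<dots> / of_nat (card I) = E $$ (k, l)" using fin nonempty by simp
  finally show "(E * E) $$ (k, l) = E $$ (k, l)" .
qed (auto simp: isotypic_projection_def)

lemma E_trace_natural: "mat_trace E \<in> \<nat>"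
  by (rule mat_trace_idempotent(1)[OF isotypic_projection_carrier E_idempotent])

end

definition primitive_root :: "nat \<Rightarrow> complex \<Rightarrow> bool" where
  "primitive_root N w \<longleftrightarrow> (\<forall>t. w ^ t = 1 \<longleftrightarrow> N dvd t)"

lemma primitive_root_exists:
  assumes "N > 0" shows "\<exists>w. primitive_root N w"
proof -
  have "cis (2 * pi / real N) ^ t = 1 \<longleftrightarrow> N dvd t" for t
  proof
    assume "cis (2 * pi / real N) ^ t = 1"
    then have "cos (real t * (2 * pi / real N)) = 1"
      by (simp add: DeMoivre complex_eq_iff)
    then obtain x :: int where "real t * (2 * pi / real N) = real_of_int x * 2 * pi"
      using cos_one_2pi_int by auto
    then have "real t = real_of_int x * real N" using assms by (simp add: field_simps)
    then have "int t = x * int N" by (metis of_int_eq_iff of_int_mult of_int_of_nat_eq)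
    then have "int N dvd int t" by simp
    then show "N dvd t" by simp
  next
    assume "N dvd t"
    then obtain k where "t = N * k" by auto
    then show "cis (2 * pi / real N) ^ t = 1"
      using assms cis_multiple_2pi[of "real k"] by (simp add: DeMoivre mult_ac)
  qed
  then show ?thesis unfolding primitive_root_def by blast
qed

lemma primitive_root_sum:
  assumes w: "primitive_root N w" and "N > 0" and "t < N"
  shows "(\<Sum>j<N. inverse (w ^ (j * t))) = (if t = 0 then of_nat N else 0)"
proof (cases "t = 0")
  case False
  define u where "u = inverse (w ^ t)"
  have "w ^ t \<noteq> 1" using w assms False unfolding primitive_root_def by (auto dest: dvd_imp_le)
  then have "u \<noteq> 1" unfolding u_def by (metis inverse_1 inverse_inverse_eq)
  have "w ^ (t * N) = 1" using w unfolding primitive_root_def by simp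
  then have "u ^ N = 1" unfolding u_def by (simp add: power_mult power_inverse)
  have "(u - 1) * (\<Sum>j<N. u ^ j) = u ^ N - 1" by (rule power_diff_1_eq[symmetric])
  then have "(\<Sum>j<N. u ^ j) = 0" using \<open>u \<noteq> 1\<close> \<open>u ^ N = 1\<close> by simp
  then show ?thesis using False by (simp add: u_def power_inverse power_mult[symmetric] mult.commute)
qed simp

lemma add_mod_inj: "inj_on (\<lambda>t. (s + t) mod N) {..<N :: nat}"
proof (rule inj_onI)
  fix t u assume tu: "t \<in> {..<N}" "u \<in> {..<N}" and "(s + t) mod N = (s + u) mod N"
  then have "(int s + int t) mod int N = (int s + int u) mod int N"
    by (metis of_nat_add of_nat_mod)
  then have "int N dvd (int s + int t) - (int s + int u)" by (simp only: mod_eq_dvd_iff)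
  then have "int t mod int N = int u mod int N" by (simp add: mod_eq_dvd_iff)
  then show "t = u" using tu by simp
qed

text \<open>
  \<open>R t\<close> is the action of the \<open>t\<close>-th power of an element whose order divides \<open>N\<close>; the projections \<open>P j\<close> below
  belong to the eigenvalues \<open>w ^ j\<close>.
\<close>

locale cyclic_action =
  fixes n N :: nat and w :: complex and R :: "nat \<Rightarrow> complex mat"
  assumes N_pos: "N > 0" and root: "primitive_root N w"
    and R_carrier: "\<And>t. R t \<in> carrier_mat n n"
    and R_add: "\<And>s t. R (s + t) = R s * R t"
    and R_0: "R 0 = 1\<^sub>m n" and R_N: "R N = 1\<^sub>m n"
begin

abbreviation "P j \<equiv> isotypic_projection n {..<N} (\<lambda>t. w ^ (j * t)) R"

lemma R_mod: "R (t mod N) = R t"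
proof -
  have R1: "R (N * k) = 1\<^sub>m n" for k
  proof (induction k)
    case (Suc k)
    then show ?case using R_add[of N "N * k"] R_N by simp
  qed (use R_0 in simp)
  have "R t = R (N * (t div N) + t mod N)" by simp
  also have "\<dots> = R (t mod N)" unfolding R_add R1 using R_carrier[of "t mod N"] by simp
  finally show ?thesis by simp
qed

lemma w_nonzero: "w \<noteq> 0" and w_N: "w ^ N = 1"
proof -
  show "w ^ N = 1" using root unfolding primitive_root_def by simp
  then show "w \<noteq> 0" using N_pos by (metis power_0_left less_numeral_extra(3) zero_neq_one)
qed

lemma w_mod: "w ^ (j * (t mod N)) = w ^ (j * t)"
proof -
  have "j * t = j * (N * (t div N) + t mod N)" by simp
  also have "\<dots> = N * (j * (t div N)) + j * (t mod N)" by (simp only: distrib_left mult_ac)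
  finally have "w ^ (j * t) = (w ^ N) ^ (j * (t div N)) * w ^ (j * (t mod N))"
    by (simp only: power_add power_mult)
  then show ?thesis using w_N by simp
qed

sublocale averaging n "{..<N}" "\<lambda>s t. (s + t) mod N" "\<lambda>t. w ^ (j * t)" R for j
proof
  show "w ^ (j * ((s + t) mod N)) = w ^ (j * s) * w ^ (j * t)" for s t
    unfolding w_mod by (simp add: algebra_simps power_add)
qed (use N_pos R_carrier w_nonzero in \<open>auto simp: R_mod R_add intro!: add_mod_inj\<close>)

lemma R_P: "R t * P j = w ^ (j * t) \<cdot>\<^sub>m P j"
  using rho_E[of "t mod N" j] N_pos by (simp add: R_mod w_mod)

lemma sum_P:
  assumes "k < n" "l < n"
  shows "(\<Sum>j<N. P j $$ (k, l)) = (if k = l then 1 else 0)"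
proof -
  have "(\<Sum>j<N. P j $$ (k, l)) = (\<Sum>t<N. (\<Sum>j<N. inverse (w ^ (j * t))) * R t $$ (k, l)) / of_nat N"
    using assms unfolding isotypic_projection_def
    by (simp add: sum_divide_distrib[symmetric] sum_distrib_right) (rule disjI2, rule sum.swap)
  also have "\<dots> = (\<Sum>t<N. if t = 0 then of_nat N * R t $$ (k, l) else 0) / of_nat N"
    by (intro arg_cong2[where f = "(/)"] sum.cong refl) (simp add: primitive_root_sum[OF root N_pos])
  also have "\<dots> = R 0 $$ (k, l)" using N_pos by simp
  also have "\<dots> = (if k = l then 1 else 0)" using assms by (simp add: R_0)
  finally show ?thesis .
qed

lemma sum_R_P:
  assumes "k < n" "l < n"
  shows "(\<Sum>j<N. w ^ (j * t) * P j $$ (k, l)) = R t $$ (k, l)"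
proof -
  have "(\<Sum>j<N. w ^ (j * t) * P j $$ (k, l)) = (\<Sum>j<N. (R t * P j) $$ (k, l))"
    unfolding R_P using assms by (simp add: isotypic_projection_def)
  also have "\<dots> = (\<Sum>j<N. \<Sum>s<n. R t $$ (k, s) * P j $$ (s, l))"
    using assms R_carrier[of t]
    by (auto simp: scalar_prod_def lessThan_atLeast0 isotypic_projection_def intro!: sum.cong)
  also have "\<dots> = (\<Sum>s<n. R t $$ (k, s) * (if s = l then 1 else 0))"
    by (subst sum.swap) (auto simp: sum_distrib_left[symmetric] sum_P assms intro!: sum.cong)
  also have "\<dots> = R t $$ (k, l)" using assms by (simp add: if_distrib cong: if_cong)
  finally show ?thesis .
qed

lemma trace_decomposition: "mat_trace (R t) = (\<Sum>j<N. w ^ (j * t) * mat_trace (P j))"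
proof -
  have "mat_trace (R t) = (\<Sum>i<n. \<Sum>j<N. w ^ (j * t) * P j $$ (i, i))"
    using R_carrier[of t] unfolding mat_trace_def by (auto simp: sum_R_P intro!: sum.cong)
  also have "\<dots> = (\<Sum>j<N. w ^ (j * t) * mat_trace (P j))"
    by (subst sum.swap) (simp add: mat_trace_def sum_distrib_left isotypic_projection_def)
  finally show ?thesis .
qed

text \<open>
  The projections sum to the identity, so one of them does not kill \<open>v\<close>.
\<close>

lemma exists_eigenvector_in_subspace:
  assumes W: "vec_subspace n W" and v: "v \<in> W" "v \<noteq> 0\<^sub>v n" and inv: "\<And>t. R t *\<^sub>v v \<in> W"
  shows "\<exists>j. P j *\<^sub>v v \<in> W \<and> P j *\<^sub>v v \<noteq> 0\<^sub>v n"
proof (rule ccontr)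
  assume neg: "\<not> ?thesis"
  have vc: "v \<in> carrier_vec n" using v vec_subspaceD(1)[OF W] by auto
  have in_W: "P j *\<^sub>v v \<in> W" for j
    using inv R_carrier v by (intro isotypic_projection_in_subspace[OF W]) auto
  have z: "P j *\<^sub>v v = 0\<^sub>v n" for j using neg in_W by blast
  have "v $ k = 0" if k: "k < n" for k
  proof -
    have "v $ k = (\<Sum>l<n. (\<Sum>j<N. P j $$ (k, l)) * v $ l)"
      using k by (simp add: sum_P if_distrib[of "\<lambda>x. x * _"] cong: if_cong)
    also have "\<dots> = (\<Sum>j<N. (P j *\<^sub>v v) $ k)"
      unfolding sum_distrib_right using k vc
      by (subst sum.swap) (simp add: scalar_prod_def lessThan_atLeast0 isotypic_projection_def)
    also have "\<dots> = 0" using z k by simp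
    finally show ?thesis .
  qed
  then have "v = 0\<^sub>v n" using vc by (intro eq_vecI) auto
  then show False using v by simp
qed

text \<open>
  The multiplicity of \<open>w ^ j\<close> is the trace of \<open>P j\<close>. If it were 0 for all \<open>j\<close> prime to \<open>p\<close>, then only
  eigenvalues of order dividing \<open>p ^ k\<close> would occur, against faithfulness. The parameter \<open>l\<close> records a common divisor of the
  multiplicities of the primitive eigenvalues.
\<close>

lemma degree_lower_bound:
  assumes p: "Factorial_Ring.prime p" and N: "N = p ^ Suc k"
    and faithful: "R (p ^ k) \<noteq> 1\<^sub>m n"
    and nat: "\<And>t. mat_trace (R t) \<in> \<nat>"
    and mult: "\<And>j m. \<not> p dvd j \<Longrightarrow> mat_trace (P j) = of_nat m \<Longrightarrow> l dvd m"
  shows "l * p ^ Suc k \<le> n"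
proof -
  define m where "m j = (SOME c. mat_trace (P j) = of_nat c)" for j
  have m: "mat_trace (P j) = of_nat (m j)" for j
    using E_trace_natural[of j] unfolding m_def Nats_def by (auto intro: someI)
  have p0: "p > 0" using p by (simp add: prime_gt_0_nat)
  have dec: "mat_trace (R t) = (\<Sum>j<N. of_nat (m j) * w ^ (j * t))" for t
    unfolding trace_decomposition m by (simp add: mult.commute)
  have "\<exists>j<N. \<not> p dvd j \<and> m j > 0"
  proof (rule ccontr)
    assume neg: "\<not> ?thesis"
    have RP: "w ^ (j * p ^ k) * P j $$ (r, s) = P j $$ (r, s)" if j: "j < N" and rs: "r < n" "s < n" for j r s
    proof (cases "p dvd j")
      case True
      then obtain i where "j = p * i" by auto
      then have "w ^ (j * p ^ k) = (w ^ N) ^ i" unfolding N by (simp add: power_mult[symmetric] mult_ac)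
      then show ?thesis using w_N by simp
    next
      case False
      then have "mat_trace (P j) = 0" using neg j m by auto
      then have "P j = 0\<^sub>m n n"
        using mat_trace_idempotent(2)[OF isotypic_projection_carrier E_idempotent[of j]] by blast
      then show ?thesis using rs by simp
    qed
    have "R (p ^ k) = 1\<^sub>m n"
    proof (rule eq_matI)
      fix r s assume "r < dim_row (1\<^sub>m n :: complex mat)" "s < dim_col (1\<^sub>m n :: complex mat)"
      then have rs: "r < n" "s < n" by auto
      have "R (p ^ k) $$ (r, s) = (\<Sum>j<N. P j $$ (r, s))"
        unfolding sum_R_P[OF rs, symmetric] using RP rs by (intro sum.cong) auto
      also have "\<dots> = 1\<^sub>m n $$ (r, s)" using sum_P[OF rs] rs by simp
      finally show "R (p ^ k) $$ (r, s) = 1\<^sub>m n $$ (r, s)" .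
    qed (use R_carrier[of "p ^ k"] in auto)
    then show False using faithful by simp
  qed
  then obtain j where j: "j < N" "\<not> p dvd j" "m j > 0" by blast
  have "l dvd m j" using mult[OF j(2) m] .
  then have lm: "l \<le> m j" using j by (simp add: dvd_imp_le)
  have w1: "w ^ p ^ Suc k = 1" using w_N N by simp
  have "\<not> N dvd p ^ k"
    using p unfolding N by (auto dest!: dvd_imp_le simp: p0 prime_gt_1_nat leD)
  then have w2: "w ^ p ^ k \<noteq> 1" using root unfolding primitive_root_def by blast
  have "l * p ^ Suc k \<le> (\<Sum>j<p ^ Suc k. m j)"
    by (rule eigenvalue_multiplicities_bound[where m = m and w = w, OF p w1 w2 _ _ j(2) lm])
      (use nat dec j N in auto)
  also have "complex_of_nat (\<Sum>j<p ^ Suc k. m j) = of_nat n"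
  proof -
    have "mat_trace (R 0) = of_nat n" unfolding R_0 mat_trace_def by simp
    then show ?thesis using dec[of 0] N by simp
  qed
  then have "(\<Sum>j<p ^ Suc k. m j) = n" by (simp only: of_nat_eq_iff)
  finally show ?thesis .
qed

end

section \<open>Linear characters of subgroups of p-groups\<close>

lemma complex_root_exists:
  fixes z :: complex
  assumes "m > 0" shows "\<exists>c. c ^ m = z"
proof -
  have "rcis (root m (cmod z)) (Arg z / real m) ^ m = rcis (cmod z) (Arg z)"
    using assms by (simp add: DeMoivre2)
  then show ?thesis by (metis rcis_cmod_Arg)
qed

context group begin

lemma mult_inv_cancel:
  assumes "x \<in> carrier G" "y \<in> carrier G"
  shows "x \<otimes> (inv x \<otimes> y) = y" "inv x \<otimes> (x \<otimes> y) = y"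
  using assms by (simp_all flip: m_assoc)

lemma finite_closed_imp_subgroup:
  assumes fin: "finite (carrier G)" and "H \<subseteq> carrier G" and one: "\<one> \<in> H"
    and closed: "\<And>x y. x \<in> H \<Longrightarrow> y \<in> H \<Longrightarrow> x \<otimes> y \<in> H"
  shows "subgroup H G"
proof
  fix x assume x: "x \<in> H"
  then have xc: "x \<in> carrier G" using assms by auto
  have "inj_on (\<lambda>y. x \<otimes> y) H" using assms xc by (intro inj_onI) (auto simp: subset_iff)
  moreover have "finite H" using assms finite_subset by blast
  ultimately have "(\<lambda>y. x \<otimes> y) ` H = H" using closed x by (intro endo_inj_surj) auto
  then obtain y where y: "y \<in> H" "x \<otimes> y = \<one>" using one by (metis imageE)
  then have "inv x = y" using xc assms by (metis inv_comm inv_equality subsetD)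
  then show "inv x \<in> H" using y by simp
qed (use assms in auto)

lemma subgroup_card_prime_power:
  assumes p: "Factorial_Ring.prime p" and "finite (carrier G)" and "card (carrier G) = p ^ k" and H: "subgroup H G"
  shows "\<exists>i. card H = p ^ i"
proof -
  have "card H dvd Coset.order G" using lagrange_finite[OF assms(2) H] by (metis dvd_triv_right)
  then show ?thesis using assms unfolding Coset.order_def by (auto simp: divides_primepow_nat)
qed

text \<open>
  Orbits have \<open>p\<close>-power size, so those with more than one point have size divisible by \<open>p\<close>, and a single
  fixed point cannot account for \<open>card X\<close>.
\<close>

lemma p_group_fixed_point:
  fixes act :: "'a \<Rightarrow> 'c \<Rightarrow> 'c"
  assumes p: "Factorial_Ring.prime p" and fin: "finite (carrier G)" and card: "card (carrier G) = p ^ k"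
    and act: "\<And>g x. g \<in> carrier G \<Longrightarrow> x \<in> X \<Longrightarrow> act g x \<in> X"
    and act_one: "\<And>x. x \<in> X \<Longrightarrow> act \<one> x = x"
    and act_mult: "\<And>g h x. g \<in> carrier G \<Longrightarrow> h \<in> carrier G \<Longrightarrow> x \<in> X \<Longrightarrow> act (g \<otimes> h) x = act g (act h x)"
    and X: "finite X" "p dvd card X" and x0: "x0 \<in> X" "\<And>g. g \<in> carrier G \<Longrightarrow> act g x0 = x0"
  shows "\<exists>x\<in>X. x \<noteq> x0 \<and> (\<forall>g\<in>carrier G. act g x = x)"
proof (rule ccontr)
  assume neg: "\<not> ?thesis"
  define orb where "orb x = (\<lambda>g. act g x) ` carrier G" for x
  have self: "x \<in> orb x" if "x \<in> X" for x
    using act_one[OF that] unfolding orb_def by (metis image_eqI one_closed)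
  have orb_X: "orb x \<subseteq> X" if "x \<in> X" for x using act that unfolding orb_def by auto
  have orb_eq: "orb y = orb x" if x: "x \<in> X" and y: "y \<in> orb x" for x y
  proof -
    obtain h where h: "h \<in> carrier G" "y = act h x" using y unfolding orb_def by auto
    have "act g y \<in> orb x" if "g \<in> carrier G" for g
      using that h x unfolding orb_def by (auto simp: act_mult[symmetric])
    moreover have "act g x \<in> orb y" if g: "g \<in> carrier G" for g
    proof -
      have "act g x = act (g \<otimes> inv h) y"
        using g h x by (simp add: act_mult[symmetric] m_assoc)
      then show ?thesis using g h unfolding orb_def by auto
    qed
    ultimately show ?thesis unfolding orb_def by auto
  qed
  have card_orb: "p dvd card (orb x)" if x: "x \<in> X" "x \<noteq> x0" for x
  proof -
    define S where "S = {g \<in> carrier G. act g x = x}"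
    have fib: "card {g \<in> carrier G. act g x = y} = card S" if y: "y \<in> orb x" for y
    proof -
      obtain h where h: "h \<in> carrier G" "y = act h x" using y unfolding orb_def by auto
      have "bij_betw (\<lambda>g. h \<otimes> g) S {g \<in> carrier G. act g x = y}"
      proof (rule bij_betwI[where g = "\<lambda>g. inv h \<otimes> g"])
        show "(\<lambda>g. h \<otimes> g) \<in> S \<rightarrow> {g \<in> carrier G. act g x = y}"
          using h x unfolding S_def by (auto simp: act_mult)
        show "(\<lambda>g. inv h \<otimes> g) \<in> {g \<in> carrier G. act g x = y} \<rightarrow> S"
        proof
          fix g assume "g \<in> {g \<in> carrier G. act g x = y}"
          then have g: "g \<in> carrier G" "act g x = act h x" using h by auto
          have "act (inv h \<otimes> g) x = act (inv h) (act h x)" using g h x by (simp add: act_mult)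
          also have "\<dots> = x" using h x by (simp add: act_mult[symmetric] act_one)
          finally show "inv h \<otimes> g \<in> S" using g h unfolding S_def by simp
        qed
      qed (use h in \<open>auto simp: S_def mult_inv_cancel\<close>)
      then show ?thesis by (simp add: bij_betw_same_card)
    qed
    have "card (carrier G) = (\<Sum>y\<in>orb x. card {g \<in> carrier G. act g x = y})"
      unfolding orb_def using fin sum.image_gen[of "carrier G" "\<lambda>_. 1::nat" "\<lambda>g. act g x"] by simp
    also have "\<dots> = card (orb x) * card S" using fib by simp
    finally have "card (orb x) dvd p ^ k" using card by (metis dvd_triv_left)
    then obtain i where i: "card (orb x) = p ^ i" using p by (auto simp: divides_primepow_nat)
    show ?thesis
    proof (cases i)
      case 0
      then have "card (orb x) = 1" using i by simp
      then obtain z where "orb x = {z}" by (rule card_1_singletonE)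
      then have "orb x = {x}" using self[OF x(1)] by auto
      then have "\<forall>g\<in>carrier G. act g x = x" unfolding orb_def by auto
      then show ?thesis using neg x by blast
    qed (use i in simp)
  qed
  have orb0: "orb x0 = {x0}" unfolding orb_def using x0(2) one_closed by auto
  have disj: "pairwise disjnt (orb ` X)"
  proof (rule pairwiseI)
    fix A B assume AB: "A \<in> orb ` X" "B \<in> orb ` X" "A \<noteq> B"
    then obtain x y where xy: "x \<in> X" "A = orb x" "y \<in> X" "B = orb y" by auto
    show "disjnt A B"
    proof (rule ccontr)
      assume "\<not> disjnt A B"
      then obtain z where "z \<in> orb x" "z \<in> orb y" unfolding xy disjnt_def by auto
      then have "A = B" using orb_eq[OF xy(1)] orb_eq[OF xy(3)] xy by metis
      then show False using AB by simp
    qed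
  qed
  have "X = \<Union> (orb ` X)" using self orb_X by auto
  then have "card X = sum card (orb ` X)"
    using card_Union_disjoint[OF disj] orb_X X(1) finite_subset by force
  also have "\<dots> = card (orb x0) + sum card (orb ` X - {orb x0})"
    using X(1) x0(1) by (intro sum.remove) auto
  also have "\<dots> = 1 + sum card (orb ` X - {orb x0})" using orb0 by simp
  finally have "card X = 1 + sum card (orb ` X - {orb x0})" .
  moreover have "p dvd sum card (orb ` X - {orb x0})"
    by (intro dvd_sum) (use card_orb in auto)
  ultimately have "p dvd 1" using X(2) dvd_add_left_iff[of p "sum card (orb ` X - {orb x0})" 1] by simp
  then show False using p by auto
qed

text \<open>
  The centre of the nontrivial \<open>p\<close>-group \<open>T / N\<close> is nontrivial: \<open>T\<close> acts by conjugation on the cosets of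
  \<open>N\<close>, and \<open>N\<close> itself is a fixed point.
\<close>

lemma p_group_central_modulo:
  assumes p: "Factorial_Ring.prime p" and fin: "finite (carrier G)" and card: "card (carrier G) = p ^ k"
    and T: "subgroup T G" and N: "subgroup N G" and NT: "N \<subset> T"
    and normal: "\<And>t n. t \<in> T \<Longrightarrow> n \<in> N \<Longrightarrow> t \<otimes> n \<otimes> inv t \<in> N"
  shows "\<exists>a\<in>T - N. \<forall>t\<in>T. t \<otimes> a \<otimes> inv t \<otimes> inv a \<in> N"
proof -
  let ?T = "G\<lparr>carrier := T\<rparr>"
  interpret TG: group ?T by (rule subgroup_imp_group[OF T])
  have Tc: "T \<subseteq> carrier G" and Nc: "N \<subseteq> carrier G" using T N by (auto dest: subgroup.subset)
  have finT: "finite T" using Tc fin finite_subset by blast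
  have NsubT: "subgroup N ?T" using subgroup_incl[OF N T] NT by auto
  obtain i where i: "card T = p ^ i" using subgroup_card_prime_power[OF p fin card T] by blast
  obtain j where j: "card N = p ^ j" using subgroup_card_prime_power[OF p fin card N] by blast
  define X where "X = (\<lambda>t. N #> t) ` T"
  have X_rc: "rcosets\<^bsub>?T\<^esub> N = X" unfolding X_def RCOSETS_def r_coset_def by auto
  have lag: "card X * card N = card T"
    using TG.lagrange_finite[OF _ NsubT] finT unfolding X_rc Coset.order_def by simp
  have "card N < card T" using NT finT by (rule psubset_card_mono[rotated])
  then have "card X \<noteq> 1" using lag by auto
  moreover have "card X dvd p ^ i" using lag i by (metis dvd_triv_left)
  ultimately obtain l where "card X = p ^ l" "l \<noteq> 0" using p by (auto simp: divides_primepow_nat)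
  then have pX: "p dvd card X" by (cases l) auto
  define act where "act g C = (\<lambda>c. g \<otimes> c \<otimes> inv g) ` C" for g C
  have act_coset: "act g (N #> t) = N #> (g \<otimes> t \<otimes> inv g)" if g: "g \<in> T" and t: "t \<in> T" for g t
  proof -
    have gc: "g \<in> carrier G" "t \<in> carrier G" using g t Tc by auto
    have a: "g \<otimes> (n \<otimes> t) \<otimes> inv g = (g \<otimes> n \<otimes> inv g) \<otimes> (g \<otimes> t \<otimes> inv g)" if "n \<in> N" for n
      using that Nc gc by (auto simp: m_assoc mult_inv_cancel)
    have b: "n \<otimes> (g \<otimes> t \<otimes> inv g) = g \<otimes> ((inv g \<otimes> n \<otimes> inv (inv g)) \<otimes> t) \<otimes> inv g" if "n \<in> N" for n
      using that Nc gc by (auto simp: m_assoc mult_inv_cancel subset_iff)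
    have "inv g \<in> T" using g T by (simp add: subgroup.m_inv_closed)
    show ?thesis
    proof
      show "act g (N #> t) \<subseteq> N #> (g \<otimes> t \<otimes> inv g)"
        unfolding act_def r_coset_def using a normal[OF g] by auto
      show "N #> (g \<otimes> t \<otimes> inv g) \<subseteq> act g (N #> t)"
        unfolding act_def r_coset_def using b normal[OF \<open>inv g \<in> T\<close>] by auto
    qed
  qed
  have NX: "N \<in> X" and N1: "N = N #> \<one>"
    unfolding X_def using subgroup.one_closed[OF T] Nc by (auto simp: coset_mult_one intro!: image_eqI[of _ _ \<one>])
  have "\<exists>C\<in>X. C \<noteq> N \<and> (\<forall>g\<in>carrier ?T. act g C = C)"
  proof (rule TG.p_group_fixed_point[OF p])
    show "finite (carrier ?T)" "card (carrier ?T) = p ^ i" using finT i by auto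
    show "finite X" unfolding X_def using finT by simp
    show "act g C \<in> X" if "g \<in> carrier ?T" "C \<in> X" for g C
      using that T unfolding X_def by (auto simp: act_coset subgroup.m_closed subgroup.m_inv_closed)
    show "act \<one>\<^bsub>?T\<^esub> C = C" if "C \<in> X" for C
    proof -
      have "C \<subseteq> carrier G" using that Nc Tc unfolding X_def by (auto simp: r_coset_def)
      then show ?thesis unfolding act_def by (force simp: subset_iff)
    qed
    show "act (g \<otimes>\<^bsub>?T\<^esub> h) C = act g (act h C)" if gh: "g \<in> carrier ?T" "h \<in> carrier ?T" and "C \<in> X" for g h C
    proof -
      have C: "C \<subseteq> carrier G" using that Nc Tc unfolding X_def by (auto simp: r_coset_def)
      have "g \<otimes> h \<otimes> c \<otimes> inv (g \<otimes> h) = g \<otimes> (h \<otimes> c \<otimes> inv h) \<otimes> inv g" if "c \<in> C" for c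
      proof -
        have "g \<in> carrier G" "h \<in> carrier G" "c \<in> carrier G" using gh that C Tc by auto
        then show ?thesis by (simp add: m_assoc inv_mult_group)
      qed
      then show ?thesis unfolding act_def by (force simp: image_image)
    qed
    show "act g N = N" if "g \<in> carrier ?T" for g
      using act_coset[of g \<one>] that Tc N1 subgroup.one_closed[OF T] by (auto simp: subset_iff)
  qed (use pX NX in auto)
  then obtain a where a: "a \<in> T" "N #> a \<noteq> N" and fixed: "\<And>g. g \<in> T \<Longrightarrow> act g (N #> a) = N #> a"
    unfolding X_def by auto
  have ac: "a \<in> carrier G" using a Tc by auto
  have "a \<notin> N" using a coset_join2[OF ac N] by blast
  moreover have "t \<otimes> a \<otimes> inv t \<otimes> inv a \<in> N" if t: "t \<in> T" for t
  proof -
    have tc: "t \<in> carrier G" using t Tc by auto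
    have "N #> (t \<otimes> a \<otimes> inv t) = N #> a" using act_coset[OF t a(1)] fixed[OF t] by simp
    then have "t \<otimes> a \<otimes> inv t \<in> N #> a"
      using rcos_self[OF _ N, of "t \<otimes> a \<otimes> inv t"] tc ac by auto
    then obtain n where n: "n \<in> N" "t \<otimes> a \<otimes> inv t = n \<otimes> a" unfolding r_coset_def by auto
    then show ?thesis using ac Nc by (auto simp: m_assoc subset_iff)
  qed
  ultimately show ?thesis using a(1) by blast
qed

lemma p_group_normal_meets_center:
  assumes p: "Factorial_Ring.prime p" and fin: "finite (carrier G)" and card: "card (carrier G) = p ^ k"
    and N: "subgroup N G" "N \<noteq> {\<one>}"
    and normal: "\<And>t n. t \<in> carrier G \<Longrightarrow> n \<in> N \<Longrightarrow> t \<otimes> n \<otimes> inv t \<in> N"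
  shows "\<exists>z\<in>N. z \<noteq> \<one> \<and> (\<forall>t\<in>carrier G. z \<otimes> t = t \<otimes> z)"
proof -
  have Nc: "N \<subseteq> carrier G" using N by (auto dest: subgroup.subset)
  have finN: "finite N" using Nc fin finite_subset by blast
  obtain j where j: "card N = p ^ j" using subgroup_card_prime_power[OF p fin card N(1)] by blast
  have "card N \<noteq> 1" using N subgroup.one_closed[OF N(1)] by (metis card_1_singletonE singletonD)
  then have "p dvd card N" using j by (cases j) auto
  then have "\<exists>z\<in>N. z \<noteq> \<one> \<and> (\<forall>t\<in>carrier G. t \<otimes> z \<otimes> inv t = z)"
    using finN normal Nc subgroup.one_closed[OF N(1)]
    by (intro p_group_fixed_point[OF p fin card]) (auto simp: m_assoc inv_mult_group subset_iff)
  then obtain z where z: "z \<in> N" "z \<noteq> \<one>" "\<And>t. t \<in> carrier G \<Longrightarrow> t \<otimes> z \<otimes> inv t = z" by blast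
  have "z \<otimes> t = t \<otimes> z" if t: "t \<in> carrier G" for t
  proof -
    have zc: "z \<in> carrier G" using z Nc by auto
    have "z \<otimes> t = t \<otimes> z \<otimes> inv t \<otimes> t" using z(3)[OF t] by simp
    then show ?thesis using t zc by (simp add: m_assoc)
  qed
  then show ?thesis using z by blast
qed

text \<open>
  A linear character \<open>\<mu>\<close> of a normal subgroup \<open>N\<close> of \<open>T\<close> that is invariant under conjugation by \<open>T\<close>.
\<close>

definition stable_character :: "'a set \<Rightarrow> 'a set \<Rightarrow> ('a \<Rightarrow> complex) \<Rightarrow> bool" where
  "stable_character T N \<mu> \<longleftrightarrow> subgroup T G \<and> subgroup N G \<and> N \<subseteq> T \<and> \<mu> \<one> = 1 \<and>
     (\<forall>m\<in>N. \<forall>n\<in>N. \<mu> (m \<otimes> n) = \<mu> m * \<mu> n) \<and>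
     (\<forall>t\<in>T. \<forall>n\<in>N. t \<otimes> n \<otimes> inv t \<in> N \<and> \<mu> (t \<otimes> n \<otimes> inv t) = \<mu> n)"

text \<open>
  The extension maps \<open>n \<otimes> a ^ i\<close> to \<open>\<mu> n * c ^ i\<close>. The condition on \<open>c\<close> makes this well defined, and
  invariance of \<open>\<mu>\<close> under \<open>a\<close> makes it multiplicative. The last two conclusions describe the
  stabiliser of the extension in \<open>T\<close>: it is determined by the value at conjugates of \<open>a\<close> and it contains \<open>A\<close>.
\<close>

lemma extend_stable_character:
  assumes fin: "finite (carrier G)" and st: "stable_character T N \<mu>"
    and a: "a \<in> T" and comm: "\<And>t. t \<in> T \<Longrightarrow> t \<otimes> a \<otimes> inv t \<otimes> inv a \<in> N"
    and c: "\<And>i :: nat. a [^] i \<in> N \<Longrightarrow> \<mu> (a [^] i) = c ^ i"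
  obtains A \<nu> where "subgroup A G" "N \<subseteq> A" "a \<in> A" "A \<subseteq> T" "\<And>n. n \<in> N \<Longrightarrow> \<nu> n = \<mu> n" "\<nu> a = c"
    "\<And>x y. x \<in> A \<Longrightarrow> y \<in> A \<Longrightarrow> \<nu> (x \<otimes> y) = \<nu> x * \<nu> y"
    "\<And>t x. t \<in> T \<Longrightarrow> x \<in> A \<Longrightarrow> t \<otimes> x \<otimes> inv t \<in> A"
    "\<And>t x. t \<in> T \<Longrightarrow> \<nu> (t \<otimes> a \<otimes> inv t) = c \<Longrightarrow> x \<in> A \<Longrightarrow> \<nu> (t \<otimes> x \<otimes> inv t) = \<nu> x"
    "\<And>t. t \<in> A \<Longrightarrow> \<nu> (t \<otimes> a \<otimes> inv t) = c"
proof -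
  have T: "subgroup T G" and N: "subgroup N G" and NT: "N \<subseteq> T" and mu1: "\<mu> \<one> = 1"
    and mu_mult: "\<And>m n. m \<in> N \<Longrightarrow> n \<in> N \<Longrightarrow> \<mu> (m \<otimes> n) = \<mu> m * \<mu> n"
    and normal: "\<And>t n. t \<in> T \<Longrightarrow> n \<in> N \<Longrightarrow> t \<otimes> n \<otimes> inv t \<in> N"
    and mu_inv: "\<And>t n. t \<in> T \<Longrightarrow> n \<in> N \<Longrightarrow> \<mu> (t \<otimes> n \<otimes> inv t) = \<mu> n"
    using st unfolding stable_character_def by auto
  have Tc: "\<And>t. t \<in> T \<Longrightarrow> t \<in> carrier G" using T subgroup.subset by blast
  have Nc: "\<And>n. n \<in> N \<Longrightarrow> n \<in> carrier G" using NT Tc by blast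
  have ac: "a \<in> carrier G" using a Tc by simp
  have aT: "a [^] (i::nat) \<in> T" for i
    using a T by (induction i) (auto simp: subgroup.one_closed subgroup.m_closed)
  define A where "A = (\<lambda>(n, i::nat). n \<otimes> a [^] i) ` (N \<times> UNIV)"
  have AI: "n \<otimes> a [^] i \<in> A" if "n \<in> N" for n and i :: nat using that unfolding A_def by auto
  have mult: "(n \<otimes> a [^] i) \<otimes> (m \<otimes> a [^] j) = (n \<otimes> (a [^] i \<otimes> m \<otimes> inv (a [^] i))) \<otimes> a [^] (i + j)"
    if "n \<in> N" "m \<in> N" for n m and i j :: nat
    using that Nc ac by (simp add: m_assoc mult_inv_cancel nat_pow_mult[symmetric])
  have well: "\<mu> n * c ^ i = \<mu> m * c ^ j" if nm: "n \<in> N" "m \<in> N" and eq: "n \<otimes> a [^] i = m \<otimes> a [^] j"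
    for n m and i j :: nat
  proof -
    have le: "\<mu> n * c ^ i = \<mu> m * c ^ j" if nm: "n \<in> N" "m \<in> N" and eq: "n \<otimes> a [^] i = m \<otimes> a [^] j" and "i \<le> j"
      for n m and i j :: nat
    proof -
      obtain d where d: "j = d + i" using \<open>i \<le> j\<close> by (metis add.commute le_Suc_ex)
      have "n \<otimes> a [^] i = (m \<otimes> a [^] d) \<otimes> a [^] i"
        using eq nm Nc ac unfolding d by (simp add: m_assoc nat_pow_mult)
      then have n: "n = m \<otimes> a [^] d" using nm Nc ac by (simp add: m_closed)
      then have "a [^] d = inv m \<otimes> n" using nm Nc ac by (simp add: mult_inv_cancel)
      then have "a [^] d \<in> N" using nm N by (simp add: subgroup.m_closed subgroup.m_inv_closed)
      then have "\<mu> n = \<mu> m * c ^ d" unfolding n using nm by (simp add: mu_mult c)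
      then show ?thesis unfolding d by (simp add: power_add)
    qed
    show ?thesis using le[OF nm eq] le[OF nm(2,1) eq[symmetric]] by (cases "i \<le> j") auto
  qed
  \<comment> \<open>Well-definedness is \<open>well\<close>: two expressions of the same element differ by a power of \<open>a\<close> that lies in \<open>N\<close>.\<close>
  define \<nu> where "\<nu> x = (THE z. \<exists>n i. n \<in> N \<and> x = n \<otimes> a [^] (i::nat) \<and> z = \<mu> n * c ^ i)" for x
  have nu: "\<nu> (n \<otimes> a [^] i) = \<mu> n * c ^ i" if "n \<in> N" for n and i :: nat
    unfolding \<nu>_def
  proof (rule the_equality)
    show "\<exists>n' i'. n' \<in> N \<and> n \<otimes> a [^] i = n' \<otimes> a [^] (i'::nat) \<and> \<mu> n * c ^ i = \<mu> n' * c ^ i'"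
      using that by blast
    fix z assume "\<exists>n' i'. n' \<in> N \<and> n \<otimes> a [^] i = n' \<otimes> a [^] (i'::nat) \<and> z = \<mu> n' * c ^ i'"
    then obtain n' and i' :: nat where "n' \<in> N" "n \<otimes> a [^] i = n' \<otimes> a [^] i'" "z = \<mu> n' * c ^ i'"
      by blast
    then show "z = \<mu> n * c ^ i" using well[OF that] by simp
  qed
  have N1: "\<one> \<in> N" using N by (rule subgroup.one_closed)
  have nuN: "\<nu> n = \<mu> n" if "n \<in> N" for n using nu[OF that, of 0] Nc[OF that] by simp
  have nua: "\<nu> a = c" using nu[OF N1, of 1] ac mu1 by simp
  have aA: "a \<in> A" using AI[OF N1, of 1] ac by simp
  have NA: "N \<subseteq> A" using AI[of _ 0] Nc by force
  have AT: "A \<subseteq> T" using NT aT T unfolding A_def by (auto intro: subgroup.m_closed)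
  have nm: "n \<otimes> (a [^] i \<otimes> m \<otimes> inv (a [^] i)) \<in> N" if "n \<in> N" "m \<in> N" for n m and i :: nat
    using that normal[OF aT] N by (simp add: subgroup.m_closed)
  have nu_mult: "\<nu> (x \<otimes> y) = \<nu> x * \<nu> y" if xy: "x \<in> A" "y \<in> A" for x y
  proof -
    obtain n i where x: "x = n \<otimes> a [^] (i::nat)" "n \<in> N" using xy unfolding A_def by auto
    obtain m j where y: "y = m \<otimes> a [^] (j::nat)" "m \<in> N" using xy unfolding A_def by auto
    show ?thesis unfolding x(1) y(1) mult[OF x(2) y(2)] nu[OF nm[OF x(2) y(2)]] nu[OF x(2)] nu[OF y(2)]
      using x(2) y(2) by (simp add: mu_mult normal[OF aT] mu_inv[OF aT] power_add)
  qed
  have A: "subgroup A G"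
  proof (rule finite_closed_imp_subgroup[OF fin])
    show "A \<subseteq> carrier G" using AT Tc by auto
    show "\<one> \<in> A" using NA N1 by auto
    show "x \<otimes> y \<in> A" if xy: "x \<in> A" "y \<in> A" for x y
    proof -
      obtain n i where x: "x = n \<otimes> a [^] (i::nat)" "n \<in> N" using xy unfolding A_def by auto
      obtain m j where y: "y = m \<otimes> a [^] (j::nat)" "m \<in> N" using xy unfolding A_def by auto
      show ?thesis unfolding x(1) y(1) mult[OF x(2) y(2)] by (rule AI[OF nm[OF x(2) y(2)]])
    qed
  qed
  have taA: "t \<otimes> a \<otimes> inv t \<in> A" if t: "t \<in> T" for t
  proof -
    have "t \<otimes> a \<otimes> inv t = (t \<otimes> a \<otimes> inv t \<otimes> inv a) \<otimes> a"
      using Tc[OF t] ac by (simp add: m_assoc)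
    then show ?thesis using AI[OF comm[OF t], of 1] ac by simp
  qed
  have conj_pow: "t \<otimes> (n \<otimes> a [^] i) \<otimes> inv t = (t \<otimes> n \<otimes> inv t) \<otimes> (t \<otimes> a \<otimes> inv t) [^] i"
    if t: "t \<in> T" and n: "n \<in> N" for t n and i :: nat
  proof (induction i)
    case 0 then show ?case using Tc[OF t] Nc[OF n] by simp
  next
    case (Suc i)
    have tc: "t \<in> carrier G" "n \<in> carrier G" using Tc[OF t] Nc[OF n] by auto
    have "t \<otimes> (n \<otimes> a [^] Suc i) \<otimes> inv t = (t \<otimes> (n \<otimes> a [^] i) \<otimes> inv t) \<otimes> (t \<otimes> a \<otimes> inv t)"
      using tc ac by (simp add: m_assoc mult_inv_cancel)
    then show ?case unfolding Suc using tc ac by (simp add: m_assoc)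
  qed
  have powA: "x [^] (i::nat) \<in> A" "\<nu> (x [^] i) = \<nu> x ^ i" if "x \<in> A" for x i
  proof -
    have "x [^] i \<in> A \<and> \<nu> (x [^] i) = \<nu> x ^ i"
      using that N1 NA mu1 by (induction i) (auto simp: nu_mult nuN subgroup.m_closed[OF A])
    then show "x [^] i \<in> A" "\<nu> (x [^] i) = \<nu> x ^ i" by auto
  qed
  have conjA: "t \<otimes> x \<otimes> inv t \<in> A" if t: "t \<in> T" and x: "x \<in> A" for t x
  proof -
    obtain n i where n: "x = n \<otimes> a [^] (i::nat)" "n \<in> N" using x unfolding A_def by auto
    show ?thesis unfolding n(1) conj_pow[OF t n(2)]
      using normal[OF t n(2)] NA powA(1)[OF taA[OF t]] by (auto intro: subgroup.m_closed[OF A])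
  qed
  have stab: "\<nu> (t \<otimes> x \<otimes> inv t) = \<nu> x" if t: "t \<in> T" and ta: "\<nu> (t \<otimes> a \<otimes> inv t) = c" and x: "x \<in> A" for t x
  proof -
    obtain n i where n: "x = n \<otimes> a [^] (i::nat)" "n \<in> N" using x unfolding A_def by auto
    have "\<nu> (t \<otimes> x \<otimes> inv t) = \<nu> (t \<otimes> n \<otimes> inv t) * \<nu> ((t \<otimes> a \<otimes> inv t) [^] i)"
      unfolding n(1) conj_pow[OF t n(2)]
      using normal[OF t n(2)] NA powA(1)[OF taA[OF t]] by (auto intro: nu_mult)
    also have "\<dots> = \<mu> n * c ^ i"
      using normal[OF t n(2)] by (simp add: nuN mu_inv[OF t n(2)] powA(2)[OF taA[OF t]] ta)
    finally show ?thesis using nu[OF n(2)] n by simp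
  qed
  have Aa: "\<nu> (t \<otimes> a \<otimes> inv t) = c" if t: "t \<in> A" for t
  proof -
    have "inv t \<in> A" using t A by (simp add: subgroup.m_inv_closed)
    then have "\<nu> (t \<otimes> a \<otimes> inv t) = \<nu> t * \<nu> a * \<nu> (inv t)"
      using t aA by (simp add: nu_mult subgroup.m_closed[OF A])
    also have "\<dots> = \<nu> (t \<otimes> inv t) * \<nu> a" using t \<open>inv t \<in> A\<close> by (simp add: nu_mult del: r_inv)
    also have "t \<otimes> inv t = \<one>" using t AT Tc by auto
    finally show ?thesis using nuN[OF N1] mu1 nua by simp
  qed
  show ?thesis by (rule that[of A \<nu>]) (fact A NA aA AT nuN nua nu_mult conjA stab Aa)+
qed

text \<open>
  One step of Clifford theory: \<open>a\<close> is central modulo \<open>N\<close>, \<open>A\<close> is generated by \<open>N\<close> and \<open>a\<close>, and \<open>T'\<close> is the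
  stabiliser of an extension \<open>\<nu>\<close> of \<open>\<mu>\<close> to \<open>A\<close>. Elements of \<open>T\<close> outside \<open>T'\<close> move \<open>\<nu>\<close>.
\<close>

lemma refine_stable_character:
  assumes p: "Factorial_Ring.prime p" and fin: "finite (carrier G)" and card: "card (carrier G) = p ^ k"
    and st: "stable_character T N \<mu>" and ne: "N \<noteq> T"
  shows "\<exists>T' A \<nu>. stable_character T' A \<nu> \<and> N \<subset> A \<and> T' \<subseteq> T \<and> (\<forall>n\<in>N. \<nu> n = \<mu> n) \<and>
     (\<forall>t\<in>T - T'. \<exists>x\<in>A. t \<otimes> x \<otimes> inv t \<in> A \<and> \<nu> (t \<otimes> x \<otimes> inv t) \<noteq> \<nu> x)"
proof -
  have T: "subgroup T G" and N: "subgroup N G" and NT: "N \<subset> T" and mu1: "\<mu> \<one> = 1"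
    and mu_mult: "\<And>m n. m \<in> N \<Longrightarrow> n \<in> N \<Longrightarrow> \<mu> (m \<otimes> n) = \<mu> m * \<mu> n"
    and normal: "\<And>t n. t \<in> T \<Longrightarrow> n \<in> N \<Longrightarrow> t \<otimes> n \<otimes> inv t \<in> N"
    using st ne unfolding stable_character_def by auto
  have Tc: "\<And>t. t \<in> T \<Longrightarrow> t \<in> carrier G" using T subgroup.subset by blast
  obtain a where a: "a \<in> T" "a \<notin> N" and comm: "\<And>t. t \<in> T \<Longrightarrow> t \<otimes> a \<otimes> inv t \<otimes> inv a \<in> N"
    using p_group_central_modulo[OF p fin card T N NT normal] by blast
  have ac: "a \<in> carrier G" using a Tc by simp
  have N1: "\<one> \<in> N" using N by (rule subgroup.one_closed)
  have "a [^] Coset.order G = \<one>" using ac by (rule pow_order_eq_1)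
  moreover have "Coset.order G > 0" using fin by (simp add: order_gt_0_iff_finite)
  ultimately have ex: "\<exists>m>0. a [^] (m::nat) \<in> N" using N1 by metis
  \<comment> \<open>The order \<open>m\<close> of \<open>a\<close> modulo \<open>N\<close> determines the admissible values at \<open>a\<close>: the \<open>m\<close>-th roots of \<open>\<mu> (a ^ m)\<close>.\<close>
  define m where "m = (LEAST m. m > 0 \<and> a [^] (m::nat) \<in> N)"
  have m: "m > 0" "a [^] m \<in> N" using LeastI_ex[OF ex] unfolding m_def by auto
  have least: "m \<le> i" if "i > 0" "a [^] i \<in> N" for i :: nat
    unfolding m_def using that by (intro Least_le) auto
  have pow: "a [^] (m * i) \<in> N \<and> \<mu> (a [^] (m * i)) = \<mu> (a [^] m) ^ i" for i
  proof (induction i)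
    case 0 show ?case using N1 mu1 by simp
  next
    case (Suc i)
    have "a [^] (m * Suc i) = a [^] m \<otimes> a [^] (m * i)" using ac by (simp add: nat_pow_mult)
    then show ?case using Suc m N by (simp add: mu_mult subgroup.m_closed)
  qed
  obtain c where c: "c ^ m = \<mu> (a [^] m)"
    using complex_root_exists[OF m(1)] by blast
  have mu_a: "\<mu> (a [^] i) = c ^ i" if i: "a [^] i \<in> N" for i :: nat
  proof -
    have "a [^] i = a [^] (m * (i div m)) \<otimes> a [^] (i mod m)" using ac by (simp add: nat_pow_mult)
    then have "a [^] (i mod m) = inv (a [^] (m * (i div m))) \<otimes> a [^] i" using ac by (simp add: mult_inv_cancel)
    also have "\<dots> \<in> N" using pow i N by (simp add: subgroup.m_closed subgroup.m_inv_closed)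
    finally have "i mod m = 0" using least[of "i mod m"] m(1) by (metis gr0I mod_less_divisor not_le)
    then have "i = m * (i div m)" by auto
    then show ?thesis using pow[of "i div m"] c by (metis power_mult)
  qed
  obtain A \<nu> where A: "subgroup A G" "N \<subseteq> A" "a \<in> A" "A \<subseteq> T"
    and nuN: "\<And>n. n \<in> N \<Longrightarrow> \<nu> n = \<mu> n" and nua: "\<nu> a = c"
    and nu_mult: "\<And>x y. x \<in> A \<Longrightarrow> y \<in> A \<Longrightarrow> \<nu> (x \<otimes> y) = \<nu> x * \<nu> y"
    and conjA: "\<And>t x. t \<in> T \<Longrightarrow> x \<in> A \<Longrightarrow> t \<otimes> x \<otimes> inv t \<in> A"
    and stab: "\<And>t x. t \<in> T \<Longrightarrow> \<nu> (t \<otimes> a \<otimes> inv t) = c \<Longrightarrow> x \<in> A \<Longrightarrow> \<nu> (t \<otimes> x \<otimes> inv t) = \<nu> x"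
    and Aa: "\<And>t. t \<in> A \<Longrightarrow> \<nu> (t \<otimes> a \<otimes> inv t) = c"
    by (rule extend_stable_character[where c = c, OF fin st a(1) comm mu_a]; (assumption | rule that; assumption))
  define T' where "T' = {t \<in> T. \<nu> (t \<otimes> a \<otimes> inv t) = c}"
  have T': "subgroup T' G"
  proof (rule finite_closed_imp_subgroup[OF fin])
    show "T' \<subseteq> carrier G" unfolding T'_def using Tc by auto
    show "\<one> \<in> T'" unfolding T'_def using subgroup.one_closed[OF T] ac nua by simp
    fix s t assume s: "s \<in> T'" and t: "t \<in> T'"
    have sT: "s \<in> T" "t \<in> T" using s t unfolding T'_def by auto
    have "s \<otimes> t \<otimes> a \<otimes> inv (s \<otimes> t) = s \<otimes> (t \<otimes> a \<otimes> inv t) \<otimes> inv s"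
      using Tc[OF sT(1)] Tc[OF sT(2)] ac by (simp add: m_assoc inv_mult_group)
    then have "\<nu> (s \<otimes> t \<otimes> a \<otimes> inv (s \<otimes> t)) = c"
      using stab[OF sT(1) _ conjA[OF sT(2) A(3)]] s t unfolding T'_def by auto
    then show "s \<otimes> t \<in> T'" unfolding T'_def using sT T by (auto intro: subgroup.m_closed)
  qed
  have "stable_character T' A \<nu>"
    unfolding stable_character_def
  proof (intro conjI ballI)
    show "A \<subseteq> T'" unfolding T'_def using A(4) Aa by auto
    show "\<nu> \<one> = 1" using nuN[OF N1] mu1 by simp
    fix t x assume "t \<in> T'" and x: "x \<in> A"
    then have t: "t \<in> T" "\<nu> (t \<otimes> a \<otimes> inv t) = c" unfolding T'_def by auto
    show "t \<otimes> x \<otimes> inv t \<in> A" by (rule conjA[OF t(1) x])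
    show "\<nu> (t \<otimes> x \<otimes> inv t) = \<nu> x" by (rule stab[OF t x])
  qed (fact T' A(1) | rule nu_mult; assumption)+
  moreover have "N \<subset> A" using A a by auto
  moreover have "\<exists>x\<in>A. t \<otimes> x \<otimes> inv t \<in> A \<and> \<nu> (t \<otimes> x \<otimes> inv t) \<noteq> \<nu> x" if "t \<in> T - T'" for t
    using that A(3) conjA[of t a] nua unfolding T'_def by (intro bexI[of _ a]) auto
  moreover have "T' \<subseteq> T" unfolding T'_def by auto
  ultimately show ?thesis using nuN by blast
qed

text \<open>
  Mackey's criterion for the irreducibility of the representation induced from \<open>\<mu>\<close>: an element
  outside \<open>H\<close> conjugates \<open>\<mu>\<close> to a character that differs from \<open>\<mu>\<close> on the intersection of their domains.
\<close>

definition mackey_pair :: "'a set \<Rightarrow> ('a \<Rightarrow> complex) \<Rightarrow> bool" where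
  "mackey_pair H \<mu> \<longleftrightarrow> subgroup H G \<and> \<mu> \<one> = 1 \<and> (\<forall>x\<in>H. \<forall>y\<in>H. \<mu> (x \<otimes> y) = \<mu> x * \<mu> y) \<and>
     (\<forall>g\<in>carrier G - H. \<exists>x\<in>H. g \<otimes> x \<otimes> inv g \<in> H \<and> \<mu> (g \<otimes> x \<otimes> inv g) \<noteq> \<mu> x)"

text \<open>
  Refining until \<open>N = T\<close> shrinks \<open>T\<close> and enlarges \<open>N\<close> until they meet in \<open>H\<close>. An element \<open>g\<close> outside \<open>H\<close>
  leaves the chain of stabilisers at some step, and there it moves the current character, of which the final one is an
  extension.
\<close>

lemma stable_character_refines_to_mackey:
  assumes p: "Factorial_Ring.prime p" and fin: "finite (carrier G)" and card: "card (carrier G) = p ^ k"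
    and st: "stable_character T N \<mu>"
  shows "\<exists>H \<nu>. subgroup H G \<and> N \<subseteq> H \<and> H \<subseteq> T \<and> \<nu> \<one> = 1 \<and> (\<forall>n\<in>N. \<nu> n = \<mu> n) \<and>
     (\<forall>x\<in>H. \<forall>y\<in>H. \<nu> (x \<otimes> y) = \<nu> x * \<nu> y) \<and>
     (\<forall>g\<in>T - H. \<exists>x\<in>H. g \<otimes> x \<otimes> inv g \<in> H \<and> \<nu> (g \<otimes> x \<otimes> inv g) \<noteq> \<nu> x)"
  using st
proof (induction "card (carrier G) - card N" arbitrary: T N \<mu> rule: less_induct)
  case less
  show ?case
  proof (cases "N = T")
    case True
    then show ?thesis using less.prems unfolding stable_character_def
      by (intro exI[of _ T] exI[of _ \<mu>]) auto
  next
    case False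
    from refine_stable_character[OF p fin card less.prems False]
    obtain T' A \<nu> where st': "stable_character T' A \<nu>" and NA: "N \<subset> A" and T': "T' \<subseteq> T" and nu: "\<forall>n\<in>N. \<nu> n = \<mu> n"
      and sep: "\<And>t. t \<in> T - T' \<Longrightarrow> \<exists>x\<in>A. t \<otimes> x \<otimes> inv t \<in> A \<and> \<nu> (t \<otimes> x \<otimes> inv t) \<noteq> \<nu> x"
      by blast
    have Ac: "A \<subseteq> carrier G" using st' unfolding stable_character_def by (auto dest: subgroup.subset)
    then have "finite A" using fin finite_subset by blast
    then have "card N < card A" using NA by (rule psubset_card_mono)
    moreover have "card A \<le> card (carrier G)" using Ac fin by (rule card_mono[rotated])
    ultimately have "card (carrier G) - card A < card (carrier G) - card N" by simp
    from less.hyps[OF this st'] obtain H \<kappa> where H: "subgroup H G" "A \<subseteq> H" "H \<subseteq> T'" "\<kappa> \<one> = 1"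
      and ka: "\<And>n. n \<in> A \<Longrightarrow> \<kappa> n = \<nu> n" and km: "\<forall>x\<in>H. \<forall>y\<in>H. \<kappa> (x \<otimes> y) = \<kappa> x * \<kappa> y"
      and sep': "\<And>g. g \<in> T' - H \<Longrightarrow> \<exists>x\<in>H. g \<otimes> x \<otimes> inv g \<in> H \<and> \<kappa> (g \<otimes> x \<otimes> inv g) \<noteq> \<kappa> x"
      by blast
    have "\<exists>x\<in>H. g \<otimes> x \<otimes> inv g \<in> H \<and> \<kappa> (g \<otimes> x \<otimes> inv g) \<noteq> \<kappa> x" if g: "g \<in> T - H" for g
    proof (cases "g \<in> T'")
      case True then show ?thesis using sep' g by blast
    next
      case False
      then obtain x where x: "x \<in> A" "g \<otimes> x \<otimes> inv g \<in> A" "\<nu> (g \<otimes> x \<otimes> inv g) \<noteq> \<nu> x" using sep g by blast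
      then have "\<kappa> (g \<otimes> x \<otimes> inv g) \<noteq> \<kappa> x" by (simp add: ka)
      then show ?thesis using x H by blast
    qed
    moreover have "\<forall>n\<in>N. \<kappa> n = \<mu> n" using ka nu NA by auto
    ultimately show ?thesis using H km NA T' by (intro exI[of _ H] exI[of _ \<kappa>]) blast
  qed
qed

text \<open>
  The chain starts from a faithful character of the cyclic group generated by \<open>x\<close>, which is
  invariant because \<open>x\<close> is central.
\<close>

lemma mackey_pair_nontrivial_at_central:
  assumes p: "Factorial_Ring.prime p" and fin: "finite (carrier G)" and card: "card (carrier G) = p ^ k"
    and x: "x \<in> carrier G" "x \<noteq> \<one>" and central: "\<And>g. g \<in> carrier G \<Longrightarrow> x \<otimes> g = g \<otimes> x"
  shows "\<exists>H \<mu>. mackey_pair H \<mu> \<and> x \<in> H \<and> \<mu> x \<noteq> 1"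
proof -
  have ex: "\<exists>m>0. x [^] (m::nat) = \<one>" using pow_order_eq_1[OF x(1)] fin by (metis order_gt_0_iff_finite)
  define m where "m = (LEAST m. m > 0 \<and> x [^] (m::nat) = \<one>)"
  have m: "m > 0" "x [^] m = \<one>" using LeastI_ex[OF ex] unfolding m_def by auto
  have least: "m \<le> i" if "i > 0" "x [^] i = \<one>" for i :: nat
    unfolding m_def using that by (intro Least_le) auto
  have "m \<noteq> 1" using m x by auto
  then obtain c :: complex where c: "c ^ m = 1" "c \<noteq> 1"
  proof -
    have "cis (2 * pi / real m) ^ m = 1" using m by (simp add: DeMoivre)
    moreover have "cis (2 * pi / real m) \<noteq> 1"
    proof
      assume "cis (2 * pi / real m) = 1"
      then have "cos (2 * pi / real m) = 1" by (simp add: complex_eq_iff)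
      then obtain i :: int where "2 * pi / real m = of_int i * 2 * pi" using cos_one_2pi_int by auto
      then have "1 = of_int i * real m" using m by (simp add: field_simps)
      then have "int m dvd 1" by (metis dvd_triv_right of_int_1 of_int_eq_iff of_int_mult of_int_of_nat_eq)
      then show False using \<open>m \<noteq> 1\<close> by simp
    qed
    ultimately show ?thesis using that by blast
  qed
  have pow: "c ^ i = 1" if "x [^] i \<in> {\<one>}" for i :: nat
  proof -
    have "x [^] (m * (i div m)) = \<one>" using m x by (simp add: nat_pow_pow[symmetric])
    moreover have "x [^] i = x [^] (m * (i div m)) \<otimes> x [^] (i mod m)" using x by (simp add: nat_pow_mult)
    ultimately have "x [^] (i mod m) = \<one>" using that x by simp
    then have "i mod m = 0" using least[of "i mod m"] m(1) by (metis gr0I mod_less_divisor not_le)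
    then have "i = m * (i div m)" by auto
    then show ?thesis using c by (metis power_mult power_one)
  qed
  have conj: "g \<otimes> x \<otimes> inv g = x" if "g \<in> carrier G" for g
    using central[OF that] that x by (metis inv_solve_right m_closed)
  have st: "stable_character (carrier G) {\<one>} (\<lambda>_. 1)"
    unfolding stable_character_def using subgroup_self triv_subgroup by auto
  have comm: "t \<otimes> x \<otimes> inv t \<otimes> inv x \<in> {\<one>}" if "t \<in> carrier G" for t
    using conj[OF that] x by simp
  have pow': "1 = c ^ i" if "x [^] i \<in> {\<one>}" for i :: nat using pow[OF that] by simp
  obtain A \<nu> where A: "subgroup A G" "{\<one>} \<subseteq> A" "x \<in> A" "A \<subseteq> carrier G" "\<And>n. n \<in> {\<one>} \<Longrightarrow> \<nu> n = 1" "\<nu> x = c"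
    "\<And>y z. y \<in> A \<Longrightarrow> z \<in> A \<Longrightarrow> \<nu> (y \<otimes> z) = \<nu> y * \<nu> z"
    "\<And>t y. t \<in> carrier G \<Longrightarrow> y \<in> A \<Longrightarrow> t \<otimes> y \<otimes> inv t \<in> A"
    "\<And>t y. t \<in> carrier G \<Longrightarrow> \<nu> (t \<otimes> x \<otimes> inv t) = c \<Longrightarrow> y \<in> A \<Longrightarrow> \<nu> (t \<otimes> y \<otimes> inv t) = \<nu> y"
    "\<And>t. t \<in> A \<Longrightarrow> \<nu> (t \<otimes> x \<otimes> inv t) = c"
    by (rule extend_stable_character[where c = c, OF fin st x(1) comm pow']; (assumption | rule that; assumption))
  then have "stable_character (carrier G) A \<nu>"
    unfolding stable_character_def using subgroup_self conj by (auto dest: subgroup.subset)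
  from stable_character_refines_to_mackey[OF p fin card this]
  obtain H \<kappa> where "mackey_pair H \<kappa>" "A \<subseteq> H" "\<forall>n\<in>A. \<kappa> n = \<nu> n"
    unfolding mackey_pair_def by blast
  then show ?thesis using A c by (intro exI[of _ H] exI[of _ \<kappa>]) auto
qed

end

section \<open>Irreducible representations and their degrees\<close>

text \<open>
  Homomorphisms to \<open>GL n\<close> without reference to units: inverses are automatic on a group.
\<close>

definition matrix_rep :: "('a, 'b) monoid_scheme \<Rightarrow> nat \<Rightarrow> ('a \<Rightarrow> complex mat) \<Rightarrow> bool" where
  "matrix_rep G n \<rho> \<longleftrightarrow> (\<forall>g\<in>carrier G. \<rho> g \<in> carrier_mat n n) \<and> \<rho> \<one>\<^bsub>G\<^esub> = 1\<^sub>m n \<and>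
     (\<forall>g\<in>carrier G. \<forall>h\<in>carrier G. \<rho> (g \<otimes>\<^bsub>G\<^esub> h) = \<rho> g * \<rho> h)"

lemma mult_mat_zero_vec: "M \<in> carrier_mat m n \<Longrightarrow> M *\<^sub>v 0\<^sub>v n = (0\<^sub>v m :: 'a :: semiring_0 vec)"
  by (intro eq_vecI) (auto simp: scalar_prod_def)

lemma GL_simps:
  "carrier (GL n) = Units (ring_mat TYPE(complex) n ())"
  "A \<otimes>\<^bsub>GL n\<^esub> B = A * B" "\<one>\<^bsub>GL n\<^esub> = 1\<^sub>m n"
  by (simp_all add: units_of_def ring_mat_simps)

context group begin

lemma hom_GL_iff: "\<rho> \<in> hom G (GL n) \<longleftrightarrow> matrix_rep G n \<rho>"
proof
  interpret R: ring "ring_mat TYPE(complex) n ()" by (rule ring_mat)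
  assume h: "\<rho> \<in> hom G (GL n)"
  have "group (GL n)" by (rule R.units_group)
  then have "\<rho> \<one> = 1\<^sub>m n" using hom_one[OF h is_group] by (simp add: GL_simps)
  then show "matrix_rep G n \<rho>"
    using h unfolding matrix_rep_def hom_def by (auto simp: GL_simps Units_def ring_mat_simps)
next
  assume r: "matrix_rep G n \<rho>"
  have "\<rho> g \<in> Units (ring_mat TYPE(complex) n ())" if g: "g \<in> carrier G" for g
  proof -
    have "\<rho> (g \<otimes> inv g) = \<rho> g * \<rho> (inv g)" "\<rho> (inv g \<otimes> g) = \<rho> (inv g) * \<rho> g"
      and one: "\<rho> \<one> = 1\<^sub>m n"
      using r g unfolding matrix_rep_def by blast+
    then have "\<rho> g * \<rho> (inv g) = 1\<^sub>m n" "\<rho> (inv g) * \<rho> g = 1\<^sub>m n"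
      unfolding r_inv[OF g] l_inv[OF g] one by simp_all
    then show ?thesis
      using r g unfolding matrix_rep_def Units_def by (auto simp: ring_mat_simps intro!: bexI[of _ "\<rho> (inv g)"])
  qed
  then show "\<rho> \<in> hom G (GL n)"
    using r unfolding hom_def matrix_rep_def by (auto simp: GL_simps)
qed

lemma irreducible_rep_iff:
  "irreducible_rep G n \<rho> \<longleftrightarrow> matrix_rep G n \<rho> \<and> n > 0 \<and>
     (\<forall>W. vec_subspace n W \<longrightarrow> (\<forall>g\<in>carrier G. \<forall>w\<in>W. \<rho> g *\<^sub>v w \<in> W) \<longrightarrow> W = {0\<^sub>v n} \<or> W = carrier_vec n)"
  unfolding irreducible_rep_def hom_GL_iff vec_subspace_def by auto

lemma cd_iff: "n \<in> cd G \<longleftrightarrow> (\<exists>\<rho>. irreducible_rep G n \<rho>)"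
proof -
  have tr: "mat_trace (\<rho> \<one>) = of_nat m" if "irreducible_rep G m \<rho>" for m \<rho>
    using that unfolding irreducible_rep_iff matrix_rep_def mat_trace_def by auto
  show ?thesis
  proof
    assume "n \<in> cd G"
    then obtain \<rho> m where "irreducible_rep G m \<rho>" "mat_trace (\<rho> \<one>) = of_nat n"
      unfolding cd_def Irr_def by auto
    then show "\<exists>\<rho>. irreducible_rep G n \<rho>" using tr by (metis of_nat_eq_iff)
  next
    assume "\<exists>\<rho>. irreducible_rep G n \<rho>"
    then show "n \<in> cd G" unfolding cd_def Irr_def using tr by fastforce
  qed
qed

lemma matrix_rep_cyclic_action:
  assumes r: "matrix_rep G n \<rho>" and x: "x \<in> carrier G" "x [^] N = \<one>" and "N > 0" "primitive_root N w"
  shows "cyclic_action n N w (\<lambda>t. \<rho> (x [^] t))"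
proof
  show "\<rho> (x [^] (s + t)) = \<rho> (x [^] s) * \<rho> (x [^] t)" for s t :: nat
    using r x unfolding matrix_rep_def by (simp add: nat_pow_mult[symmetric])
qed (use assms in \<open>auto simp: matrix_rep_def\<close>)

lemma rep_mult_vec:
  assumes "matrix_rep G n \<rho>" "g \<in> carrier G" "h \<in> carrier G" "v \<in> carrier_vec n"
  shows "\<rho> (g \<otimes> h) *\<^sub>v v = \<rho> g *\<^sub>v (\<rho> h *\<^sub>v v)" "\<rho> g *\<^sub>v v \<in> carrier_vec n"
proof -
  have "\<rho> g \<in> carrier_mat n n" "\<rho> h \<in> carrier_mat n n" "\<rho> (g \<otimes> h) = \<rho> g * \<rho> h"
    using assms unfolding matrix_rep_def by auto
  then show "\<rho> (g \<otimes> h) *\<^sub>v v = \<rho> g *\<^sub>v (\<rho> h *\<^sub>v v)" "\<rho> g *\<^sub>v v \<in> carrier_vec n"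
    using assms(4) by auto
qed

text \<open>
  One element at a time: the joint eigenspace found so far is invariant under the next element,
  since the elements commute, and hence contains an eigenvector of it.
\<close>

lemma common_eigenvector:
  assumes r: "matrix_rep G n \<rho>" and n: "n > 0" and fin: "finite (carrier G)"
    and S: "finite S" "S \<subseteq> carrier G" and comm: "\<And>a b. a \<in> S \<Longrightarrow> b \<in> S \<Longrightarrow> a \<otimes> b = b \<otimes> a"
  shows "\<exists>v\<in>carrier_vec n. v \<noteq> 0\<^sub>v n \<and> (\<forall>a\<in>S. \<exists>c. \<rho> a *\<^sub>v v = c \<cdot>\<^sub>v v)"
  using S comm
proof (induction S)
  case empty
  have "unit_vec n 0 \<noteq> (0\<^sub>v n :: complex vec)" using n by simp
  then show ?case by (intro bexI[of _ "unit_vec n 0"]) auto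
next
  case (insert a S)
  then obtain v where v: "v \<in> carrier_vec n" "v \<noteq> 0\<^sub>v n" and "\<forall>b\<in>S. \<exists>c. \<rho> b *\<^sub>v v = c \<cdot>\<^sub>v v" by auto
  then obtain c where c: "\<And>b. b \<in> S \<Longrightarrow> \<rho> b *\<^sub>v v = c b \<cdot>\<^sub>v v" by metis
  have a: "a \<in> carrier G" using insert by auto
  have rc: "\<rho> g \<in> carrier_mat n n" if "g \<in> carrier G" for g using r that unfolding matrix_rep_def by auto
  define W where "W = {w \<in> carrier_vec n. \<forall>b\<in>S. \<rho> b *\<^sub>v w = c b \<cdot>\<^sub>v w}"
  have Sc: "b \<in> carrier G" if "b \<in> S" for b using insert.prems that by auto
  have W: "vec_subspace n W"
  proof (rule vec_subspaceI)
    have "\<rho> b *\<^sub>v 0\<^sub>v n = c b \<cdot>\<^sub>v 0\<^sub>v n" if "b \<in> S" for b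
      using mult_mat_zero_vec[OF rc[OF Sc[OF that]]] by auto
    then show "0\<^sub>v n \<in> W" unfolding W_def by auto
    show "u + w \<in> W" if "u \<in> W" "w \<in> W" for u w
    proof -
      have "\<rho> b *\<^sub>v (u + w) = c b \<cdot>\<^sub>v (u + w)" if "b \<in> S" for b
        using \<open>u \<in> W\<close> \<open>w \<in> W\<close> that rc[OF Sc[OF that]] unfolding W_def
        by (simp add: mult_add_distrib_mat_vec[of _ n n] smult_add_distrib_vec[of _ n])
      then show ?thesis using that unfolding W_def by auto
    qed
    show "k \<cdot>\<^sub>v w \<in> W" if "w \<in> W" for k w
    proof -
      have "\<rho> b *\<^sub>v (k \<cdot>\<^sub>v w) = c b \<cdot>\<^sub>v (k \<cdot>\<^sub>v w)" if "b \<in> S" for b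
        using \<open>w \<in> W\<close> that rc[OF Sc[OF that]] unfolding W_def
        by (simp add: mult_mat_vec smult_smult_assoc mult.commute)
      then show ?thesis using that unfolding W_def by auto
    qed
  qed (auto simp: W_def)
  let ?N = "Coset.order G"
  have N: "?N > 0" using fin by (simp add: order_gt_0_iff_finite)
  obtain w where w: "primitive_root ?N w" using primitive_root_exists[OF N] by blast
  interpret cyclic_action n ?N w "\<lambda>t. \<rho> (a [^] t)"
    by (rule matrix_rep_cyclic_action[OF r a pow_order_eq_1[OF a] N w])
  have inv: "\<rho> (a [^] t) *\<^sub>v v \<in> W" for t :: nat
  proof -
    have "\<rho> b *\<^sub>v (\<rho> (a [^] t) *\<^sub>v v) = c b \<cdot>\<^sub>v (\<rho> (a [^] t) *\<^sub>v v)" if b: "b \<in> S" for b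
    proof -
      have "b \<otimes> a [^] t = a [^] t \<otimes> b"
        using insert.prems(2)[of b a] b a Sc[OF b] by (simp add: group_commutes_pow)
      then have "\<rho> b *\<^sub>v (\<rho> (a [^] t) *\<^sub>v v) = \<rho> (a [^] t) *\<^sub>v (\<rho> b *\<^sub>v v)"
        using rep_mult_vec(1)[OF r] Sc[OF b] a v by (metis nat_pow_closed)
      also have "\<dots> = c b \<cdot>\<^sub>v (\<rho> (a [^] t) *\<^sub>v v)"
        unfolding c[OF b] using rc[of "a [^] t"] a v by (simp add: mult_mat_vec)
      finally show ?thesis .
    qed
    then show ?thesis unfolding W_def using rep_mult_vec(2)[OF r _ a, of "a [^] t" v] a v by auto
  qed
  have "v \<in> W" unfolding W_def using v c by auto
  from exists_eigenvector_in_subspace[OF W this v(2) inv]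
  obtain j where j: "P j *\<^sub>v v \<in> W" "P j *\<^sub>v v \<noteq> 0\<^sub>v n" by blast
  have "\<rho> (a [^] (1 mod ?N)) *\<^sub>v (P j *\<^sub>v v) = w ^ (j * (1 mod ?N)) \<cdot>\<^sub>v (P j *\<^sub>v v)"
    using N v(1) by (intro rho_E_vec) auto
  then have "\<rho> a *\<^sub>v (P j *\<^sub>v v) = w ^ j \<cdot>\<^sub>v (P j *\<^sub>v v)"
    unfolding R_mod w_mod using a by simp
  then show ?case using j unfolding W_def by blast
qed

text \<open>
  If \<open>v\<close> is a common eigenvector of \<open>A\<close>, then the translates of \<open>v\<close> by coset representatives span
  an invariant subspace.
\<close>

lemma irreducible_degree_le_index:
  assumes irr: "irreducible_rep G n \<rho>" and fin: "finite (carrier G)"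
    and A: "subgroup A G" and comm: "\<And>a b. a \<in> A \<Longrightarrow> b \<in> A \<Longrightarrow> a \<otimes> b = b \<otimes> a"
  shows "n \<le> card (rcosets A)"
proof -
  have r: "matrix_rep G n \<rho>" and n: "n > 0"
    and simple: "\<And>W. vec_subspace n W \<Longrightarrow> (\<And>g w. g \<in> carrier G \<Longrightarrow> w \<in> W \<Longrightarrow> \<rho> g *\<^sub>v w \<in> W) \<Longrightarrow> W = {0\<^sub>v n} \<or> W = carrier_vec n"
    using irr unfolding irreducible_rep_iff by auto
  have Ac: "A \<subseteq> carrier G" using A by (rule subgroup.subset)
  have rc: "\<rho> g \<in> carrier_mat n n" if "g \<in> carrier G" for g using r that unfolding matrix_rep_def by auto
  have "finite A" using Ac fin finite_subset by blast
  from common_eigenvector[OF r n fin this Ac comm]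
  obtain v where v: "v \<in> carrier_vec n" "v \<noteq> 0\<^sub>v n" and eig: "\<forall>a\<in>A. \<exists>c. \<rho> a *\<^sub>v v = c \<cdot>\<^sub>v v" by blast
  define rep where "rep C = (SOME g. g \<in> C)" for C :: "'a set"
  \<comment> \<open>Inverses turn representatives of right cosets into representatives of left cosets.\<close>
  define f where "f C = \<rho> (inv (rep C)) *\<^sub>v v" for C
  define S where "S = f ` (rcosets A)"
  have rep: "rep C \<in> C \<and> rep C \<in> carrier G" if C: "C \<in> rcosets A" for C
  proof -
    obtain g where g: "g \<in> carrier G" "C = A #> g" using C unfolding RCOSETS_def by auto
    then have "g \<in> C" using rcos_self[OF _ A] by simp
    then have "rep C \<in> C" unfolding rep_def by (rule someI)
    then show ?thesis using g r_coset_subset_G[OF Ac] by auto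
  qed
  interpret V: vec_space "TYPE(complex)" n .
  have Sc: "S \<subseteq> carrier_vec n" unfolding S_def f_def using rep rep_mult_vec(2)[OF r _ one_closed v(1)] by auto
  have subm: "vec_subspace n (V.span S)"
    unfolding vec_subspace_def using Sc by (intro V.span_is_subspace) (simp add: module_vec_simps)
  have own: "S \<subseteq> V.span S" using Sc by (intro V.in_own_span) (simp add: module_vec_simps)
  have inv_S: "\<rho> g *\<^sub>v s \<in> V.span S" if g: "g \<in> carrier G" and s: "s \<in> S" for g s
  proof -
    obtain C where C: "C \<in> rcosets A" "s = f C" using s unfolding S_def by auto
    define x where "x = rep C \<otimes> inv g"
    have xc: "x \<in> carrier G" unfolding x_def using rep[OF C(1)] g by simp
    define C' where "C' = A #> x"
    have C': "C' \<in> rcosets A" unfolding C'_def RCOSETS_def using xc by auto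
    obtain a where a: "a \<in> A" "rep C' = a \<otimes> x" using rep[OF C'] unfolding C'_def r_coset_def by auto
    have ac: "a \<in> carrier G" using a Ac by auto
    have "\<rho> g *\<^sub>v s = \<rho> (g \<otimes> inv (rep C)) *\<^sub>v v"
      unfolding C(2) f_def using rep_mult_vec(1)[OF r g _ v(1)] rep[OF C(1)] by simp
    also have "g \<otimes> inv (rep C) = inv (rep C') \<otimes> a"
      unfolding a(2) x_def using rep[OF C(1)] g ac by (simp add: inv_mult_group m_assoc)
    also have "\<rho> (inv (rep C') \<otimes> a) *\<^sub>v v = \<rho> (inv (rep C')) *\<^sub>v (\<rho> a *\<^sub>v v)"
      using rep_mult_vec(1)[OF r _ ac v(1)] rep[OF C'] by simp
    also obtain c where "\<rho> a *\<^sub>v v = c \<cdot>\<^sub>v v" using eig a by blast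
    also have "\<rho> (inv (rep C')) *\<^sub>v (c \<cdot>\<^sub>v v) = c \<cdot>\<^sub>v f C'"
      unfolding f_def using rc[of "inv (rep C')"] rep[OF C'] v by (simp add: mult_mat_vec)
    finally have "\<rho> g *\<^sub>v s = c \<cdot>\<^sub>v f C'" .
    moreover have "f C' \<in> V.span S" using own C' unfolding S_def by auto
    ultimately show ?thesis using vec_subspaceD(4)[OF subm] by simp
  qed
  have inv_span: "\<rho> g *\<^sub>v w \<in> V.span S" if g: "g \<in> carrier G" and w: "w \<in> V.span S" for g w
  proof -
    define W where "W = {w \<in> carrier_vec n. \<rho> g *\<^sub>v w \<in> V.span S}"
    have "vec_subspace n W"
    proof (rule vec_subspaceI)
      show "0\<^sub>v n \<in> W" unfolding W_def using rc[OF g] vec_subspaceD(2)[OF subm] by (auto simp: mult_mat_zero_vec)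
      show "u + w \<in> W" if "u \<in> W" "w \<in> W" for u w
        using that rc[OF g] vec_subspaceD(3)[OF subm] unfolding W_def by (auto simp: mult_add_distrib_mat_vec)
      show "k \<cdot>\<^sub>v w \<in> W" if "w \<in> W" for k w
        using that rc[OF g] vec_subspaceD(4)[OF subm] unfolding W_def by (auto simp: mult_mat_vec)
    qed (auto simp: W_def)
    then have "submodule class_ring W (module_vec TYPE(complex) n)"
      unfolding vec_subspace_def VectorSpace.subspace_def by simp
    moreover have "S \<subseteq> W" unfolding W_def using Sc inv_S[OF g] by auto
    ultimately have "V.span S \<subseteq> W" by (intro V.span_is_subset)
    then show ?thesis using w unfolding W_def by auto
  qed
  have "V.span S = {0\<^sub>v n} \<or> V.span S = carrier_vec n"
    by (rule simple[OF subm inv_span])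
  moreover have "V.span S \<noteq> {0\<^sub>v n}"
  proof
    assume z: "V.span S = {0\<^sub>v n}"
    have AR: "A \<in> rcosets A" unfolding RCOSETS_def using coset_mult_one[OF Ac] by force
    have "f A \<in> V.span S" using own AR unfolding S_def by auto
    then have "\<rho> (inv (rep A)) *\<^sub>v v = 0\<^sub>v n" using z unfolding f_def by simp
    then have "\<rho> (rep A) *\<^sub>v (\<rho> (inv (rep A)) *\<^sub>v v) = 0\<^sub>v n" using rc[of "rep A"] rep[OF AR] by auto
    then have "\<rho> (rep A \<otimes> inv (rep A)) *\<^sub>v v = 0\<^sub>v n"
      using rep[OF AR] by (subst rep_mult_vec(1)[OF r _ _ v(1)]) auto
    then show False using r v rep[OF AR] unfolding matrix_rep_def by simp
  qed
  ultimately have span: "V.span S = carrier_vec n" by blast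
  have "finite (rcosets A)" unfolding RCOSETS_def using fin by simp
  then have finS: "finite S" and card: "card S \<le> card (rcosets A)" unfolding S_def by (auto intro: card_image_le)
  have "V.dim \<le> card S"
    using finS Sc span by (intro V.gen_ge_dim) (auto simp: module_vec_simps)
  then show ?thesis using card V.dim_is_n by simp
qed

text \<open>
  This is what makes \<open>Max (cd G)\<close> the largest degree.
\<close>

lemma finite_cd:
  assumes fin: "finite (carrier G)" shows "finite (cd G)"
proof (rule finite_subset)
  show "cd G \<subseteq> {..card (rcosets {\<one>})}"
    unfolding cd_iff subset_iff using irreducible_degree_le_index[OF _ fin triv_subgroup] by auto
qed simp

text \<open>
  The representative of \<open>H\<close> itself is \<open>\<one>\<close>; the last clause says that \<open>r\<close> represents the left cosets.
\<close>

lemma transversal_exists: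
  assumes fin: "finite (carrier G)" and H: "subgroup H G"
  obtains r :: "nat \<Rightarrow> 'a" and i0 where "\<And>i. i < card (rcosets H) \<Longrightarrow> r i \<in> carrier G"
    "i0 < card (rcosets H)" "r i0 = \<one>"
    "\<And>g. g \<in> carrier G \<Longrightarrow> \<exists>!i. i < card (rcosets H) \<and> inv (r i) \<otimes> g \<in> H"
proof -
  let ?m = "card (rcosets H)"
  have Hc: "H \<subseteq> carrier G" using H by (rule subgroup.subset)
  have "finite (rcosets H)" unfolding RCOSETS_def using fin by simp
  then obtain f where f: "bij_betw f {..<?m} (rcosets H)"
    using ex_bij_betw_nat_finite[of "rcosets H"] by (auto simp: lessThan_atLeast0)
  define s where "s i = (if f i = H then \<one> else (SOME g. g \<in> f i))" for i
  have s: "s i \<in> carrier G \<and> f i = H #> s i" if i: "i < ?m" for i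
  proof -
    have "f i \<in> rcosets H" using f i unfolding bij_betw_def by auto
    then obtain g where g: "g \<in> carrier G" "f i = H #> g" unfolding RCOSETS_def by auto
    then have "g \<in> f i" using rcos_self[OF _ H] by simp
    then have "(SOME g. g \<in> f i) \<in> f i" by (rule someI)
    then have "(SOME g. g \<in> f i) \<in> H #> g" using g by simp
    then have "H #> g = H #> (SOME g. g \<in> f i)" "(SOME g. g \<in> f i) \<in> carrier G"
      using g repr_independence[OF _ g(1) H] r_coset_subset_G[OF Hc g(1)] by auto
    then show ?thesis unfolding s_def using g coset_mult_one[OF Hc] by auto
  qed
  have HR: "H \<in> rcosets H" unfolding RCOSETS_def using coset_mult_one[OF Hc] by force
  then obtain i0 where i0: "i0 < ?m" "f i0 = H" using f unfolding bij_betw_def by (metis imageE lessThan_iff)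
  have key: "s i \<otimes> g \<in> H \<longleftrightarrow> f i = H #> inv g" if i: "i < ?m" and g: "g \<in> carrier G" for i g
  proof
    assume sg: "s i \<otimes> g \<in> H"
    have "s i = (s i \<otimes> g) \<otimes> inv g" using s[OF i] g by (simp add: m_assoc)
    then have "s i \<in> H #> inv g" unfolding r_coset_def using sg by blast
    then have "H #> inv g = H #> s i" using repr_independence[of "s i" H "inv g"] g H by simp
    then show "f i = H #> inv g" using s[OF i] by simp
  next
    assume "f i = H #> inv g"
    then have "s i \<in> H #> inv g" using s[OF i] rcos_self[OF _ H, of "s i"] by simp
    then obtain h where h: "h \<in> H" "s i = h \<otimes> inv g" unfolding r_coset_def by auto
    then show "s i \<otimes> g \<in> H" using g Hc by (auto simp: m_assoc subset_iff)
  qed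
  show ?thesis
  proof (rule that[of "\<lambda>i. inv (s i)" i0])
    show "inv (s i0) = \<one>" unfolding s_def using i0 by simp
    show "inv (s i) \<in> carrier G" if "i < ?m" for i using s[OF that] by simp
    fix g assume g: "g \<in> carrier G"
    have "H #> inv g \<in> rcosets H" unfolding RCOSETS_def using g by auto
    then have "\<exists>!i. i < ?m \<and> f i = H #> inv g"
      using f unfolding bij_betw_def inj_on_def by (smt (verit) imageE lessThan_iff)
    moreover have "(i < ?m \<and> inv (inv (s i)) \<otimes> g \<in> H) \<longleftrightarrow> (i < ?m \<and> f i = H #> inv g)" for i
    proof (cases "i < ?m")
      case True
      have "inv (inv (s i)) = s i" using s[OF True] by (intro inv_inv) blast
      then show ?thesis using key[OF True g] by (simp only:)
    qed simp
    ultimately show "\<exists>!i. i < ?m \<and> inv (inv (s i)) \<otimes> g \<in> H" by simp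
  qed (rule i0(1))
qed

text \<open>
  The representation induced from \<open>\<mu>\<close> acts by monomial matrices on the space of functions on the cosets of \<open>H\<close>. Projecting any
  vector of an invariant subspace to the \<open>\<mu>\<close>-eigenspace of \<open>H\<close> gives, by Mackey's condition, a
  multiple of the basis vector that belongs to \<open>H\<close>, and this vector generates the whole space.
\<close>

lemma mackey_pair_irreducible:
  assumes fin: "finite (carrier G)" and M: "mackey_pair H \<mu>"
  shows "card (rcosets H) \<in> cd G"
proof -
  let ?m = "card (rcosets H)"
  have H: "subgroup H G" and mu1: "\<mu> \<one> = 1"
    and mu_mult: "\<And>x y. x \<in> H \<Longrightarrow> y \<in> H \<Longrightarrow> \<mu> (x \<otimes> y) = \<mu> x * \<mu> y"
    and mackey: "\<And>g. g \<in> carrier G \<Longrightarrow> g \<notin> H \<Longrightarrow> \<exists>x\<in>H. g \<otimes> x \<otimes> inv g \<in> H \<and> \<mu> (g \<otimes> x \<otimes> inv g) \<noteq> \<mu> x"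
    using M unfolding mackey_pair_def by auto
  have Hc: "\<And>h. h \<in> H \<Longrightarrow> h \<in> carrier G" using subgroup.subset[OF H] by blast
  have H1: "\<one> \<in> H" using H by (rule subgroup.one_closed)
  have mu_nz: "\<mu> h \<noteq> 0" if "h \<in> H" for h
  proof -
    have "\<mu> h * \<mu> (inv h) = \<mu> (h \<otimes> inv h)" using that H by (simp add: mu_mult subgroup.m_inv_closed del: r_inv)
    then show ?thesis using mu1 Hc[OF that] by auto
  qed
  obtain r i0 where rc: "\<And>i. i < ?m \<Longrightarrow> r i \<in> carrier G" and i0: "i0 < ?m" "r i0 = \<one>"
    and uniq: "\<And>g. g \<in> carrier G \<Longrightarrow> \<exists>!i. i < ?m \<and> inv (r i) \<otimes> g \<in> H"
    by (rule transversal_exists[OF fin H]; (assumption | rule that; assumption))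
  have unique: "i = j" if "i < ?m" "j < ?m" "g \<in> carrier G" "inv (r i) \<otimes> g \<in> H" "inv (r j) \<otimes> g \<in> H" for i j g
    using uniq[OF that(3)] that by blast
  define \<rho> where "\<rho> g = mat ?m ?m (\<lambda>(i, j). if inv (r i) \<otimes> g \<otimes> r j \<in> H then \<mu> (inv (r i) \<otimes> g \<otimes> r j) else 0)" for g
  have rho_vec: "(\<rho> g *\<^sub>v w) $ i = \<mu> (inv (r i) \<otimes> g \<otimes> r j) * w $ j"
    if g: "g \<in> carrier G" and w: "w \<in> carrier_vec ?m" and ij: "i < ?m" "j < ?m"
      and mem: "inv (r i) \<otimes> g \<otimes> r j \<in> H" for g w i j
  proof -
    have "(\<rho> g *\<^sub>v w) $ i = (\<Sum>l<?m. \<rho> g $$ (i, l) * w $ l)"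
      using ij w unfolding \<rho>_def by (simp add: scalar_prod_def lessThan_atLeast0)
    also have "\<dots> = (\<Sum>l<?m. if l = j then \<mu> (inv (r i) \<otimes> g \<otimes> r j) * w $ j else 0)"
    proof (intro sum.cong refl)
      fix l assume "l \<in> {..<?m}"
      then have l: "l < ?m" by simp
      have "l = j" if "inv (r i) \<otimes> g \<otimes> r l \<in> H"
      proof (rule unique[OF l ij(2)])
        show "inv g \<otimes> r i \<in> carrier G" using g rc ij by simp
        have "inv (r k) \<otimes> (inv g \<otimes> r i) = inv (inv (r i) \<otimes> g \<otimes> r k)" if "k < ?m" for k
          using rc[OF that] rc[OF ij(1)] g by (simp add: inv_mult_group)
        then show "inv (r l) \<otimes> (inv g \<otimes> r i) \<in> H" "inv (r j) \<otimes> (inv g \<otimes> r i) \<in> H"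
          using that mem l ij H by (auto simp: subgroup.m_inv_closed)
      qed
      then show "\<rho> g $$ (i, l) * w $ l = (if l = j then \<mu> (inv (r i) \<otimes> g \<otimes> r j) * w $ j else 0)"
        using ij(1) l mem unfolding \<rho>_def by (cases "l = j") auto
    qed
    also have "\<dots> = \<mu> (inv (r i) \<otimes> g \<otimes> r j) * w $ j" using ij by simp
    finally show ?thesis .
  qed
  have rep: "matrix_rep G ?m \<rho>"
    unfolding matrix_rep_def
  proof (intro conjI ballI)
    show "\<rho> g \<in> carrier_mat ?m ?m" for g unfolding \<rho>_def by simp
    show "\<rho> \<one> = 1\<^sub>m ?m"
    proof (rule eq_matI)
      fix i j assume "i < dim_row (1\<^sub>m ?m :: complex mat)" "j < dim_col (1\<^sub>m ?m :: complex mat)"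
      then have ij: "i < ?m" "j < ?m" by auto
      have "i = j" if "inv (r i) \<otimes> r j \<in> H"
        using unique[OF ij rc[OF ij(2)] that] rc[OF ij(2)] H1 by simp
      then show "\<rho> \<one> $$ (i, j) = 1\<^sub>m ?m $$ (i, j)"
        using ij rc[OF ij(1)] rc[OF ij(2)] H1 mu1 unfolding \<rho>_def by auto
    qed (auto simp: \<rho>_def)
    fix g h assume g: "g \<in> carrier G" and h: "h \<in> carrier G"
    show "\<rho> (g \<otimes> h) = \<rho> g * \<rho> h"
    proof (rule eq_matI)
      fix i k assume "i < dim_row (\<rho> g * \<rho> h)" "k < dim_col (\<rho> g * \<rho> h)"
      then have ik: "i < ?m" "k < ?m" by (auto simp: \<rho>_def)
      obtain j where j: "j < ?m" "inv (r j) \<otimes> (h \<otimes> r k) \<in> H"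
        using uniq[of "h \<otimes> r k"] h rc[OF ik(2)] by auto
      have split: "inv (r i) \<otimes> (g \<otimes> h) \<otimes> r k = (inv (r i) \<otimes> g \<otimes> r j) \<otimes> (inv (r j) \<otimes> (h \<otimes> r k))"
        using g h rc ik j by (simp add: m_assoc mult_inv_cancel)
      have iff: "inv (r i) \<otimes> (g \<otimes> h) \<otimes> r k \<in> H \<longleftrightarrow> inv (r i) \<otimes> g \<otimes> r j \<in> H"
      proof
        assume "inv (r i) \<otimes> g \<otimes> r j \<in> H"
        then show "inv (r i) \<otimes> (g \<otimes> h) \<otimes> r k \<in> H" unfolding split using j H by (simp add: subgroup.m_closed)
      next
        assume A: "inv (r i) \<otimes> (g \<otimes> h) \<otimes> r k \<in> H"
        have "inv (r i) \<otimes> g \<otimes> r j = (inv (r i) \<otimes> (g \<otimes> h) \<otimes> r k) \<otimes> inv (inv (r j) \<otimes> (h \<otimes> r k))"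
          using g h rc ik j by (simp add: m_assoc mult_inv_cancel inv_mult_group)
        then show "inv (r i) \<otimes> g \<otimes> r j \<in> H" using A j H by (simp add: subgroup.m_closed subgroup.m_inv_closed)
      qed
      have "(\<rho> g * \<rho> h) $$ (i, k) = (\<Sum>l<?m. \<rho> g $$ (i, l) * \<rho> h $$ (l, k))"
        using ik unfolding \<rho>_def by (simp add: scalar_prod_def lessThan_atLeast0)
      also have "\<dots> = (\<Sum>l<?m. if l = j then \<rho> g $$ (i, j) * \<mu> (inv (r j) \<otimes> h \<otimes> r k) else 0)"
      proof (intro sum.cong refl)
        fix l assume "l \<in> {..<?m}"
        then have l: "l < ?m" by simp
        have "l = j" if "inv (r l) \<otimes> h \<otimes> r k \<in> H"
          using unique[OF l j(1) _ _ j(2)] that h rc l ik by (simp add: m_assoc)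
        moreover have "inv (r j) \<otimes> h \<otimes> r k \<in> H" using j h rc ik by (simp add: m_assoc)
        ultimately show "\<rho> g $$ (i, l) * \<rho> h $$ (l, k) = (if l = j then \<rho> g $$ (i, j) * \<mu> (inv (r j) \<otimes> h \<otimes> r k) else 0)"
          using ik l unfolding \<rho>_def by (cases "l = j") auto
      qed
      also have "\<dots> = \<rho> g $$ (i, j) * \<mu> (inv (r j) \<otimes> (h \<otimes> r k))"
        using j h rc ik by (simp add: m_assoc)
      also have "\<dots> = \<rho> (g \<otimes> h) $$ (i, k)"
        unfolding \<rho>_def using ik j iff split by (auto simp: mu_mult)
      finally show "\<rho> (g \<otimes> h) $$ (i, k) = (\<rho> g * \<rho> h) $$ (i, k)" ..
    qed (auto simp: \<rho>_def)
  qed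
  have "irreducible_rep G ?m \<rho>"
    unfolding irreducible_rep_iff
  proof (intro conjI allI impI)
    show "?m > 0" using i0 by simp
    fix W assume W: "vec_subspace ?m W" and invar: "\<forall>g\<in>carrier G. \<forall>w\<in>W. \<rho> g *\<^sub>v w \<in> W"
    note WD = vec_subspaceD[OF W]
    show "W = {0\<^sub>v ?m} \<or> W = carrier_vec ?m"
    proof (cases "W = {0\<^sub>v ?m}")
      case False
      then obtain w where w: "w \<in> W" "w \<noteq> 0\<^sub>v ?m" using WD(2) by auto
      have wc: "w \<in> carrier_vec ?m" using w WD by auto
      obtain i where i: "i < ?m" "w $ i \<noteq> 0"
      proof (rule ccontr)
        assume "\<not> thesis"
        then have "\<And>i. i < ?m \<Longrightarrow> w $ i = 0" using that by blast
        then have "w = 0\<^sub>v ?m" using wc by (intro eq_vecI) auto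
        then show False using w by simp
      qed
      \<comment> \<open>Translation moves a nonzero coordinate of \<open>w\<close> to the coordinate \<open>i0\<close> of the coset \<open>H\<close>.\<close>
      define w' where "w' = \<rho> (inv (r i)) *\<^sub>v w"
      have w': "w' \<in> W" "w' \<in> carrier_vec ?m" unfolding w'_def using invar w rc[OF i(1)] WD by auto
      have "w' $ i0 = \<mu> (inv (r i0) \<otimes> inv (r i) \<otimes> r i) * w $ i"
        unfolding w'_def using rc[OF i(1)] i0 i wc H1 by (intro rho_vec) auto
      then have w'0: "w' $ i0 \<noteq> 0" using i i0 rc[OF i(1)] mu1 by simp
      interpret A: averaging ?m H "(\<otimes>)" \<mu> \<rho>
      proof
        show "finite H" using Hc fin by (meson finite_subset subsetI)
        show "inj_on ((\<otimes>) h) H" if "h \<in> H" for h using Hc that by (auto intro!: inj_onI)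
        show "H \<noteq> {}" using H1 by auto
        show "x \<otimes> y \<in> H" if "x \<in> H" "y \<in> H" for x y using that by (rule subgroup.m_closed[OF H])
        show "\<rho> h \<in> carrier_mat ?m ?m" for h unfolding \<rho>_def by simp
        show "\<rho> (x \<otimes> y) = \<rho> x * \<rho> y" if "x \<in> H" "y \<in> H" for x y
          using rep Hc[OF that(1)] Hc[OF that(2)] unfolding matrix_rep_def by blast
      qed (fact mu_mult mu_nz)+
      define u where "u = A.E *\<^sub>v w'"
      have u: "u \<in> W" "u \<in> carrier_vec ?m"
      proof -
        show "u \<in> W" unfolding u_def
          using A.fin A.rho_carrier w' invar Hc by (intro isotypic_projection_in_subspace[OF W]) auto
        then show "u \<in> carrier_vec ?m" using WD by auto
      qed
      have u_eig: "\<rho> h *\<^sub>v u = \<mu> h \<cdot>\<^sub>v u" if "h \<in> H" for h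
        unfolding u_def using that w' by (intro A.rho_E_vec)
      have u0: "u $ i0 = w' $ i0"
      proof -
        have "u $ i0 = (\<Sum>h\<in>H. ((inverse (\<mu> h) / of_nat (card H)) \<cdot>\<^sub>v (\<rho> h *\<^sub>v w')) $ i0)"
          unfolding u_def using A.rho_carrier A.fin w' i0 by (subst isotypic_projection_mult_vec) auto
        also have "\<dots> = (\<Sum>h\<in>H. w' $ i0 / of_nat (card H))"
        proof (intro sum.cong refl)
          fix h assume h: "h \<in> H"
          have "(\<rho> h *\<^sub>v w') $ i0 = \<mu> (inv (r i0) \<otimes> h \<otimes> r i0) * w' $ i0"
            using h Hc i0 w' by (intro rho_vec) auto
          also have "inv (r i0) \<otimes> h \<otimes> r i0 = h" using i0 Hc[OF h] by simp
          finally show "((inverse (\<mu> h) / of_nat (card H)) \<cdot>\<^sub>v (\<rho> h *\<^sub>v w')) $ i0 = w' $ i0 / of_nat (card H)"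
            using i0 mu_nz[OF h] A.rho_carrier[OF h] by simp
        qed
        also have "\<dots> = w' $ i0" using A.fin H1 by auto
        finally show ?thesis .
      qed
      \<comment> \<open>An element \<open>?h\<close> of \<open>H\<close> that fixes the coset \<open>k\<close> scales this coordinate by \<open>\<mu> x\<close> because of the
        monomial form, but by \<open>\<mu> ?h \<noteq> \<mu> x\<close> because \<open>u\<close> is a \<open>\<mu>\<close>-eigenvector.\<close>
      have uk: "u $ k = 0" if k: "k < ?m" "k \<noteq> i0" for k
      proof -
        have "r k \<notin> H"
        proof
          assume "r k \<in> H"
          then have "k = i0" using unique[OF k(1) i0(1) rc[OF k(1)]] rc[OF k(1)] i0 H1 by simp
          then show False using k by simp
        qed
        from mackey[OF rc[OF k(1)] this] obtain x where x: "x \<in> H" "r k \<otimes> x \<otimes> inv (r k) \<in> H"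
          "\<mu> (r k \<otimes> x \<otimes> inv (r k)) \<noteq> \<mu> x" by blast
        let ?h = "r k \<otimes> x \<otimes> inv (r k)"
        have e: "inv (r k) \<otimes> ?h \<otimes> r k = x" using rc[OF k(1)] Hc[OF x(1)] by (simp add: m_assoc mult_inv_cancel)
        have "(\<rho> ?h *\<^sub>v u) $ k = \<mu> (inv (r k) \<otimes> ?h \<otimes> r k) * u $ k"
          using e x Hc k u by (intro rho_vec) auto
        moreover have "(\<rho> ?h *\<^sub>v u) $ k = \<mu> ?h * u $ k" using u_eig[OF x(2)] u k by simp
        ultimately show ?thesis using e x(3) by simp
      qed
      have e_in: "unit_vec ?m i0 \<in> W"
      proof -
        have "unit_vec ?m i0 = inverse (w' $ i0) \<cdot>\<^sub>v u"
          using u u0 uk w'0 i0 by (intro eq_vecI) (auto simp: unit_vec_def)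
        then show ?thesis using WD(4)[OF u(1)] by simp
      qed
      have all: "unit_vec ?m k \<in> W" if k: "k < ?m" for k
      proof -
        have "\<rho> (r k) *\<^sub>v unit_vec ?m i0 = unit_vec ?m k"
        proof (rule eq_vecI)
          fix i assume "i < dim_vec (unit_vec ?m k :: complex vec)"
          then have i: "i < ?m" by simp
          obtain j where j: "j < ?m" "inv (r j) \<otimes> (inv (r k) \<otimes> r i) \<in> H"
            using uniq[of "inv (r k) \<otimes> r i"] rc k i by auto
          have mem: "inv (r i) \<otimes> r k \<otimes> r j \<in> H"
          proof -
            have "inv (r i) \<otimes> r k \<otimes> r j = inv (inv (r j) \<otimes> (inv (r k) \<otimes> r i))"
              using rc i j k by (simp add: inv_mult_group m_assoc)
            then show ?thesis using j H by (simp add: subgroup.m_inv_closed)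
          qed
          have eq: "(\<rho> (r k) *\<^sub>v unit_vec ?m i0) $ i = \<mu> (inv (r i) \<otimes> r k \<otimes> r j) * unit_vec ?m i0 $ j"
            using mem rc i j k by (intro rho_vec) auto
          have "j = i0 \<longleftrightarrow> i = k"
          proof
            assume "j = i0"
            then have "inv (r i) \<otimes> r k \<in> H" using mem i0 rc i k by simp
            then show "i = k" using unique[OF i k rc[OF k]] rc[OF k] H1 by simp
          next
            assume "i = k"
            then have "inv (r j) \<in> H" using j rc[OF k] rc[OF j(1)] by simp
            then show "j = i0" using unique[OF j(1) i0(1) one_closed] i0 rc[OF j(1)] H1 by simp
          qed
          then show "(\<rho> (r k) *\<^sub>v unit_vec ?m i0) $ i = unit_vec ?m k $ i"
            unfolding eq using i j k i0 rc mu1 by (auto simp: unit_vec_def)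
        qed (simp add: \<rho>_def)
        then show ?thesis using invar e_in rc[OF k] by metis
      qed
      have "v \<in> W" if v: "v \<in> carrier_vec ?m" for v
      proof -
        have "vec ?m (\<lambda>k. \<Sum>i\<in>{..<?m}. (v $ i \<cdot>\<^sub>v unit_vec ?m i) $ k) \<in> W"
          using all WD(4) by (intro vec_subspace_sum[OF W]) auto
        also have "vec ?m (\<lambda>k. \<Sum>i\<in>{..<?m}. (v $ i \<cdot>\<^sub>v unit_vec ?m i) $ k) = v"
          using v by (intro eq_vecI) (auto simp: unit_vec_def if_distrib[of "\<lambda>x. _ * x"] cong: if_cong)
        finally show ?thesis .
      qed
      then show ?thesis using WD(1) by auto
    qed simp
  qed (rule rep)
  then show ?thesis unfolding cd_iff by blast
qed

end

section \<open>Bounds for quasi-permutation representations\<close>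

definition has_quasi_perm_rep :: "('a, 'b) monoid_scheme \<Rightarrow> nat \<Rightarrow> bool" where
  "has_quasi_perm_rep G n \<longleftrightarrow> (\<exists>\<rho>\<in>mon G (GL n). \<forall>g\<in>carrier G. quasi_permutation_matrix (\<rho> g))"

lemma min_quasi_perm_degree_le: "has_quasi_perm_rep G n \<Longrightarrow> min_quasi_perm_degree G \<le> n"
  unfolding min_quasi_perm_degree_def has_quasi_perm_rep_def by (rule Least_le)

lemma min_quasi_perm_degree_attained:
  "has_quasi_perm_rep G n \<Longrightarrow> has_quasi_perm_rep G (min_quasi_perm_degree G)"
  unfolding min_quasi_perm_degree_def has_quasi_perm_rep_def by (rule LeastI)

context group begin

text \<open>
  The trace of a permutation matrix is the number of fixed points.
\<close>

lemma has_quasi_perm_rep_of_action: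
  fixes act :: "'a \<Rightarrow> 'c \<Rightarrow> 'c"
  assumes X: "finite X"
    and act: "\<And>g x. g \<in> carrier G \<Longrightarrow> x \<in> X \<Longrightarrow> act g x \<in> X"
    and act_one: "\<And>x. x \<in> X \<Longrightarrow> act \<one> x = x"
    and act_mult: "\<And>g h x. g \<in> carrier G \<Longrightarrow> h \<in> carrier G \<Longrightarrow> x \<in> X \<Longrightarrow> act (g \<otimes> h) x = act g (act h x)"
    and faithful: "\<And>g. g \<in> carrier G \<Longrightarrow> (\<And>x. x \<in> X \<Longrightarrow> act g x = x) \<Longrightarrow> g = \<one>"
  shows "has_quasi_perm_rep G (card X)"
proof -
  let ?n = "card X"
  obtain f where f: "bij_betw f {..<?n} X"
    using ex_bij_betw_nat_finite[OF X] by (auto simp: lessThan_atLeast0)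
  have fX: "f i \<in> X" if "i < ?n" for i using f that unfolding bij_betw_def by auto
  have finj: "f i = f j \<longleftrightarrow> i = j" if "i < ?n" "j < ?n" for i j
    using f that unfolding bij_betw_def inj_on_def by auto
  have fsurj: "\<exists>i<?n. f i = x" if "x \<in> X" for x
    using f that unfolding bij_betw_def by (metis imageE lessThan_iff)
  define \<rho> where "\<rho> g = mat ?n ?n (\<lambda>(i, j). if act g (f j) = f i then 1 else 0 :: complex)" for g
  have rep: "matrix_rep G ?n \<rho>"
    unfolding matrix_rep_def
  proof (intro conjI ballI)
    show "\<rho> g \<in> carrier_mat ?n ?n" for g unfolding \<rho>_def by simp
    show "\<rho> \<one> = 1\<^sub>m ?n"
      unfolding \<rho>_def by (rule eq_matI) (auto simp: act_one fX finj)
    fix g h assume g: "g \<in> carrier G" and h: "h \<in> carrier G"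
    show "\<rho> (g \<otimes> h) = \<rho> g * \<rho> h"
    proof (rule eq_matI)
      fix i k assume "i < dim_row (\<rho> g * \<rho> h)" "k < dim_col (\<rho> g * \<rho> h)"
      then have ik: "i < ?n" "k < ?n" by (auto simp: \<rho>_def)
      obtain j where j: "j < ?n" "f j = act h (f k)" using fsurj[OF act[OF h fX[OF ik(2)]]] by auto
      have "(\<rho> g * \<rho> h) $$ (i, k) = (\<Sum>l<?n. \<rho> g $$ (i, l) * \<rho> h $$ (l, k))"
        using ik unfolding \<rho>_def by (simp add: scalar_prod_def lessThan_atLeast0)
      also have "\<dots> = (\<Sum>l<?n. if l = j then \<rho> g $$ (i, j) else 0)"
      proof (intro sum.cong refl)
        fix l assume "l \<in> {..<?n}"
        then have "\<rho> h $$ (l, k) = (if l = j then 1 else 0)"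
          unfolding \<rho>_def using ik j(1) finj[OF j(1), of l] by (auto simp: j(2)[symmetric])
        then show "\<rho> g $$ (i, l) * \<rho> h $$ (l, k) = (if l = j then \<rho> g $$ (i, j) else 0)" by simp
      qed
      also have "\<dots> = \<rho> g $$ (i, j)" using j by simp
      also have "\<dots> = \<rho> (g \<otimes> h) $$ (i, k)"
        unfolding \<rho>_def using ik j by (simp add: act_mult[OF g h fX])
      finally show "\<rho> (g \<otimes> h) $$ (i, k) = (\<rho> g * \<rho> h) $$ (i, k)" ..
    qed (auto simp: \<rho>_def)
  qed
  have same: "act g x = act h x" if gh: "g \<in> carrier G" "h \<in> carrier G" and eq: "\<rho> g = \<rho> h" and x: "x \<in> X" for g h x
  proof -
    obtain j where j: "j < ?n" "f j = x" using fsurj[OF x] by auto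
    obtain i where i: "i < ?n" "f i = act g x" using fsurj[OF act[OF gh(1) x]] by auto
    have "\<rho> g $$ (i, j) = 1" unfolding \<rho>_def using i j by simp
    then have "\<rho> h $$ (i, j) = 1" using eq by simp
    then have "act h x = f i" unfolding \<rho>_def using i j by (simp split: if_splits)
    then show ?thesis using i by simp
  qed
  have "inj_on \<rho> (carrier G)"
  proof (rule inj_onI)
    fix g h assume gh: "g \<in> carrier G" "h \<in> carrier G" "\<rho> g = \<rho> h"
    have "inv h \<otimes> g = \<one>"
    proof (rule faithful)
      fix x assume x: "x \<in> X"
      have "act (inv h \<otimes> g) x = act (inv h) (act h x)" using gh x same[OF gh x] by (simp add: act_mult)
      also have "\<dots> = x" using gh x by (simp add: act_mult[symmetric] act_one)
      finally show "act (inv h \<otimes> g) x = x" .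
    qed (use gh in simp)
    then have "h \<otimes> (inv h \<otimes> g) = h" using gh by simp
    then show "g = h" using gh by (simp add: mult_inv_cancel)
  qed
  moreover have "quasi_permutation_matrix (\<rho> g)" for g
  proof -
    have "mat_trace (\<rho> g) = of_nat (\<Sum>i<?n. if act g (f i) = f i then 1 else 0)"
      unfolding mat_trace_def \<rho>_def by (auto intro!: sum.cong)
    then have "mat_trace (\<rho> g) \<in> \<nat>" by (simp only: of_nat_in_Nats)
    then show ?thesis unfolding quasi_permutation_matrix_def by (simp add: \<rho>_def)
  qed
  ultimately show ?thesis
    unfolding has_quasi_perm_rep_def mon_def using rep hom_GL_iff by blast
qed

text \<open>
  \<open>G\<close> acts on the disjoint union of the coset spaces of the subgroups in \<open>Ks\<close>. The kernel is a normal subgroup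
  contained in all of them, and a nontrivial one would contain a central element different from \<open>\<one>\<close>.
\<close>

lemma has_quasi_perm_rep_of_subgroups:
  assumes p: "Factorial_Ring.prime p" and fin: "finite (carrier G)" and card: "card (carrier G) = p ^ k"
    and Ks: "\<And>K. K \<in> set Ks \<Longrightarrow> subgroup K G"
    and cover: "\<And>z. z \<in> carrier G \<Longrightarrow> z \<noteq> \<one> \<Longrightarrow> (\<And>t. t \<in> carrier G \<Longrightarrow> z \<otimes> t = t \<otimes> z) \<Longrightarrow> \<exists>K\<in>set Ks. z \<notin> K"
  shows "has_quasi_perm_rep G (\<Sum>K\<leftarrow>Ks. card (rcosets K))"
proof -
  define X where "X = (SIGMA i:{..<length Ks}. rcosets (Ks ! i))"
  define act where "act g = (\<lambda>(i :: nat, C). (i, C #> inv g))" for g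
  have finR: "finite (rcosets K)" for K unfolding RCOSETS_def using fin by simp
  have sub: "subgroup (Ks ! i) G" "Ks ! i \<subseteq> carrier G" if "i < length Ks" for i
    using Ks[OF nth_mem[OF that]] subgroup.subset[OF Ks[OF nth_mem[OF that]]] by auto
  have "card X = (\<Sum>i<length Ks. card (rcosets (Ks ! i)))" unfolding X_def using finR by simp
  also have "\<dots> = (\<Sum>K\<leftarrow>Ks. card (rcosets K))"
    by (simp add: sum_list_sum_nth lessThan_atLeast0)
  finally have cardX: "card X = (\<Sum>K\<leftarrow>Ks. card (rcosets K))" .
  have actX: "act g (i, Ks ! i #> t) = (i, Ks ! i #> (t \<otimes> inv g))"
    if "i < length Ks" "t \<in> carrier G" "g \<in> carrier G" for g i t
    using that sub unfolding act_def by (simp add: coset_mult_assoc)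
  have XE: "\<exists>i t. x = (i, Ks ! i #> t) \<and> i < length Ks \<and> t \<in> carrier G" if "x \<in> X" for x
    using that unfolding X_def RCOSETS_def by auto
  have XI: "(i, Ks ! i #> t) \<in> X" if "i < length Ks" "t \<in> carrier G" for i t
    using that unfolding X_def RCOSETS_def by auto
  \<comment> \<open>The kernel of the action.\<close>
  define N where "N = {g \<in> carrier G. \<forall>K\<in>set Ks. \<forall>t\<in>carrier G. t \<otimes> g \<otimes> inv t \<in> K}"
  have N: "subgroup N G"
  proof (rule finite_closed_imp_subgroup[OF fin])
    show "\<one> \<in> N" unfolding N_def using Ks by (auto simp: subgroup.one_closed)
    fix g h assume gh: "g \<in> N" "h \<in> N"
    have "t \<otimes> (g \<otimes> h) \<otimes> inv t \<in> K" if K: "K \<in> set Ks" and t: "t \<in> carrier G" for K t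
    proof -
      have "t \<otimes> (g \<otimes> h) \<otimes> inv t = (t \<otimes> g \<otimes> inv t) \<otimes> (t \<otimes> h \<otimes> inv t)"
        using gh t unfolding N_def by (simp add: m_assoc mult_inv_cancel)
      moreover have "t \<otimes> g \<otimes> inv t \<in> K" "t \<otimes> h \<otimes> inv t \<in> K" using gh K t unfolding N_def by auto
      ultimately show ?thesis using Ks[OF K] by (simp add: subgroup.m_closed)
    qed
    then show "g \<otimes> h \<in> N" using gh unfolding N_def by auto
  qed (auto simp: N_def)
  have N_normal: "s \<otimes> g \<otimes> inv s \<in> N" if s: "s \<in> carrier G" and g: "g \<in> N" for s g
  proof -
    have gc: "g \<in> carrier G" using g unfolding N_def by auto
    have "t \<otimes> (s \<otimes> g \<otimes> inv s) \<otimes> inv t \<in> K" if K: "K \<in> set Ks" and t: "t \<in> carrier G" for K t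
    proof -
      have "t \<otimes> (s \<otimes> g \<otimes> inv s) \<otimes> inv t = (t \<otimes> s) \<otimes> g \<otimes> inv (t \<otimes> s)"
        using gc s t by (simp add: m_assoc inv_mult_group)
      also have "\<dots> \<in> K" using g K t s unfolding N_def by auto
      finally show ?thesis .
    qed
    then show ?thesis using gc s unfolding N_def by auto
  qed
  have N1: "N = {\<one>}"
  proof (rule ccontr)
    assume "N \<noteq> {\<one>}"
    from p_group_normal_meets_center[OF p fin card N this N_normal]
    obtain z where z: "z \<in> N" "z \<noteq> \<one>" "\<forall>t\<in>carrier G. z \<otimes> t = t \<otimes> z" by blast
    have zc: "z \<in> carrier G" using z unfolding N_def by auto
    obtain K where K: "K \<in> set Ks" "z \<notin> K" using cover[OF zc z(2)] z(3) by blast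
    have "\<one> \<otimes> z \<otimes> inv \<one> \<in> K" using z(1) K unfolding N_def by blast
    then show False using K zc by simp
  qed
  have "has_quasi_perm_rep G (card X)"
  proof (rule has_quasi_perm_rep_of_action)
    show "finite X" unfolding X_def using finR by auto
    show "act g x \<in> X" if "g \<in> carrier G" "x \<in> X" for g x
    proof -
      obtain i t where "x = (i, Ks ! i #> t)" "i < length Ks" "t \<in> carrier G" using XE[OF \<open>x \<in> X\<close>] by blast
      then show ?thesis using XI that by (simp add: actX)
    qed
    show "act \<one> x = x" if "x \<in> X" for x
    proof -
      obtain i t where "x = (i, Ks ! i #> t)" "i < length Ks" "t \<in> carrier G" using XE[OF \<open>x \<in> X\<close>] by blast
      then show ?thesis by (simp add: actX)
    qed
    show "act (g \<otimes> h) x = act g (act h x)" if gh: "g \<in> carrier G" "h \<in> carrier G" and "x \<in> X" for g h x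
    proof -
      obtain i t where "x = (i, Ks ! i #> t)" "i < length Ks" "t \<in> carrier G" using XE[OF \<open>x \<in> X\<close>] by blast
      then show ?thesis using gh by (simp add: actX inv_mult_group m_assoc)
    qed
    show "g = \<one>" if g: "g \<in> carrier G" and fix_all: "\<And>x. x \<in> X \<Longrightarrow> act g x = x" for g
    proof -
      have "t \<otimes> g \<otimes> inv t \<in> K" if K: "K \<in> set Ks" and t: "t \<in> carrier G" for K t
      proof -
        obtain i where i: "i < length Ks" "K = Ks ! i" using K by (metis in_set_conv_nth)
        have "K #> (t \<otimes> inv g) = K #> t" using fix_all[OF XI[OF i(1) t]] actX[OF i(1) t g] i by simp
        then have "t \<otimes> inv g \<in> K #> t" using rcos_self[of "t \<otimes> inv g" K] t g Ks[OF K] by simp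
        then obtain y where y: "y \<in> K" "t \<otimes> inv g = y \<otimes> t" unfolding r_coset_def by auto
        have yc: "y \<in> carrier G" using y Ks[OF K] subgroup.subset by blast
        have "y = t \<otimes> inv g \<otimes> inv t" using y(2) yc t g by (simp add: m_assoc)
        then have "t \<otimes> g \<otimes> inv t = inv y" using t g by (simp add: inv_mult_group m_assoc)
        then show ?thesis using y Ks[OF K] by (simp add: subgroup.m_inv_closed)
      qed
      then have "g \<in> N" unfolding N_def using g by auto
      then show ?thesis using N1 by simp
    qed
  qed
  then show ?thesis using cardX by simp
qed

lemma p_group_has_quasi_perm_rep:
  assumes p: "Factorial_Ring.prime p" and fin: "finite (carrier G)" and card: "card (carrier G) = p ^ k"
  shows "has_quasi_perm_rep G (min_quasi_perm_degree G)"
  by (rule min_quasi_perm_degree_attained[OF has_quasi_perm_rep_of_subgroups[OF p fin card, of "[{\<one>}]"]])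
    (auto simp: triv_subgroup)

lemma quasi_perm_rep_degree_ge:
  assumes p: "Factorial_Ring.prime p" and q: "has_quasi_perm_rep G n"
    and x: "x \<in> carrier G" "x [^] (p ^ Suc k) = \<one>" "x [^] (p ^ k) \<noteq> \<one>"
  shows "p ^ Suc k \<le> n"
proof -
  obtain \<rho> where hom: "\<rho> \<in> hom G (GL n)" and inj: "inj_on \<rho> (carrier G)"
    and quasi: "\<And>g. g \<in> carrier G \<Longrightarrow> mat_trace (\<rho> g) \<in> \<nat>"
    using q unfolding has_quasi_perm_rep_def mon_def quasi_permutation_matrix_def by blast
  have rep: "matrix_rep G n \<rho>" using hom hom_GL_iff by blast
  have N: "p ^ Suc k > 0" using p prime_gt_0_nat by simp
  obtain w where w: "primitive_root (p ^ Suc k) w" using primitive_root_exists[OF N] by blast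
  interpret cyclic_action n "p ^ Suc k" w "\<lambda>t. \<rho> (x [^] t)"
    by (rule matrix_rep_cyclic_action[OF rep x(1,2) N w])
  have "\<rho> (x [^] (p ^ k)) \<noteq> \<rho> \<one>" using inj x by (metis inj_onD nat_pow_closed one_closed)
  then have "\<rho> (x [^] (p ^ k)) \<noteq> 1\<^sub>m n" using rep unfolding matrix_rep_def by simp
  from degree_lower_bound[OF p refl this, of 1] quasi x show ?thesis by simp
qed

lemma group_exponent_pow:
  assumes fin: "finite (carrier G)" and x: "x \<in> carrier G"
  shows "x [^] group_exponent G = \<one>" "group_exponent G > 0"
proof -
  have "\<exists>m>0. \<forall>x\<in>carrier G. x [^] (m::nat) = \<one>"
    using fin pow_order_eq_1 by (intro exI[of _ "Coset.order G"]) (simp add: order_gt_0_iff_finite)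
  from LeastI_ex[OF this] x show "x [^] group_exponent G = \<one>" "group_exponent G > 0"
    unfolding group_exponent_def by auto
qed

lemma group_exponent_less:
  assumes "m > 0" "m < group_exponent G"
  shows "\<exists>x\<in>carrier G. x [^] m \<noteq> \<one>"
  using not_less_Least[OF assms(2)[unfolded group_exponent_def]] assms(1) by auto

lemma exponent_le_min_quasi_perm_degree:
  assumes p: "Factorial_Ring.prime p" and fin: "finite (carrier G)" and card: "card (carrier G) = p ^ k"
    and exp: "group_exponent G = p ^ Suc b"
  shows "p ^ Suc b \<le> min_quasi_perm_degree G"
proof -
  have "p ^ b < group_exponent G" "p ^ b > 0" unfolding exp using prime_gt_1_nat[OF p] by auto
  then obtain x where x: "x \<in> carrier G" "x [^] (p ^ b) \<noteq> \<one>" using group_exponent_less by blast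
  have "x [^] (p ^ Suc b) = \<one>" using group_exponent_pow(1)[OF fin x(1)] exp by simp
  from quasi_perm_rep_degree_ge[OF p p_group_has_quasi_perm_rep[OF p fin card] x(1) this x(2)]
  show ?thesis .
qed

text \<open>
  \<open>K\<close> is the kernel of \<open>\<mu>\<close> for a Mackey pair with \<open>\<mu> x \<noteq> 1\<close>. The index of \<open>H\<close> is a character degree, and
  the values of \<open>\<mu>\<close> are roots of unity of order dividing the exponent.
\<close>

lemma small_index_subgroup_avoiding_central:
  assumes p: "Factorial_Ring.prime p" and fin: "finite (carrier G)" and card: "card (carrier G) = p ^ k"
    and x: "x \<in> carrier G" "x \<noteq> \<one>" and central: "\<And>g. g \<in> carrier G \<Longrightarrow> x \<otimes> g = g \<otimes> x"
  shows "\<exists>K. subgroup K G \<and> x \<notin> K \<and> card (rcosets K) \<le> Max (cd G) * group_exponent G"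
proof -
  obtain H \<mu> where M: "mackey_pair H \<mu>" and xH: "x \<in> H" "\<mu> x \<noteq> 1"
    using mackey_pair_nontrivial_at_central[OF p fin card x central] by blast
  have H: "subgroup H G" and mu1: "\<mu> \<one> = 1"
    and mu_mult: "\<And>x y. x \<in> H \<Longrightarrow> y \<in> H \<Longrightarrow> \<mu> (x \<otimes> y) = \<mu> x * \<mu> y"
    using M unfolding mackey_pair_def by auto
  have Hc: "\<And>h. h \<in> H \<Longrightarrow> h \<in> carrier G" using subgroup.subset[OF H] by blast
  have finH: "finite H" using Hc fin by (meson finite_subset subsetI)
  define K where "K = {h \<in> H. \<mu> h = 1}"
  have K: "subgroup K G"
    by (rule finite_closed_imp_subgroup[OF fin])
      (use H Hc mu1 mu_mult in \<open>auto simp: K_def subgroup.one_closed subgroup.m_closed\<close>)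
  have inv_H: "inv h \<in> H" if "h \<in> H" for h using that H by (simp add: subgroup.m_inv_closed)
  have mu_inv: "\<mu> (inv h) * \<mu> h = 1" if "h \<in> H" for h
    using mu_mult[OF inv_H[OF that] that] mu1 Hc[OF that] by simp
  have fib: "card {h \<in> H. \<mu> h = y} \<le> card K" if y: "y \<in> \<mu> ` H" for y
  proof -
    obtain h0 where h0: "h0 \<in> H" "y = \<mu> h0" using y by auto
    show ?thesis
    proof (rule card_inj_on_le[of "\<lambda>h. inv h0 \<otimes> h"])
      show "inj_on (\<lambda>h. inv h0 \<otimes> h) {h \<in> H. \<mu> h = y}" using Hc h0 by (auto intro!: inj_onI)
      show "(\<lambda>h. inv h0 \<otimes> h) ` {h \<in> H. \<mu> h = y} \<subseteq> K"
      proof (rule image_subsetI)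
        fix h assume "h \<in> {h \<in> H. \<mu> h = y}"
        then have h: "h \<in> H" "\<mu> h = \<mu> h0" using h0 by simp_all
        have "\<mu> (inv h0 \<otimes> h) = 1" using mu_mult[OF inv_H[OF h0(1)] h(1)] mu_inv[OF h0(1)] h(2) by simp
        then show "inv h0 \<otimes> h \<in> K"
          unfolding K_def using subgroup.m_closed[OF H inv_H[OF h0(1)] h(1)] by simp
      qed
      show "finite K" unfolding K_def using finH by simp
    qed
  qed
  let ?N = "group_exponent G"
  have N: "?N > 0" using group_exponent_pow[OF fin one_closed] by simp
  have "\<mu> ` H \<subseteq> {z. z ^ ?N = 1}"
  proof -
    have "\<mu> h ^ ?N = 1" if h: "h \<in> H" for h
    proof -
      have "h [^] i \<in> H \<and> \<mu> (h [^] i) = \<mu> h ^ i" for i :: nat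
        using h H mu1 by (induction i) (auto simp: mu_mult subgroup.one_closed subgroup.m_closed)
      then show ?thesis using group_exponent_pow(1)[OF fin Hc[OF h]] mu1 by metis
    qed
    then show ?thesis by auto
  qed
  moreover have roots: "card {z :: complex. z ^ ?N = 1} = ?N" using card_nth_roots[of 1 ?N] N by simp
  moreover have "finite {z :: complex. z ^ ?N = 1}" using roots N by (intro card_ge_0_finite) simp
  ultimately have img: "card (\<mu> ` H) \<le> ?N" by (metis card_mono)
  have "card H = (\<Sum>y\<in>\<mu> ` H. card {h \<in> H. \<mu> h = y})"
    using finH sum.image_gen[of H "\<lambda>_. 1::nat" \<mu>] by simp
  also have "\<dots> \<le> (\<Sum>y\<in>\<mu> ` H. card K)" by (rule sum_mono[OF fib])
  also have "\<dots> \<le> ?N * card K" using img by simp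
  finally have HK: "card H \<le> ?N * card K" .
  have "card (rcosets H) \<le> Max (cd G)"
    using Max_ge[OF finite_cd[OF fin] mackey_pair_irreducible[OF fin M]] .
  then have "card (rcosets H) * card H \<le> Max (cd G) * (?N * card K)"
    using HK by (intro mult_le_mono)
  moreover have "card (rcosets H) * card H = card (rcosets K) * card K"
    using lagrange_finite[OF fin H] lagrange_finite[OF fin K] by simp
  ultimately have "card (rcosets K) * card K \<le> (Max (cd G) * ?N) * card K" by simp
  moreover have "card K > 0"
    using finH H mu1 unfolding K_def
    by (auto simp: card_gt_0_iff subgroup.one_closed intro!: exI[of _ \<one>])
  ultimately have "card (rcosets K) \<le> Max (cd G) * ?N" by simp
  moreover have "x \<notin> K" using xH unfolding K_def by simp
  ultimately show ?thesis using K by blast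
qed

text \<open>
  Each chosen subgroup cuts the part of \<open>M\<close> that is still unseparated to a proper subgroup, so its
  order drops by a factor of at least \<open>p\<close>.
\<close>

lemma greedy_separating_subgroups:
  assumes p: "Factorial_Ring.prime p" and fin: "finite (carrier G)" and card: "card (carrier G) = p ^ k"
  shows "subgroup M G \<Longrightarrow> card M \<le> p ^ d \<Longrightarrow>
    (\<And>x. x \<in> M \<Longrightarrow> x \<noteq> \<one> \<Longrightarrow> \<exists>K. subgroup K G \<and> x \<notin> K \<and> card (rcosets K) \<le> q) \<Longrightarrow>
    \<exists>Ks. length Ks \<le> d \<and> (\<forall>K\<in>set Ks. subgroup K G \<and> card (rcosets K) \<le> q) \<and>
      (\<forall>x\<in>M. x \<noteq> \<one> \<longrightarrow> (\<exists>K\<in>set Ks. x \<notin> K))"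
proof (induction d arbitrary: M)
  case 0
  then have "card M \<le> 1" "\<one> \<in> M" "finite M"
    using fin subgroup.subset[OF 0(1)] by (auto simp: subgroup.one_closed finite_subset)
  then have "\<forall>x\<in>M. x = \<one>" by (metis card_le_Suc0_iff_eq One_nat_def)
  then show ?case by (intro exI[of _ "[]"]) auto
next
  case (Suc d M)
  show ?case
  proof (cases "M = {\<one>}")
    case True then show ?thesis by (intro exI[of _ "[]"]) auto
  next
    case False
    then obtain x where x: "x \<in> M" "x \<noteq> \<one>" using subgroup.one_closed[OF Suc.prems(1)] by blast
    then obtain K where K: "subgroup K G" "x \<notin> K" "card (rcosets K) \<le> q" using Suc.prems(3) by blast
    have MK: "subgroup (M \<inter> K) G" using subgroups_Inter_pair[OF Suc.prems(1) K(1)] .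
    have finM: "finite M" using fin subgroup.subset[OF Suc.prems(1)] by (auto intro: finite_subset)
    obtain i where i: "card M = p ^ i" using subgroup_card_prime_power[OF p fin card Suc.prems(1)] by blast
    obtain j where j: "card (M \<inter> K) = p ^ j" using subgroup_card_prime_power[OF p fin card MK] by blast
    have p1: "p > 1" using p by (rule prime_gt_1_nat)
    have "i \<le> Suc d" using Suc.prems(2) i p1 power_le_imp_le_exp by metis
    moreover have "card (M \<inter> K) < card M" using x K finM by (intro psubset_card_mono) auto
    then have "j < i" using i j p1 power_less_imp_less_exp by metis
    ultimately have "j \<le> d" by simp
    then have "card (M \<inter> K) \<le> p ^ d" using j p1 by simp
    from Suc.IH[OF MK this] Suc.prems(3) obtain Ks where Ks: "length Ks \<le> d"
      "\<forall>K\<in>set Ks. subgroup K G \<and> card (rcosets K) \<le> q" "\<forall>x\<in>M \<inter> K. x \<noteq> \<one> \<longrightarrow> (\<exists>K\<in>set Ks. x \<notin> K)"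
      by blast
    then show ?thesis using K by (intro exI[of _ "K # Ks"]) auto
  qed
qed

text \<open>
  The carrier of \<open>center_group G\<close> as a plain set, so that the centre can be treated as a subgroup of \<open>G\<close>.
\<close>

definition center_set :: "'a set" where
  "center_set = {z \<in> carrier G. \<forall>x\<in>carrier G. z \<otimes> x = x \<otimes> z}"

lemma center_group_eq: "center_group G = G\<lparr>carrier := center_set\<rparr>"
  unfolding center_group_def center_set_def ..

lemma center_subgroup: "subgroup center_set G"
proof
  show "inv z \<in> center_set" if z: "z \<in> center_set" for z
  proof -
    have "inv z \<otimes> x = x \<otimes> inv z" if x: "x \<in> carrier G" for x
    proof -
      have zc: "z \<in> carrier G" and zx: "z \<otimes> x = x \<otimes> z" using z x unfolding center_set_def by auto
      have "inv z \<otimes> x = inv z \<otimes> (x \<otimes> z) \<otimes> inv z" using zc x by (simp add: m_assoc)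
      also have "\<dots> = x \<otimes> inv z" unfolding zx[symmetric] using zc x by (simp add: mult_inv_cancel)
      finally show ?thesis .
    qed
    then show ?thesis using z unfolding center_set_def by auto
  qed
  show "y \<otimes> z \<in> center_set" if yz: "y \<in> center_set" "z \<in> center_set" for y z
  proof -
    have "y \<otimes> z \<otimes> x = x \<otimes> (y \<otimes> z)" if x: "x \<in> carrier G" for x
    proof -
      have c: "y \<in> carrier G" "z \<in> carrier G" and e: "z \<otimes> x = x \<otimes> z" "y \<otimes> x = x \<otimes> y"
        using yz x unfolding center_set_def by blast+
      have "y \<otimes> z \<otimes> x = y \<otimes> (x \<otimes> z)" using c x e by (simp add: m_assoc)
      also have "\<dots> = x \<otimes> y \<otimes> z" using c x e by (simp flip: m_assoc)
      finally show ?thesis using c x by (simp add: m_assoc)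
    qed
    moreover have "y \<otimes> z \<in> carrier G" using yz unfolding center_set_def by blast
    ultimately show ?thesis unfolding center_set_def by blast
  qed
qed (auto simp: center_set_def)

lemma min_generators_center:
  assumes fin: "finite (carrier G)"
  obtains S where "S \<subseteq> center_set" "finite S" "card S = min_generators (center_group G)" "generate G S = center_set"
proof -
  have cons: "generate (center_group G) S = generate G S" if "S \<subseteq> center_set" for S
    unfolding center_group_eq by (rule generate_consistent[OF that center_subgroup])
  have cc: "carrier (center_group G) = center_set" unfolding center_group_eq by simp
  have "finite center_set" using fin unfolding center_set_def by simp
  moreover have "generate G center_set = center_set"
    using generate_subgroup_incl[OF subset_refl center_subgroup] generate.incl by fast
  ultimately have "\<exists>S\<subseteq>center_set. finite S \<and> card S = card center_set \<and> generate (center_group G) S = center_set"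
    using cons by (intro exI[of _ center_set]) auto
  then have "\<exists>k S. S \<subseteq> carrier (center_group G) \<and> finite S \<and> card S = k \<and> generate (center_group G) S = carrier (center_group G)"
    unfolding cc by blast
  from LeastI_ex[OF this] obtain S where S: "S \<subseteq> center_set" "finite S"
    "card S = min_generators (center_group G)" "generate (center_group G) S = center_set"
    unfolding cc min_generators_def by blast
  then show ?thesis using cons by (intro that[of S]) auto
qed

text \<open>
  With \<open>P\<close> the image and \<open>W\<close> the kernel of the \<open>p\<close>-th power map on the centre \<open>Z\<close>, counting fibres gives
  \<open>card P * card W \<le> card Z\<close>. On the other hand each generator enlarges a subgroup
  containing \<open>P\<close> by a factor of at most \<open>p\<close>, so \<open>card Z \<le> p ^ d * card P\<close>.
\<close>

lemma card_center_torsion_le: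
  assumes fin: "finite (carrier G)" and p0: "p > 0"
  shows "card {z \<in> center_set. z [^] p = \<one>} \<le> p ^ min_generators (center_group G)"
proof -
  let ?Z = center_set
  note Z = center_subgroup
  have Zc: "\<And>z. z \<in> ?Z \<Longrightarrow> z \<in> carrier G" and comm: "\<And>y z. y \<in> ?Z \<Longrightarrow> z \<in> ?Z \<Longrightarrow> y \<otimes> z = z \<otimes> y"
    unfolding center_set_def by blast+
  have finZ: "finite ?Z" using fin unfolding center_set_def by simp
  have pow_dist: "(y \<otimes> z) [^] (i::nat) = y [^] i \<otimes> z [^] i" if "y \<in> ?Z" "z \<in> ?Z" for y z i
    using that Zc comm by (intro pow_mult_distrib) auto
  have powZ: "z [^] (i::nat) \<in> ?Z" if "z \<in> ?Z" for z i
    using that Z by (induction i) (auto simp: subgroup.one_closed subgroup.m_closed)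
  define P where "P = (\<lambda>z. z [^] p) ` ?Z"
  define W where "W = {z \<in> ?Z. z [^] p = \<one>}"
  have P: "subgroup P G"
  proof (rule finite_closed_imp_subgroup[OF fin])
    show "P \<subseteq> carrier G" unfolding P_def using Zc by auto
    show "\<one> \<in> P" unfolding P_def using Z by (auto simp: subgroup.one_closed intro!: image_eqI[of _ _ \<one>])
    show "x \<otimes> y \<in> P" if "x \<in> P" "y \<in> P" for x y
      using that Z unfolding P_def by (auto simp: pow_dist[symmetric] subgroup.m_closed)
  qed
  have PZ: "P \<subseteq> ?Z" unfolding P_def using powZ by auto
  have fib: "card W \<le> card {z \<in> ?Z. z [^] p = y}" if y: "y \<in> P" for y
  proof -
    obtain z0 where z0: "z0 \<in> ?Z" "y = z0 [^] p" using y unfolding P_def by auto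
    show ?thesis
    proof (rule card_inj_on_le[of "\<lambda>z. z0 \<otimes> z"])
      show "inj_on (\<lambda>z. z0 \<otimes> z) W" unfolding W_def using z0 Zc by (auto intro!: inj_onI)
      show "(\<lambda>z. z0 \<otimes> z) ` W \<subseteq> {z \<in> ?Z. z [^] p = y}"
        unfolding W_def using z0 Z Zc by (auto simp: pow_dist subgroup.m_closed)
    qed (use finZ in simp)
  qed
  have "card P * card W = (\<Sum>y\<in>P. card W)" by simp
  also have "\<dots> \<le> (\<Sum>y\<in>P. card {z \<in> ?Z. z [^] p = y})" by (rule sum_mono[OF fib])
  also have "\<dots> = card ?Z"
    unfolding P_def using finZ sum.image_gen[of ?Z "\<lambda>_. 1::nat" "\<lambda>z. z [^] p"] by simp
  finally have PW: "card P * card W \<le> card ?Z" .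
  have grow: "\<exists>B. subgroup B G \<and> B \<subseteq> ?Z \<and> S \<subseteq> B \<and> P \<subseteq> B \<and> card B \<le> p ^ card S * card P"
    if "finite S" "S \<subseteq> ?Z" for S
    using that
  proof (induction S)
    case empty
    then show ?case using P PZ by (intro exI[of _ P]) auto
  next
    case (insert s S)
    then obtain B where B: "subgroup B G" "B \<subseteq> ?Z" "S \<subseteq> B" "P \<subseteq> B" "card B \<le> p ^ card S * card P" by auto
    have s: "s \<in> ?Z" "s \<in> carrier G" using insert.prems Zc by auto
    have Bc: "\<And>b. b \<in> B \<Longrightarrow> b \<in> carrier G" using B Zc by auto
    define B' where "B' = (\<lambda>(i, b). s [^] (i::nat) \<otimes> b) ` ({..<p} \<times> B)"
    have B'I: "s [^] (i::nat) \<otimes> b \<in> B'" if b: "b \<in> B" for i b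
    proof -
      have sp: "s [^] (p * k) \<in> B" for k
      proof -
        have "s [^] (p * k) = (s [^] k) [^] p" using s by (simp add: nat_pow_pow mult.commute)
        then show ?thesis using powZ[OF s(1)] B(4) unfolding P_def by auto
      qed
      have "s [^] i = s [^] (i mod p) \<otimes> s [^] (p * (i div p))" using s by (simp add: nat_pow_mult)
      then have "s [^] i \<otimes> b = s [^] (i mod p) \<otimes> (s [^] (p * (i div p)) \<otimes> b)"
        using s Bc[OF b] by (simp add: m_assoc)
      moreover have "s [^] (p * (i div p)) \<otimes> b \<in> B" using sp b B(1) by (simp add: subgroup.m_closed)
      ultimately show ?thesis unfolding B'_def using p0 by force
    qed
    have B'E: "\<exists>i b. x = s [^] (i::nat) \<otimes> b \<and> b \<in> B" if "x \<in> B'" for x using that unfolding B'_def by auto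
    have "subgroup B' G"
    proof (rule finite_closed_imp_subgroup[OF fin])
      show "B' \<subseteq> carrier G" unfolding B'_def using s Bc by auto
      show "\<one> \<in> B'" using B'I[OF subgroup.one_closed[OF B(1)], of 0] by simp
      fix x y assume "x \<in> B'" "y \<in> B'"
      then obtain i b j c where x: "x = s [^] (i::nat) \<otimes> b" "b \<in> B" and y: "y = s [^] (j::nat) \<otimes> c" "c \<in> B"
        using B'E by meson
      have bs: "b \<otimes> s [^] j = s [^] j \<otimes> b" using comm[OF _ powZ[OF s(1)]] x B(2) by auto
      have "x \<otimes> y = s [^] i \<otimes> (b \<otimes> s [^] j) \<otimes> c" unfolding x y using s Bc x y by (simp add: m_assoc)
      also have "\<dots> = s [^] (i + j) \<otimes> (b \<otimes> c)"
        unfolding bs using s Bc x y by (simp add: m_assoc nat_pow_mult[symmetric])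
      finally show "x \<otimes> y \<in> B'" using B'I[OF subgroup.m_closed[OF B(1) x(2) y(2)]] by simp
    qed
    moreover have "B' \<subseteq> ?Z" unfolding B'_def using powZ[OF s(1)] B(2) Z by (auto intro: subgroup.m_closed)
    moreover have BB': "B \<subseteq> B'" using B'I[of _ 0] Bc by force
    moreover have "s \<in> B'" using B'I[OF subgroup.one_closed[OF B(1)], of 1] s by simp
    moreover have "card B' \<le> p ^ card (insert s S) * card P"
    proof -
      have "finite B" using B(2) finZ finite_subset by blast
      then have "card B' \<le> card ({..<p} \<times> B)" unfolding B'_def by (intro card_image_le) auto
      also have "\<dots> = p * card B" by (simp add: card_cartesian_product)
      also have "\<dots> \<le> p * (p ^ card S * card P)" using B(5) by (rule mult_le_mono2)
      finally show ?thesis using insert.hyps by (simp add: mult.assoc)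
    qed
    ultimately show ?case using B(3,4) by (intro exI[of _ B']) auto
  qed
  obtain S where S: "S \<subseteq> ?Z" "finite S" "card S = min_generators (center_group G)" "generate G S = ?Z"
    by (rule min_generators_center[OF fin]; (assumption | rule that; assumption))
  obtain B where B: "subgroup B G" "B \<subseteq> ?Z" "S \<subseteq> B" "card B \<le> p ^ card S * card P"
    using grow[OF S(2,1)] by blast
  have "?Z \<subseteq> B" using generate_subgroup_incl[OF B(3,1)] S(4) by simp
  moreover have "finite B" using B(2) finZ finite_subset by blast
  ultimately have "card ?Z \<le> card B" by (intro card_mono)
  then have "card P * card W \<le> p ^ card S * card P" using PW B(4) by linarith
  then have "card W * card P \<le> p ^ card S * card P" by (simp only: mult.commute[of "card P"])
  moreover have "card P > 0"
    using PZ finZ subgroup.one_closed[OF P] by (auto simp: card_gt_0_iff finite_subset)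
  ultimately have "card W \<le> p ^ card S" by simp
  then show ?thesis unfolding W_def S(3) .
qed

text \<open>
  It is enough to separate from \<open>\<one>\<close> the central elements whose \<open>p\<close>-th power is \<open>\<one>\<close>: every other nontrivial central
  element has a nontrivial power among them.
\<close>

lemma min_quasi_perm_degree_upper:
  assumes p: "Factorial_Ring.prime p" and fin: "finite (carrier G)" and card: "card (carrier G) = p ^ k"
  shows "min_quasi_perm_degree G \<le> min_generators (center_group G) * (Max (cd G) * group_exponent G)"
proof -
  let ?q = "Max (cd G) * group_exponent G" and ?d = "min_generators (center_group G)"
  define M where "M = {z \<in> center_set. z [^] p = \<one>}"
  have p0: "p > 0" using p by (simp add: prime_gt_0_nat)
  have central: "z \<in> carrier G" "\<And>t. t \<in> carrier G \<Longrightarrow> z \<otimes> t = t \<otimes> z" if "z \<in> center_set" for z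
    using that unfolding center_set_def by blast+
  have M: "subgroup M G"
  proof (rule finite_closed_imp_subgroup[OF fin])
    show "M \<subseteq> carrier G" unfolding M_def using central by auto
    show "\<one> \<in> M" unfolding M_def using subgroup.one_closed[OF center_subgroup] by simp
    show "x \<otimes> y \<in> M" if "x \<in> M" "y \<in> M" for x y
      using that central pow_mult_distrib[of x y p] subgroup.m_closed[OF center_subgroup, of x y]
      unfolding M_def by auto
  qed
  have avoid: "\<exists>K. subgroup K G \<and> x \<notin> K \<and> card (rcosets K) \<le> ?q" if "x \<in> M" "x \<noteq> \<one>" for x
    using that central unfolding M_def by (intro small_index_subgroup_avoiding_central[OF p fin card]) auto
  have "card M \<le> p ^ ?d" unfolding M_def by (rule card_center_torsion_le[OF fin p0])
  from greedy_separating_subgroups[OF p fin card M this avoid]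
  obtain Ks where Ks: "length Ks \<le> ?d" "\<And>K. K \<in> set Ks \<Longrightarrow> subgroup K G"
    "\<And>K. K \<in> set Ks \<Longrightarrow> card (rcosets K) \<le> ?q"
    "\<And>x. x \<in> M \<Longrightarrow> x \<noteq> \<one> \<Longrightarrow> \<exists>K\<in>set Ks. x \<notin> K" by blast
  have "has_quasi_perm_rep G (\<Sum>K\<leftarrow>Ks. card (rcosets K))"
  proof (rule has_quasi_perm_rep_of_subgroups[OF p fin card Ks(2)])
    fix z assume z: "z \<in> carrier G" "z \<noteq> \<one>" "\<And>t. t \<in> carrier G \<Longrightarrow> z \<otimes> t = t \<otimes> z"
    then have zZ: "z \<in> center_set" unfolding center_set_def by blast
    have "z [^] (p ^ k) = \<one>" using pow_order_eq_1[OF z(1)] card unfolding Coset.order_def by simp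
    then have ex: "\<exists>l. z [^] (p ^ l) = \<one>" by blast
    \<comment> \<open>The power of \<open>z\<close> with exponent \<open>p ^ (l - 1)\<close> has order \<open>p\<close>.\<close>
    define l where "l = (LEAST l. z [^] (p ^ l) = \<one>)"
    have l: "z [^] (p ^ l) = \<one>" unfolding l_def by (rule LeastI_ex[OF ex])
    have "l \<noteq> 0" using l z by (cases l) auto
    then obtain j where j: "l = Suc j" by (cases l) auto
    have nj: "z [^] (p ^ j) \<noteq> \<one>" using not_less_Least[of j "\<lambda>l. z [^] (p ^ l) = \<one>"] j unfolding l_def by auto
    have "(z [^] (p ^ j)) [^] p = \<one>" using l j z by (simp add: nat_pow_pow mult.commute)
    moreover have pw: "z [^] (i::nat) \<in> K" if "z \<in> K" "subgroup K G" for K i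
      using that by (induction i) (auto simp: subgroup.one_closed subgroup.m_closed)
    ultimately have "z [^] (p ^ j) \<in> M" unfolding M_def using zZ center_subgroup by auto
    then obtain K where K: "K \<in> set Ks" "z [^] (p ^ j) \<notin> K" using Ks(4) nj by blast
    then have "z \<notin> K" using pw Ks(2) by blast
    then show "\<exists>K\<in>set Ks. z \<notin> K" using K by blast
  qed
  then have "min_quasi_perm_degree G \<le> (\<Sum>K\<leftarrow>Ks. card (rcosets K))" by (rule min_quasi_perm_degree_le)
  also have "\<dots> \<le> (\<Sum>K\<leftarrow>Ks. ?q)" using Ks(3) by (intro sum_list_mono) auto
  also have "\<dots> = length Ks * ?q" by (simp add: sum_list_triv)
  also have "\<dots> \<le> ?d * ?q" using Ks(1) by (rule mult_le_mono1)
  finally show ?thesis .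
qed

end

lemma p_expansion_bounds:
  assumes "p > 1" and e: "p_expansion p m r a"
  shows "p ^ r \<le> m" "m < p ^ Suc r"
proof -
  have r: "r \<ge> 1" "\<And>i. i \<in> {1..r} \<Longrightarrow> a i < p" "a r \<noteq> 0" and m: "m = (\<Sum>i=1..r. a i * p ^ i)"
    using e unfolding p_expansion_def by auto
  have "p ^ r \<le> a r * p ^ r" using r by simp
  also have "\<dots> \<le> m" unfolding m using r by (intro member_le_sum) auto
  finally show "p ^ r \<le> m" .
  have geo: "(\<Sum>i=1..s. a i * p ^ i) < p ^ Suc s" if "s \<le> r" for s
    using that
  proof (induction s)
    case 0 then show ?case using assms by simp
  next
    case (Suc s)
    have "a (Suc s) < p" using r(2) Suc.prems by simp
    then have "a (Suc s) + 1 \<le> p" by simp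
    then have "(a (Suc s) + 1) * p ^ Suc s \<le> p * p ^ Suc s" by (rule mult_le_mono1)
    moreover have "(\<Sum>i=1..s. a i * p ^ i) < p ^ Suc s" using Suc by simp
    ultimately show ?case by simp
  qed
  show "m < p ^ Suc r" unfolding m by (rule geo) simp
qed

lemma expansion_length_bounds:
  fixes G :: "('a, 'b) monoid_scheme"
  assumes p: "Factorial_Ring.prime p" and G: "nonabelian_p_group p G" and exp: "group_exponent G = p ^ b"
    and cd: "Max (cd G) = p ^ e" and a: "p_expansion p (min_quasi_perm_degree G) r a"
  shows "b \<le> r" "min_generators (center_group G) < p \<Longrightarrow> r \<le> b + e"
proof -
  interpret group G using G unfolding nonabelian_p_group_def by simp
  obtain k where fin: "finite (carrier G)" and card: "card (carrier G) = p ^ k"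
    using G unfolding nonabelian_p_group_def by auto
  have p1: "p > 1" using p by (rule prime_gt_1_nat)
  note bounds = p_expansion_bounds[OF p1 a]
  show "b \<le> r"
  proof (cases b)
    case (Suc c)
    then have "p ^ b \<le> min_quasi_perm_degree G"
      using exponent_le_min_quasi_perm_degree[OF p fin card, of c] exp by simp
    then have "p ^ b < p ^ Suc r" using bounds by simp
    then show ?thesis using power_less_imp_less_exp[OF p1] by (metis less_Suc_eq_le)
  qed simp
  show "r \<le> b + e" if d: "min_generators (center_group G) < p"
  proof -
    have "p ^ r \<le> min_generators (center_group G) * (p ^ e * p ^ b)"
      using bounds(1) min_quasi_perm_degree_upper[OF p fin card] unfolding exp cd by simp
    also have "\<dots> < p * (p ^ e * p ^ b)" using d p1 by simp
    also have "\<dots> = p ^ Suc (b + e)" by (simp add: power_add mult_ac)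
    finally show ?thesis using power_less_imp_less_exp[OF p1] by (metis less_Suc_eq_le)
  qed
qed

section \<open>Central commutators and abelian subgroups of prime index\<close>

context group begin

lemma mat_trace_conjugate:
  assumes r: "matrix_rep G n \<rho>" and x: "x \<in> carrier G" and g: "g \<in> carrier G"
  shows "mat_trace (\<rho> (x \<otimes> g \<otimes> inv x)) = mat_trace (\<rho> g)"
proof -
  have c: "\<rho> x \<in> carrier_mat n n" "\<rho> (g \<otimes> inv x) \<in> carrier_mat n n"
    and mult: "\<rho> (x \<otimes> (g \<otimes> inv x)) = \<rho> x * \<rho> (g \<otimes> inv x)"
      "\<rho> (g \<otimes> inv x \<otimes> x) = \<rho> (g \<otimes> inv x) * \<rho> x"
    using r x g m_closed[OF g inv_closed[OF x]] unfolding matrix_rep_def by blast+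
  have "mat_trace (\<rho> (x \<otimes> g \<otimes> inv x)) = mat_trace (\<rho> x * \<rho> (g \<otimes> inv x))"
    using x g mult(1) by (simp add: m_assoc)
  also have "\<dots> = mat_trace (\<rho> (g \<otimes> inv x) * \<rho> x)" by (rule mat_trace_mult_commute[OF c])
  also have "\<dots> = mat_trace (\<rho> (g \<otimes> inv x \<otimes> x))" unfolding mult(2) ..
  also have "g \<otimes> inv x \<otimes> x = g" using x g by (simp add: m_assoc)
  finally show ?thesis .
qed

text \<open>
  If \<open>w ^ j\<close> is an eigenvalue of \<open>z\<close> with \<open>j\<close> prime to \<open>p\<close>, then on its eigenspace the commutator of \<open>x\<close>
  and \<open>y\<close> is a nontrivial scalar, so conjugation by \<open>x\<close> permutes the \<open>p\<close> possible eigenvalues of \<open>y\<close>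
  transitively. They are therefore equally frequent and \<open>p\<close> divides the multiplicity of \<open>w ^ j\<close>. In terms of traces: the
  trace of \<open>z ^ t * y ^ s\<close> is invariant under shifting \<open>t\<close> by \<open>s * p ^ k\<close>, so that its
  \<open>w ^ j\<close>-component vanishes unless \<open>p\<close> divides \<open>s\<close>.
\<close>

lemma quasi_perm_rep_degree_ge_central_commutator:
  assumes p: "Factorial_Ring.prime p" and q: "has_quasi_perm_rep G n"
    and x: "x \<in> carrier G" and y: "y \<in> carrier G" "y [^] p = \<one>"
    and z: "z \<in> carrier G" "z [^] (p ^ Suc k) = \<one>" "z [^] (p ^ k) \<noteq> \<one>"
    and xz: "x \<otimes> z = z \<otimes> x" and yz: "y \<otimes> z = z \<otimes> y"
    and comm: "x \<otimes> y \<otimes> inv x = y \<otimes> z [^] (p ^ k)"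
  shows "p * p ^ Suc k \<le> n"
proof -
  obtain \<rho> where hom: "\<rho> \<in> hom G (GL n)" and inj: "inj_on \<rho> (carrier G)"
    and quasi: "\<And>g. g \<in> carrier G \<Longrightarrow> mat_trace (\<rho> g) \<in> \<nat>"
    using q unfolding has_quasi_perm_rep_def mon_def quasi_permutation_matrix_def by blast
  have rep: "matrix_rep G n \<rho>" using hom hom_GL_iff by blast
  have rc: "\<rho> g \<in> carrier_mat n n" if "g \<in> carrier G" for g using rep that unfolding matrix_rep_def by auto
  define N where "N = p ^ Suc k"
  have p0: "p > 0" using p by (simp add: prime_gt_0_nat)
  have N: "N > 0" using p0 by (simp add: N_def)
  obtain w where w: "primitive_root N w" using primitive_root_exists[OF N] by blast
  have zN: "z [^] N = \<one>" using z by (simp add: N_def)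
  interpret Z: cyclic_action n N w "\<lambda>t. \<rho> (z [^] t)"
    by (rule matrix_rep_cyclic_action[OF rep z(1) zN N w])
  have zy: "z [^] (t::nat) \<otimes> y [^] (s::nat) = y [^] s \<otimes> z [^] t" for t s
  proof -
    have "y [^] s \<otimes> z = z \<otimes> y [^] s" using y z yz by (intro group_commutes_pow) auto
    then show ?thesis using y z by (intro group_commutes_pow) auto
  qed
  define f where "f t s = mat_trace (\<rho> (z [^] (t::nat) \<otimes> y [^] (s::nat)))" for t s
  have conj: "x \<otimes> (z [^] t \<otimes> y [^] s) \<otimes> inv x = z [^] (t + s * p ^ k) \<otimes> y [^] s" for t s :: nat
  proof -
    have xzt: "x \<otimes> z [^] t = z [^] t \<otimes> x"
      using x z xz group_commutes_pow[of z x t] by simp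
    have ys: "x \<otimes> y [^] s \<otimes> inv x = z [^] (s * p ^ k) \<otimes> y [^] s"
    proof (induction s)
      case 0 then show ?case using x by simp
    next
      case (Suc s)
      have "x \<otimes> y [^] Suc s \<otimes> inv x = (x \<otimes> y [^] s \<otimes> inv x) \<otimes> (x \<otimes> y \<otimes> inv x)"
        using x y by (simp add: m_assoc mult_inv_cancel)
      also have "\<dots> = z [^] (s * p ^ k) \<otimes> y [^] s \<otimes> (y \<otimes> z [^] (p ^ k))" unfolding Suc comm ..
      also have "\<dots> = z [^] (s * p ^ k) \<otimes> (y [^] Suc s \<otimes> z [^] (p ^ k))" using y z by (simp add: m_assoc)
      also have "\<dots> = z [^] (s * p ^ k) \<otimes> (z [^] (p ^ k) \<otimes> y [^] Suc s)" by (simp only: zy)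
      also have "\<dots> = z [^] (Suc s * p ^ k) \<otimes> y [^] Suc s"
        using y z by (simp add: m_assoc[symmetric] nat_pow_mult add.commute)
      finally show ?case .
    qed
    have "x \<otimes> (z [^] t \<otimes> y [^] s) \<otimes> inv x = (x \<otimes> z [^] t) \<otimes> (y [^] s \<otimes> inv x)"
      using x y z by (simp add: m_assoc)
    also have "\<dots> = z [^] t \<otimes> (x \<otimes> y [^] s \<otimes> inv x)" unfolding xzt using x y z by (simp add: m_assoc)
    also have "\<dots> = z [^] (t + s * p ^ k) \<otimes> y [^] s"
      unfolding ys using y z by (simp add: m_assoc[symmetric] nat_pow_mult)
    finally show ?thesis .
  qed
  have f_shift: "f (t + s * p ^ k) s = f t s" for t s
    unfolding f_def conj[symmetric] using x y z by (intro mat_trace_conjugate[OF rep]) auto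
  have z_mod: "z [^] (t mod N) = z [^] (t::nat)" for t
  proof -
    have "z [^] t = z [^] (N * (t div N) + t mod N)" by simp
    also have "\<dots> = z [^] (N * (t div N)) \<otimes> z [^] (t mod N)" using z by (simp only: nat_pow_mult)
    also have "z [^] (N * (t div N)) = \<one>" using z zN by (simp add: nat_pow_pow[symmetric])
    finally show ?thesis using z by simp
  qed
  have y_mod: "y [^] (s mod p) = y [^] (s::nat)" for s
  proof -
    have "y [^] s = y [^] (p * (s div p) + s mod p)" by simp
    also have "\<dots> = y [^] (p * (s div p)) \<otimes> y [^] (s mod p)" using y by (simp only: nat_pow_mult)
    also have "y [^] (p * (s div p)) = \<one>" using y by (simp add: nat_pow_pow[symmetric])
    finally show ?thesis using y by simp
  qed
  have vanish: "(\<Sum>t<N. inverse (w ^ (j * t)) * f t s) = 0" if j: "\<not> p dvd j" and s: "s < p" "s \<noteq> 0" for j s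
  proof -
    define u where "u = s * p ^ k"
    have bij: "bij_betw (\<lambda>t. (u + t) mod N) {..<N} {..<N}"
      unfolding bij_betw_def using add_mod_inj[of u N] N
      by (auto intro!: endo_inj_surj[of "{..<N}" "\<lambda>t. (u + t) mod N", THEN equalityD2, THEN subsetD])
    have "(\<Sum>t<N. inverse (w ^ (j * t)) * f t s)
        = (\<Sum>t<N. inverse (w ^ (j * ((u + t) mod N))) * f ((u + t) mod N) s)"
      by (rule sum.reindex_bij_betw[OF bij, symmetric])
    also have "\<dots> = (\<Sum>t<N. inverse (w ^ (j * u)) * (inverse (w ^ (j * t)) * f t s))"
    proof (intro sum.cong refl)
      fix t
      have "f ((u + t) mod N) s = f t s"
        unfolding f_def z_mod using f_shift[of t s] unfolding f_def u_def by (simp add: add.commute)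
      then show "inverse (w ^ (j * ((u + t) mod N))) * f ((u + t) mod N) s
          = inverse (w ^ (j * u)) * (inverse (w ^ (j * t)) * f t s)"
        unfolding Z.w_mod by (simp add: distrib_left power_add)
    qed
    also have "\<dots> = inverse (w ^ (j * u)) * (\<Sum>t<N. inverse (w ^ (j * t)) * f t s)"
      by (simp add: sum_distrib_left)
    finally have eq: "(\<Sum>t<N. inverse (w ^ (j * t)) * f t s)
        = inverse (w ^ (j * u)) * (\<Sum>t<N. inverse (w ^ (j * t)) * f t s)" .
    have "\<not> N dvd j * u"
    proof
      assume "N dvd j * u"
      then have "p * p ^ k dvd (j * s) * p ^ k" unfolding N_def u_def by (simp add: mult.assoc)
      then have "p dvd j * s" using p0 by simp
      then show False using p j s by (auto simp: prime_dvd_mult_iff dest: dvd_imp_le)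
    qed
    then have "w ^ (j * u) \<noteq> 1" using w unfolding primitive_root_def by blast
    then have "inverse (w ^ (j * u)) \<noteq> 1" by (metis inverse_1 inverse_inverse_eq)
    moreover have "X = 0" if "X = c * X" "c \<noteq> 1" for X c :: complex using that by simp
    ultimately show ?thesis using eq by blast
  qed
  have mult: "p dvd m" if j: "\<not> p dvd j" and m: "mat_trace (Z.P j) = of_nat m" for j m
  proof -
    \<comment> \<open>The projection to the joint eigenspace where \<open>z\<close> has eigenvalue \<open>w ^ j\<close> and \<open>y\<close> has
      eigenvalue 1 has a natural number \<open>c\<close> as its trace, and \<open>m = p * c\<close>.\<close>
    define I where "I = {..<N} \<times> {..<p}"
    define opr where "opr = (\<lambda>(t, s) (t', s'). ((t + t') mod N, (s + s') mod p))"
    define \<chi> where "\<chi> = (\<lambda>(t, s :: nat). w ^ (j * t))"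
    define R where "R = (\<lambda>(t, s). \<rho> (z [^] (t::nat) \<otimes> y [^] (s::nat)))"
    interpret A: averaging n I opr \<chi> R
    proof
      show "finite I" "I \<noteq> {}" unfolding I_def using N p0 by auto
      show "opr a b \<in> I" for a b unfolding I_def opr_def using N p0 by (auto split: prod.split)
      show "inj_on (opr a) I" for a
      proof -
        have inj: "inj_on (\<lambda>t. (fst a + t) mod N) {..<N}" "inj_on (\<lambda>s. (snd a + s) mod p) {..<p}"
          by (rule add_mod_inj)+
        show ?thesis
        proof (rule inj_onI)
          fix b c assume bc: "b \<in> I" "c \<in> I" and eq: "opr a b = opr a c"
          have "fst b = fst c"
            by (rule inj_onD[OF inj(1)]) (use bc eq in \<open>auto simp: I_def opr_def split: prod.splits\<close>)
          moreover have "snd b = snd c"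
            by (rule inj_onD[OF inj(2)]) (use bc eq in \<open>auto simp: I_def opr_def split: prod.splits\<close>)
          ultimately show "b = c" by (rule prod_eqI)
        qed
      qed
      show "R a \<in> carrier_mat n n" for a unfolding R_def using y z rc by (auto split: prod.split)
      show "R (opr a b) = R a * R b" for a b
      proof -
        obtain t s t' s' where ab: "a = (t, s)" "b = (t', s')" by (cases a; cases b) auto
        have "(z [^] t \<otimes> y [^] s) \<otimes> (z [^] t' \<otimes> y [^] s') = z [^] t \<otimes> (y [^] s \<otimes> z [^] t') \<otimes> y [^] s'"
          using y z by (simp add: m_assoc)
        also have "\<dots> = z [^] t \<otimes> (z [^] t' \<otimes> y [^] s) \<otimes> y [^] s'" by (simp only: zy)
        also have "\<dots> = (z [^] t \<otimes> z [^] t') \<otimes> (y [^] s \<otimes> y [^] s')" using y z by (simp add: m_assoc)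
        also have "\<dots> = z [^] ((t + t') mod N) \<otimes> y [^] ((s + s') mod p)"
          unfolding z_mod y_mod using y z by (simp add: nat_pow_mult)
        finally have "R (opr a b) = \<rho> ((z [^] t \<otimes> y [^] s) \<otimes> (z [^] t' \<otimes> y [^] s'))"
          unfolding R_def opr_def ab by simp
        also have "\<dots> = R a * R b"
          unfolding R_def ab using rep y z unfolding matrix_rep_def by simp
        finally show ?thesis .
      qed
      show "\<chi> (opr a b) = \<chi> a * \<chi> b" for a b
        unfolding \<chi>_def opr_def by (auto simp: Z.w_mod distrib_left power_add split: prod.split)
      show "\<chi> a \<noteq> 0" for a unfolding \<chi>_def using Z.w_nonzero by (auto split: prod.split)
    qed
    obtain c where c: "mat_trace A.E = of_nat c" using A.E_trace_natural unfolding Nats_def by auto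
    have "mat_trace A.E = (\<Sum>a\<in>I. inverse (\<chi> a) * mat_trace (R a)) / of_nat (card I)"
      by (rule mat_trace_isotypic_projection[OF A.rho_carrier])
    also have "(\<Sum>a\<in>I. inverse (\<chi> a) * mat_trace (R a)) = (\<Sum>t<N. \<Sum>s<p. inverse (w ^ (j * t)) * f t s)"
      unfolding I_def \<chi>_def R_def f_def sum.cartesian_product by (intro sum.cong) auto
    also have "\<dots> = (\<Sum>s<p. \<Sum>t<N. inverse (w ^ (j * t)) * f t s)" by (rule sum.swap)
    also have "\<dots> = (\<Sum>s<p. if s = 0 then (\<Sum>t<N. inverse (w ^ (j * t)) * f t 0) else 0)"
      using vanish[OF j] by (intro sum.cong) auto
    also have "\<dots> = (\<Sum>t<N. inverse (w ^ (j * t)) * f t 0)" using p0 by simp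
    also have "\<dots> = of_nat N * mat_trace (Z.P j)"
      using z N by (subst mat_trace_isotypic_projection) (auto simp: f_def rc)
    also have "of_nat N * mat_trace (Z.P j) / of_nat (card I) = of_nat m / of_nat p"
      unfolding m I_def using N by (simp add: card_cartesian_product)
    finally have "of_nat m = (of_nat (p * c) :: complex)" using c p0 by (simp add: field_simps)
    then have "m = p * c" by (simp only: of_nat_eq_iff)
    then show ?thesis by simp
  qed
  have "\<rho> (z [^] (p ^ k)) \<noteq> \<rho> \<one>" using inj z by (metis inj_onD nat_pow_closed one_closed)
  then have "\<rho> (z [^] (p ^ k)) \<noteq> 1\<^sub>m n" using rep unfolding matrix_rep_def by simp
  from Z.degree_lower_bound[OF p N_def this _ mult] quasi z show ?thesis by simp
qed

text \<open>
  The abelian subgroup bounds all degrees by \<open>p\<close>. The central commutator \<open>x\<close> of \<open>g\<close> and \<open>h\<close> lies in a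
  Mackey pair with \<open>\<mu> x \<noteq> 1\<close>; since linear characters of \<open>G\<close> are trivial on commutators, \<open>H\<close> is a
  proper subgroup, and its index is a degree divisible by \<open>p\<close>.
\<close>

lemma Max_cd_abelian_prime_index:
  assumes p: "Factorial_Ring.prime p" and fin: "finite (carrier G)" and card: "card (carrier G) = p ^ k"
    and A: "subgroup A G" and comm: "\<And>a b. a \<in> A \<Longrightarrow> b \<in> A \<Longrightarrow> a \<otimes> b = b \<otimes> a"
    and index: "card (rcosets A) \<le> p"
    and g: "g \<in> carrier G" and h: "h \<in> carrier G" and gh: "g \<otimes> h \<noteq> h \<otimes> g"
    and central: "\<And>t. t \<in> carrier G \<Longrightarrow> (g \<otimes> h \<otimes> inv (h \<otimes> g)) \<otimes> t = t \<otimes> (g \<otimes> h \<otimes> inv (h \<otimes> g))"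
  shows "Max (cd G) = p"
proof -
  define x where "x = g \<otimes> h \<otimes> inv (h \<otimes> g)"
  have x: "x \<in> carrier G" unfolding x_def using g h by simp
  have xhg: "x \<otimes> (h \<otimes> g) = g \<otimes> h" unfolding x_def using g h by (simp add: m_assoc)
  then have x1: "x \<noteq> \<one>" using gh g h by auto
  obtain H \<mu> where M: "mackey_pair H \<mu>" and xH: "x \<in> H" "\<mu> x \<noteq> 1"
    using mackey_pair_nontrivial_at_central[OF p fin card x x1] central unfolding x_def by blast
  have H: "subgroup H G" and mu_mult: "\<And>x y. x \<in> H \<Longrightarrow> y \<in> H \<Longrightarrow> \<mu> (x \<otimes> y) = \<mu> x * \<mu> y" and mu1: "\<mu> \<one> = 1"
    using M unfolding mackey_pair_def by auto
  have "H \<noteq> carrier G"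
  proof
    assume HG: "H = carrier G"
    have "\<mu> x * (\<mu> h * \<mu> g) = \<mu> g * \<mu> h" using g h x xhg HG by (simp add: mu_mult[symmetric])
    moreover have "\<mu> (g \<otimes> h) * \<mu> (inv (g \<otimes> h)) = 1"
      using mu_mult[of "g \<otimes> h" "inv (g \<otimes> h)"] g h HG mu1 by simp
    then have "\<mu> g * \<mu> h \<noteq> 0" using g h HG by (auto simp: mu_mult)
    ultimately show False using xH(2) by (simp add: mult.commute)
  qed
  have le: "n \<le> p" if "n \<in> cd G" for n
    using that irreducible_degree_le_index[OF _ fin A comm] index unfolding cd_iff by fastforce
  have in_cd: "card (rcosets H) \<in> cd G" by (rule mackey_pair_irreducible[OF fin M])
  have lag: "card (rcosets H) * card H = p ^ k" using lagrange_finite[OF fin H] card by (simp add: Coset.order_def)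
  have "card (rcosets H) \<noteq> 1"
  proof
    assume "card (rcosets H) = 1"
    then have "card H = card (carrier G)" using lag card by simp
    then have "H = carrier G" using card_subset_eq[OF fin] subgroup.subset[OF H] by blast
    then show False using \<open>H \<noteq> carrier G\<close> by simp
  qed
  moreover have "card (rcosets H) dvd p ^ k" using lag by (metis dvd_triv_left)
  then obtain i where i: "card (rcosets H) = p ^ i" using p by (auto simp: divides_primepow_nat)
  ultimately have "i \<noteq> 0" by (intro notI) simp
  then have "p dvd card (rcosets H)" using i by (cases i) auto
  moreover have "card (rcosets H) > 0" using i p by (simp add: prime_gt_0_nat)
  ultimately have "p \<le> card (rcosets H)" by (simp add: dvd_imp_le)
  then have "card (rcosets H) = p" using le[OF in_cd] by simp
  then show ?thesis using in_cd le finite_cd[OF fin] by (intro Max_eqI) auto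
qed

end

section \<open>Groups attaining the bounds\<close>

text \<open>
  The examples have natural numbers as elements, so triples of residues are encoded by pairing.
\<close>

definition triple :: "nat \<times> nat \<times> nat \<Rightarrow> nat" where
  "triple = (\<lambda>(a, b, c). prod_encode (a, prod_encode (b, c)))"

text \<open>
  The group of all \<open>(a, b, c)\<close> with \<open>a\<close>, \<open>b\<close> modulo \<open>p\<close> and \<open>c\<close> modulo \<open>p ^ 2\<close>, where \<open>(1, 0, 0)\<close> and
  \<open>(0, 1, 0)\<close> have the commutator \<open>(0, 0, p)\<close> and the centre consists of the \<open>(0, 0, c)\<close>. This is the
  central product of a cyclic group of order \<open>p ^ 2\<close> with an extraspecial group of order \<open>p ^ 3\<close>.
\<close>

definition heis :: "nat \<Rightarrow> nat monoid" where
  "heis p = \<lparr>carrier = triple ` ({..<p} \<times> {..<p} \<times> {..<p\<^sup>2}),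
     monoid.mult = (\<lambda>u v. case prod_decode u of (a, u') \<Rightarrow> case prod_decode u' of (b, c) \<Rightarrow>
       case prod_decode v of (a', v') \<Rightarrow> case prod_decode v' of (b', c') \<Rightarrow>
         triple ((a + a') mod p, (b + b') mod p, (c + c' + p * a * b') mod p\<^sup>2)),
     monoid.one = triple (0, 0, 0)\<rparr>"

lemma triple_eq_iff: "triple s = triple t \<longleftrightarrow> s = t"
  unfolding triple_def by (auto split: prod.splits)

lemma heis_mult:
  "triple (a, b, c) \<otimes>\<^bsub>heis p\<^esub> triple (a', b', c')
    = triple ((a + a') mod p, (b + b') mod p, (c + c' + p * a * b') mod p\<^sup>2)"
  unfolding heis_def triple_def by simp

lemma heis_one: "\<one>\<^bsub>heis p\<^esub> = triple (0, 0, 0)"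
  unfolding heis_def by simp

lemma heis_carrier: "carrier (heis p) = triple ` ({..<p} \<times> {..<p} \<times> {..<p\<^sup>2})"
  unfolding heis_def by simp

lemma heis_memI: "a < p \<Longrightarrow> b < p \<Longrightarrow> c < p\<^sup>2 \<Longrightarrow> triple (a, b, c) \<in> carrier (heis p)"
  unfolding heis_carrier by auto

lemma heis_memE:
  assumes "u \<in> carrier (heis p)"
  obtains a b c where "u = triple (a, b, c)" "a < p" "b < p" "c < p\<^sup>2"
proof -
  obtain t where t: "t \<in> {..<p} \<times> {..<p} \<times> {..<p\<^sup>2}" "u = triple t"
    using assms unfolding heis_carrier by blast
  obtain a b c where "t = (a, b, c)" by (cases t)
  then show ?thesis using t by (intro that[of a b c]) auto
qed

lemma add_mod_middle: "(c + x mod q + y) mod q = (c + x + y) mod q" for c x y q :: nat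
proof -
  have "(c + x mod q + y) mod q = ((c + x mod q) mod q + y) mod q" by (simp only: mod_add_left_eq)
  also have "\<dots> = (c + x + y) mod q" by (simp only: mod_add_right_eq mod_add_left_eq)
  finally show ?thesis .
qed

lemma mult_mod_square: "(p * (x mod p)) mod p\<^sup>2 = (p * x) mod p\<^sup>2" for p x :: nat
  by (simp only: mult_mod_right power2_eq_square mod_mod_trivial)

text \<open>
  The product \<open>p * a * b\<close> depends only on the residues of \<open>a\<close> and \<open>b\<close> modulo \<open>p\<close>.
\<close>

lemma twist_mod:
  fixes p :: nat
  shows "(c + p * (x mod p) * y) mod p\<^sup>2 = (c + p * x * y) mod p\<^sup>2"
    and "(c + p * x * (y mod p)) mod p\<^sup>2 = (c + p * x * y) mod p\<^sup>2"
proof -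
  have a: "(c + p * (x mod p) * y) mod p\<^sup>2 = (c + p * x * y) mod p\<^sup>2" for x y
    by (metis mod_add_right_eq mod_mult_left_eq mult_mod_square)
  show "(c + p * (x mod p) * y) mod p\<^sup>2 = (c + p * x * y) mod p\<^sup>2" by (rule a)
  show "(c + p * x * (y mod p)) mod p\<^sup>2 = (c + p * x * y) mod p\<^sup>2"
    using a[of y x] by (simp add: mult_ac)
qed

context
  fixes p :: nat
  assumes p1: "p > 1"
begin

lemma p_pos: "0 < p" and p_less_square: "p < p\<^sup>2" and one_less_square: "1 < p\<^sup>2"
  and Suc_less_square: "Suc p < p\<^sup>2"
proof -
  show "0 < p" using p1 by simp
  show "p < p\<^sup>2" using p1 by (simp add: power2_eq_square)
  then show "1 < p\<^sup>2" using p1 by linarith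
  have "2 * p \<le> p\<^sup>2" using p1 by (simp add: power2_eq_square)
  then show "Suc p < p\<^sup>2" using p1 \<open>p < p\<^sup>2\<close> by (cases "p = 2") auto
qed

lemma heis_group: "group (heis p)"
proof (rule groupI)
  show "u \<otimes>\<^bsub>heis p\<^esub> v \<in> carrier (heis p)" if "u \<in> carrier (heis p)" "v \<in> carrier (heis p)" for u v
    using that p_pos by (elim heis_memE) (auto simp: heis_mult intro!: heis_memI)
  show "\<one>\<^bsub>heis p\<^esub> \<in> carrier (heis p)" unfolding heis_one using p_pos by (auto intro!: heis_memI)
  show "u \<otimes>\<^bsub>heis p\<^esub> v \<otimes>\<^bsub>heis p\<^esub> w = u \<otimes>\<^bsub>heis p\<^esub> (v \<otimes>\<^bsub>heis p\<^esub> w)"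
    if uvw: "u \<in> carrier (heis p)" "v \<in> carrier (heis p)" "w \<in> carrier (heis p)" for u v w
  proof -
    obtain a b c where u: "u = triple (a, b, c)" by (rule heis_memE[OF uvw(1)])
    obtain a' b' c' where v: "v = triple (a', b', c')" by (rule heis_memE[OF uvw(2)])
    obtain a'' b'' c'' where w: "w = triple (a'', b'', c'')" by (rule heis_memE[OF uvw(3)])
    have "((c + c' + p * a * b') mod p\<^sup>2 + c'' + p * ((a + a') mod p) * b'') mod p\<^sup>2
        = (c + c' + p * a * b' + c'' + p * (a + a') * b'') mod p\<^sup>2"
      unfolding twist_mod by (simp add: mod_simps add.assoc)
    also have "\<dots> = (c + (c' + c'' + p * a' * b'') + p * a * (b' + b'')) mod p\<^sup>2"
      by (simp add: algebra_simps)
    also have "\<dots> = (c + (c' + c'' + p * a' * b'') mod p\<^sup>2 + p * a * ((b' + b'') mod p)) mod p\<^sup>2"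
      unfolding twist_mod add_mod_middle ..
    finally show ?thesis unfolding u v w heis_mult triple_eq_iff by (simp add: mod_simps add.assoc)
  qed
  show "\<one>\<^bsub>heis p\<^esub> \<otimes>\<^bsub>heis p\<^esub> u = u" if "u \<in> carrier (heis p)" for u
    using that by (elim heis_memE) (simp add: heis_one heis_mult)
  show "\<exists>v\<in>carrier (heis p). v \<otimes>\<^bsub>heis p\<^esub> u = \<one>\<^bsub>heis p\<^esub>" if u: "u \<in> carrier (heis p)" for u
  proof -
    obtain a b c where u: "u = triple (a, b, c)" "a < p" "b < p" "c < p\<^sup>2" by (rule heis_memE[OF u])
    let ?v = "triple ((p - a) mod p, (p - b) mod p, (p\<^sup>2 - c + p * a * b) mod p\<^sup>2)"
    have "((p\<^sup>2 - c + p * a * b) mod p\<^sup>2 + c + p * ((p - a) mod p) * b) mod p\<^sup>2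
        = (p\<^sup>2 - c + p * a * b + c + p * (p - a) * b) mod p\<^sup>2"
      unfolding twist_mod by (simp add: mod_simps add.assoc)
    also have "p\<^sup>2 - c + p * a * b + c + p * (p - a) * b = p\<^sup>2 * (1 + b)"
    proof -
      have "p * a * b + p * (p - a) * b = p * (a + (p - a)) * b" by (simp only: distrib_left distrib_right)
      also have "\<dots> = p\<^sup>2 * b" using u(2) by (simp add: power2_eq_square)
      finally have "p * a * b + p * (p - a) * b = p\<^sup>2 * b" .
      moreover have "p\<^sup>2 - c + c = p\<^sup>2" using u(4) by simp
      ultimately show ?thesis by (simp add: distrib_left)
    qed
    finally have "((p\<^sup>2 - c + p * a * b) mod p\<^sup>2 + c + p * ((p - a) mod p) * b) mod p\<^sup>2 = 0" by simp
    then have "?v \<otimes>\<^bsub>heis p\<^esub> u = \<one>\<^bsub>heis p\<^esub>"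
      unfolding u(1) heis_mult heis_one triple_eq_iff using u by (simp add: mod_simps)
    moreover have "?v \<in> carrier (heis p)" using p_pos by (intro heis_memI) auto
    ultimately show ?thesis by blast
  qed
qed

lemma heis_finite: "finite (carrier (heis p))" and heis_card: "card (carrier (heis p)) = p ^ 4"
proof -
  have "card (carrier (heis p)) = card ({..<p} \<times> {..<p} \<times> {..<p\<^sup>2})"
    unfolding heis_carrier by (rule card_image) (auto simp: inj_on_def triple_eq_iff)
  then show "card (carrier (heis p)) = p ^ 4"
    by (simp add: card_cartesian_product power2_eq_square power4_eq_xxxx mult.assoc)
qed (simp add: heis_carrier)

lemma heis_pow:
  assumes "a < p" "b < p" "c < p\<^sup>2"
  shows "triple (a, b, c) [^]\<^bsub>heis p\<^esub> (m::nat)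
    = triple ((m * a) mod p, (m * b) mod p, (m * c + p * a * b * (m choose 2)) mod p\<^sup>2)"
proof (induction m)
  case 0
  interpret group "heis p" by (rule heis_group)
  show ?case by (simp add: heis_one numeral_2_eq_2)
next
  case (Suc m)
  interpret group "heis p" by (rule heis_group)
  have ch: "Suc m choose 2 = (m choose 2) + m" by (simp add: numeral_2_eq_2)
  have "((m * c + p * a * b * (m choose 2)) mod p\<^sup>2 + c + p * ((m * a) mod p) * b) mod p\<^sup>2
      = (m * c + p * a * b * (m choose 2) + c + p * (m * a) * b) mod p\<^sup>2"
    unfolding twist_mod by (simp add: mod_simps add.assoc)
  also have "m * c + p * a * b * (m choose 2) + c + p * (m * a) * b = Suc m * c + p * a * b * (Suc m choose 2)"
    unfolding ch by (simp add: algebra_simps)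
  finally have "((m * c + p * a * b * (m choose 2)) mod p\<^sup>2 + c + p * ((m * a) mod p) * b) mod p\<^sup>2
      = (Suc m * c + p * a * b * (Suc m choose 2)) mod p\<^sup>2" .
  then show ?case
    unfolding nat_pow_Suc Suc.IH heis_mult triple_eq_iff by (simp add: mod_simps add.commute)
qed

end

text \<open>
  In the \<open>p ^ 2\<close>-th power of \<open>(a, b, c)\<close> this makes the term \<open>p * a * b * (p ^ 2 choose 2)\<close> vanish
  modulo \<open>p ^ 2\<close>.
\<close>

lemma prime_dvd_square_choose_two:
  assumes p: "Factorial_Ring.prime p" shows "p dvd (p\<^sup>2 choose 2)"
proof (cases "p = 2")
  case True
  then have "(p\<^sup>2 choose 2) = 6" by (simp add: choose_two)
  then show ?thesis using True by simp
next
  case False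
  have "2 * (p\<^sup>2 choose 2) = p\<^sup>2 * (p\<^sup>2 - 1)"
  proof -
    have "even (p\<^sup>2 * (p\<^sup>2 - 1))" by auto
    then show ?thesis by (simp add: choose_two)
  qed
  then have "p dvd 2 * (p\<^sup>2 choose 2)" by (simp add: power2_eq_square)
  moreover have "\<not> p dvd 2" using p False by (metis primes_dvd_imp_eq two_is_prime_nat)
  ultimately show ?thesis using p by (simp add: prime_dvd_mult_iff)
qed

text \<open>
  The subgroup generated by \<open>(1, 0, 1)\<close>, of order \<open>p ^ 2\<close>, and \<open>(0, 1, 0)\<close>, of order \<open>p\<close>: a
  semidirect product of order \<open>p ^ 3\<close>, dihedral for \<open>p = 2\<close>.
\<close>

definition modular_set :: "nat \<Rightarrow> nat set" where
  "modular_set p = {triple (a, b, c) | a b c. a < p \<and> b < p \<and> c < p\<^sup>2 \<and> c mod p = a}"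

lemma modular_setI: "a < p \<Longrightarrow> b < p \<Longrightarrow> c < p\<^sup>2 \<Longrightarrow> c mod p = a \<Longrightarrow> triple (a, b, c) \<in> modular_set p"
  unfolding modular_set_def by blast

text \<open>
  Exponent, maximal character degree, and the bound on the generators of the centre are the same for both examples
  and have the same proofs.
\<close>

locale heis_subgroup =
  fixes p :: nat and S :: "nat set"
  assumes p: "Factorial_Ring.prime p" and S: "S = carrier (heis p) \<or> S = modular_set p"
begin

lemma p1: "p > 1" using p by (rule prime_gt_1_nat)

lemmas size_facts = p_pos[OF p1] p_less_square[OF p1] one_less_square[OF p1] Suc_less_square[OF p1]

definition G where "G = heis p\<lparr>carrier := S\<rparr>"

lemma S_sub: "S \<subseteq> carrier (heis p)"
  using S unfolding modular_set_def by (auto intro: heis_memI)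

lemma S_memE:
  assumes "u \<in> S" obtains a b c where "u = triple (a, b, c)" "a < p" "b < p" "c < p\<^sup>2"
  using assms S_sub heis_memE by blast

lemma S_subgroup: "subgroup S (heis p)"
proof -
  interpret H: group "heis p" by (rule heis_group[OF p1])
  show ?thesis
  proof (rule H.finite_closed_imp_subgroup[OF heis_finite[OF p1] S_sub])
    show "\<one>\<^bsub>heis p\<^esub> \<in> S" using S size_facts unfolding heis_one by (auto intro: heis_memI modular_setI)
    fix u v assume uv: "u \<in> S" "v \<in> S"
    show "u \<otimes>\<^bsub>heis p\<^esub> v \<in> S"
      using S
    proof
      assume "S = carrier (heis p)" then show ?thesis using uv by simp
    next
      assume SM: "S = modular_set p"
      obtain a b c where u: "u = triple (a, b, c)" "c mod p = a" using uv unfolding SM modular_set_def by auto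
      obtain a' b' c' where v: "v = triple (a', b', c')" "c' mod p = a'" using uv unfolding SM modular_set_def by auto
      have "(c + c' + p * a * b') mod p\<^sup>2 mod p = (c + c' + p * a * b') mod p"
        by (simp add: mod_mod_cancel power2_eq_square)
      also have "\<dots> = (c + c') mod p" by (simp add: mult.assoc)
      also have "\<dots> = (a + a') mod p" unfolding u(2)[symmetric] v(2)[symmetric] by (simp add: mod_simps)
      finally show ?thesis
        unfolding SM u(1) v(1) heis_mult using size_facts by (intro modular_setI) auto
    qed
  qed
qed

sublocale group G
  unfolding G_def by (rule group.subgroup_imp_group[OF heis_group[OF p1] S_subgroup])

lemma carrier_G: "carrier G = S" and mult_G: "(\<otimes>\<^bsub>G\<^esub>) = (\<otimes>\<^bsub>heis p\<^esub>)" and one_G: "\<one>\<^bsub>G\<^esub> = triple (0, 0, 0)"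
  unfolding G_def by (simp_all add: heis_one)

lemma mult_code: "triple (a, b, c) \<otimes>\<^bsub>G\<^esub> triple (a', b', c')
    = triple ((a + a') mod p, (b + b') mod p, (c + c' + p * a * b') mod p\<^sup>2)"
  unfolding mult_G by (rule heis_mult)

lemma pow_code:
  assumes "a < p" "b < p" "c < p\<^sup>2"
  shows "triple (a, b, c) [^]\<^bsub>G\<^esub> (m::nat)
    = triple ((m * a) mod p, (m * b) mod p, (m * c + p * a * b * (m choose 2)) mod p\<^sup>2)"
  using heis_pow[OF p1 assms, of m] monoid.nat_pow_consistent[OF group.is_monoid[OF heis_group[OF p1]], of "triple (a, b, c)" m S]
  unfolding G_def by simp

lemma fin: "finite (carrier G)"
  unfolding carrier_G using S_sub heis_finite[OF p1] by (rule finite_subset)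

lemma card_G: "\<exists>k. card (carrier G) = p ^ k"
  unfolding carrier_G
  by (rule group.subgroup_card_prime_power[OF heis_group[OF p1] p heis_finite[OF p1] heis_card[OF p1] S_subgroup])

lemma x_mem: "triple (1, 0, 1) \<in> S" and y_mem: "b < p \<Longrightarrow> triple (0, b, 0) \<in> S"
  and z_mem: "c < p \<Longrightarrow> triple (0, 0, p * c) \<in> S"
  using S size_facts p1 by (auto intro!: heis_memI modular_setI simp: power2_eq_square)

lemma exponent: "group_exponent G = p\<^sup>2"
  unfolding group_exponent_def
proof (rule Least_equality, intro conjI ballI)
  show "p\<^sup>2 > 0" using size_facts by simp
  fix u assume "u \<in> carrier G"
  then obtain a b c where u: "u = triple (a, b, c)" "a < p" "b < p" "c < p\<^sup>2" unfolding carrier_G by (rule S_memE)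
  obtain d where d: "(p\<^sup>2 choose 2) = p * d" using prime_dvd_square_choose_two[OF p] by auto
  have "p\<^sup>2 * c + p * a * b * (p\<^sup>2 choose 2) = p\<^sup>2 * (c + a * b * d)"
    unfolding d by (simp add: power2_eq_square algebra_simps)
  then show "u [^]\<^bsub>G\<^esub> p\<^sup>2 = \<one>\<^bsub>G\<^esub>"
    unfolding u(1) pow_code[OF u(2-4)] one_G triple_eq_iff by (simp add: power2_eq_square)
next
  fix m :: nat assume m: "m > 0 \<and> (\<forall>u\<in>carrier G. u [^]\<^bsub>G\<^esub> m = \<one>\<^bsub>G\<^esub>)"
  then have "triple (1, 0, 1) [^]\<^bsub>G\<^esub> m = triple (0, 0, 0)" using x_mem unfolding carrier_G one_G by blast
  then have "m mod p\<^sup>2 = 0" using size_facts p1 by (simp add: pow_code triple_eq_iff)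
  then show "p\<^sup>2 \<le> m" using m by (metis dvd_imp_le mod_0_imp_dvd)
qed

lemma commutator_relation:
  "triple (1, 0, 1) \<otimes>\<^bsub>G\<^esub> triple (0, 1, 0) = triple (0, 0, p) \<otimes>\<^bsub>G\<^esub> (triple (0, 1, 0) \<otimes>\<^bsub>G\<^esub> triple (1, 0, 1))"
  unfolding mult_code triple_eq_iff using p1 size_facts by (simp add: mod_simps)

lemma central_code:
  assumes "c < p\<^sup>2" "triple (0, 0, c) \<in> S" "t \<in> S"
  shows "triple (0, 0, c) \<otimes>\<^bsub>G\<^esub> t = t \<otimes>\<^bsub>G\<^esub> triple (0, 0, c)"
proof -
  obtain a b d where "t = triple (a, b, d)" by (rule S_memE[OF assms(3)])
  then show ?thesis by (simp add: mult_code add.commute)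
qed

lemma p_central: "triple (0, 0, p) \<in> S"
  using z_mem[of 1] p1 by simp

lemma noncommuting: "triple (1, 0, 1) \<otimes>\<^bsub>G\<^esub> triple (0, 1, 0) \<noteq> triple (0, 1, 0) \<otimes>\<^bsub>G\<^esub> triple (1, 0, 1)"
  unfolding mult_code triple_eq_iff using p1 size_facts by (simp add: mod_simps)

lemma nonabelian: "nonabelian_p_group p G"
proof -
  have "\<not> comm_group G"
  proof
    assume "comm_group G"
    then interpret C: comm_group G .
    show False using noncommuting C.m_comm[of "triple (1, 0, 1)" "triple (0, 1, 0)"] x_mem y_mem[OF p1]
      unfolding carrier_G by simp
  qed
  then show ?thesis unfolding nonabelian_p_group_def using is_group fin card_G by blast
qed

text \<open>
  Commuting with \<open>(1, 0, 1)\<close> and with \<open>(0, 1, 0)\<close> forces \<open>b = 0\<close> and \<open>a = 0\<close>.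
\<close>

lemma center_code:
  assumes "u \<in> center_set"
  obtains c where "u = triple (0, 0, c)" "c < p\<^sup>2"
proof -
  have u: "u \<in> S" "\<And>t. t \<in> S \<Longrightarrow> u \<otimes>\<^bsub>G\<^esub> t = t \<otimes>\<^bsub>G\<^esub> u"
    using assms unfolding center_set_def carrier_G by auto
  obtain a b c where c: "u = triple (a, b, c)" "a < p" "b < p" "c < p\<^sup>2" by (rule S_memE[OF u(1)])
  have "p * i = 0" if "(k + p * i) mod p\<^sup>2 = k mod p\<^sup>2" "i < p" for k i
  proof -
    have "p\<^sup>2 dvd (k + p * i) - k" using that(1) by (subst mod_eq_dvd_iff_nat[symmetric]) auto
    moreover have "p * i < p\<^sup>2" using that size_facts by (simp add: power2_eq_square)
    ultimately show ?thesis by (auto dest: dvd_imp_le)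
  qed
  then have z: "i = 0" if "(k + p * i) mod p\<^sup>2 = k mod p\<^sup>2" "i < p" for k i using that size_facts by fastforce
  have "(1 + c + p * b) mod p\<^sup>2 = (1 + c) mod p\<^sup>2"
    using u(2)[OF x_mem] unfolding c(1) mult_code triple_eq_iff by (simp add: add.commute)
  then have "b = 0" using z c by blast
  moreover have "(c + p * a) mod p\<^sup>2 = c mod p\<^sup>2"
    using u(2)[OF y_mem[OF p1]] unfolding c(1) mult_code triple_eq_iff by (simp add: add.commute)
  then have "a = 0" using z c by blast
  ultimately show ?thesis using that c by simp
qed

lemma min_generators_le_1: "min_generators (center_group G) \<le> 1"
proof -
  define z where "z = (if S = carrier (heis p) then triple (0, 0, 1) else triple (0, 0, p))"
  have zS: "z \<in> S" unfolding z_def using p_central size_facts by (auto intro: heis_memI)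
  then have zc: "z \<in> center_set"
    unfolding center_set_def carrier_G z_def using central_code[of 1] central_code[of p] size_facts
    by (auto split: if_splits)
  have cc: "carrier (center_group G) = center_set" unfolding center_group_eq by simp
  have cons: "generate (center_group G) {z} = generate G {z}"
    unfolding center_group_eq using zc by (intro generate_consistent center_subgroup) auto
  have gsub: "subgroup (generate G {z}) G" using zS carrier_G by (intro generate_is_subgroup) auto
  have pow_gen: "z [^]\<^bsub>G\<^esub> (i::nat) \<in> generate G {z}" for i
    using gsub generate.incl[of z "{z}" G]
    by (induction i) (auto simp: subgroup.one_closed subgroup.m_closed)
  have "center_set \<subseteq> generate G {z}"
  proof
    fix u assume u: "u \<in> center_set"
    then obtain c where c: "u = triple (0, 0, c)" "c < p\<^sup>2" by (rule center_code)
    have "\<exists>i::nat. u = z [^]\<^bsub>G\<^esub> i"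
    proof (cases "S = carrier (heis p)")
      case True
      then have "z = triple (0, 0, 1)" unfolding z_def by simp
      moreover have "triple (0, 0, 1) [^]\<^bsub>G\<^esub> c = u" unfolding c(1) using c size_facts by (simp add: pow_code)
      ultimately show ?thesis by blast
    next
      case False
      then have SM: "S = modular_set p" using S by blast
      have "u \<in> S" using u unfolding center_set_def carrier_G by auto
      then have "c mod p = 0" unfolding SM modular_set_def c(1) by (auto simp: triple_eq_iff)
      then have "triple (0, 0, p) [^]\<^bsub>G\<^esub> (c div p) = u" unfolding c(1) using c size_facts by (auto simp: pow_code)
      moreover have "z = triple (0, 0, p)" unfolding z_def using False by simp
      ultimately show ?thesis by blast
    qed
    then show "u \<in> generate G {z}" using pow_gen by auto
  qed
  moreover have "generate G {z} \<subseteq> center_set"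
    using zc by (intro generate_subgroup_incl center_subgroup) auto
  ultimately have "generate (center_group G) {z} = carrier (center_group G)" unfolding cons cc by auto
  then show ?thesis
    unfolding min_generators_def cc using zc by (intro Least_le exI[of _ "{z}"]) auto
qed

lemma Max_cd: "Max (cd G) = p"
proof -
  obtain k where k: "card (carrier G) = p ^ k" using card_G by blast
  define A where "A = {triple (0, b, c) | b c. b < p \<and> c < p\<^sup>2} \<inter> S"
  have A: "subgroup A G"
  proof (rule finite_closed_imp_subgroup[OF fin])
    show "A \<subseteq> carrier G" unfolding A_def carrier_G by auto
    show "\<one>\<^bsub>G\<^esub> \<in> A" using one_closed size_facts unfolding A_def one_G carrier_G by (auto simp: triple_eq_iff)
    show "u \<otimes>\<^bsub>G\<^esub> v \<in> A" if "u \<in> A" "v \<in> A" for u v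
      using that m_closed[of u v] size_facts unfolding A_def carrier_G by (auto simp: mult_code triple_eq_iff)
  qed
  have comm: "u \<otimes>\<^bsub>G\<^esub> v = v \<otimes>\<^bsub>G\<^esub> u" if "u \<in> A" "v \<in> A" for u v
    using that unfolding A_def by (auto simp: mult_code add.commute)
  \<comment> \<open>The first coordinate determines the coset of \<open>A\<close>; the third coordinate \<open>a\<close> keeps the
    representative inside both groups.\<close>
  define rep where "rep a = triple (a, 0, a)" for a :: nat
  have rep: "rep a \<in> S" if "a < p" for a
    using S size_facts that unfolding rep_def by (auto intro!: heis_memI modular_setI)
  have "rcosets\<^bsub>G\<^esub> A \<subseteq> (\<lambda>a. A #>\<^bsub>G\<^esub> rep a) ` {..<p}"
  proof
    fix C assume "C \<in> rcosets\<^bsub>G\<^esub> A"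
    then obtain u where u: "u \<in> S" "C = A #>\<^bsub>G\<^esub> u" unfolding RCOSETS_def carrier_G by auto
    obtain a b c where c: "u = triple (a, b, c)" "a < p" "b < p" "c < p\<^sup>2" by (rule S_memE[OF u(1)])
    define v where "v = u \<otimes>\<^bsub>G\<^esub> inv\<^bsub>G\<^esub> rep a"
    have ra: "rep a \<in> carrier G" "u \<in> carrier G" using rep c u carrier_G by auto
    have "v \<in> carrier G" unfolding v_def using ra by simp
    then have vS: "v \<in> S" by (simp only: carrier_G)
    obtain a' b' c' where c': "v = triple (a', b', c')" "a' < p" "b' < p" "c' < p\<^sup>2" by (rule S_memE[OF vS])
    have "v \<otimes>\<^bsub>G\<^esub> rep a = u" unfolding v_def using ra by (simp add: m_assoc)
    then have "(a' + a) mod p = a" unfolding c'(1) c(1) rep_def mult_code triple_eq_iff by simp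
    then have "a' = 0" using c'(2) c(2) by (auto simp: mod_if split: if_splits)
    then have "v \<in> A" unfolding A_def using c' vS by auto
    then have "u \<in> A #>\<^bsub>G\<^esub> rep a"
      unfolding r_coset_def using \<open>v \<otimes>\<^bsub>G\<^esub> rep a = u\<close> by auto
    then have "C = A #>\<^bsub>G\<^esub> rep a" using repr_independence[OF _ ra(1) A] u(2) by simp
    then show "C \<in> (\<lambda>a. A #>\<^bsub>G\<^esub> rep a) ` {..<p}" using c by auto
  qed
  then have "card (rcosets\<^bsub>G\<^esub> A) \<le> card ((\<lambda>a. A #>\<^bsub>G\<^esub> rep a) ` {..<p})" by (intro card_mono) auto
  also have "\<dots> \<le> p" using card_image_le[of "{..<p}"] by fastforce
  finally have index: "card (rcosets\<^bsub>G\<^esub> A) \<le> p" .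
  let ?x = "triple (1, 0, 1)" and ?y = "triple (0, 1, 0)" and ?z = "triple (0, 0, p)"
  have mem: "?x \<in> carrier G" "?y \<in> carrier G" "?z \<in> carrier G"
    unfolding carrier_G using x_mem y_mem[OF p1] p_central by auto
  have z: "?x \<otimes>\<^bsub>G\<^esub> ?y \<otimes>\<^bsub>G\<^esub> inv\<^bsub>G\<^esub> (?y \<otimes>\<^bsub>G\<^esub> ?x) = ?z"
    unfolding commutator_relation using mem by (simp add: m_assoc)
  show ?thesis
  proof (rule Max_cd_abelian_prime_index[OF p fin k A comm index mem(1,2) noncommuting])
    show "(?x \<otimes>\<^bsub>G\<^esub> ?y \<otimes>\<^bsub>G\<^esub> inv\<^bsub>G\<^esub> (?y \<otimes>\<^bsub>G\<^esub> ?x)) \<otimes>\<^bsub>G\<^esub> t = t \<otimes>\<^bsub>G\<^esub> (?x \<otimes>\<^bsub>G\<^esub> ?y \<otimes>\<^bsub>G\<^esub> inv\<^bsub>G\<^esub> (?y \<otimes>\<^bsub>G\<^esub> ?x))"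
      if "t \<in> carrier G" for t
      unfolding z using central_code[of p t] size_facts p_central that carrier_G by simp
  qed
qed

end

lemma p_expansion_power:
  assumes "p > 1" "r \<ge> 1"
  shows "p_expansion p (p ^ r) r (\<lambda>i. if i = r then 1 else 0)"
  using assms unfolding p_expansion_def by (simp add: if_distrib[of "\<lambda>x. x * _"] cong: if_cong)

text \<open>
  The general upper bound is attained: \<open>(0, 0, 1)\<close> is central of order \<open>p ^ 2\<close> and its \<open>p\<close>-th power
  is a commutator.
\<close>

lemma heis_min_quasi_perm_degree:
  assumes p: "Factorial_Ring.prime p"
  shows "min_quasi_perm_degree (heis p) = p ^ 3"
proof -
  interpret heis_subgroup p "carrier (heis p)" by unfold_locales (use p in auto)
  have GH: "G = heis p" unfolding G_def by simp
  obtain k where k: "card (carrier G) = p ^ k" using card_G by blast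
  have "min_quasi_perm_degree G \<le> min_generators (center_group G) * (Max (cd G) * group_exponent G)"
    by (rule min_quasi_perm_degree_upper[OF p fin k])
  also have "\<dots> \<le> 1 * (p * p\<^sup>2)"
    unfolding Max_cd exponent using min_generators_le_1 by (rule mult_le_mono1)
  finally have upper: "min_quasi_perm_degree G \<le> p ^ 3" by (simp add: power2_eq_square power3_eq_cube)
  let ?x = "triple (1, 0, 1)" and ?y = "triple (0, 1, 0)" and ?z = "triple (0, 0, 1)"
  have zS: "?z \<in> carrier (heis p)" using size_facts by (auto intro: heis_memI)
  have mem: "?x \<in> carrier G" "?y \<in> carrier G" "?z \<in> carrier G"
    unfolding carrier_G using x_mem y_mem[OF p1] zS by auto
  have zp: "?z [^]\<^bsub>G\<^esub> p = triple (0, 0, p)" using size_facts p1 by (simp add: pow_code)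
  have zc: "?z \<otimes>\<^bsub>G\<^esub> t = t \<otimes>\<^bsub>G\<^esub> ?z" if "t \<in> carrier G" for t
    using central_code[of 1 t] zS that size_facts carrier_G by simp
  have "p * p ^ Suc 1 \<le> min_quasi_perm_degree G"
  proof (rule quasi_perm_rep_degree_ge_central_commutator[OF p p_group_has_quasi_perm_rep[OF p fin k] mem(1,2) _ mem(3)])
    show "?y [^]\<^bsub>G\<^esub> p = \<one>\<^bsub>G\<^esub>" using size_facts p1 by (simp add: pow_code one_G)
    show "?z [^]\<^bsub>G\<^esub> (p ^ Suc 1) = \<one>\<^bsub>G\<^esub>" using size_facts p1 by (simp add: pow_code one_G power2_eq_square)
    show "?z [^]\<^bsub>G\<^esub> (p ^ 1) \<noteq> \<one>\<^bsub>G\<^esub>" using zp size_facts by (simp add: one_G triple_eq_iff)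
    show "?x \<otimes>\<^bsub>G\<^esub> ?z = ?z \<otimes>\<^bsub>G\<^esub> ?x" "?y \<otimes>\<^bsub>G\<^esub> ?z = ?z \<otimes>\<^bsub>G\<^esub> ?y"
      using zc mem by simp_all
    have pc: "triple (0, 0, p) \<in> carrier G" unfolding carrier_G by (rule p_central)
    have "?x \<otimes>\<^bsub>G\<^esub> ?y \<otimes>\<^bsub>G\<^esub> inv\<^bsub>G\<^esub> ?x = triple (0, 0, p) \<otimes>\<^bsub>G\<^esub> ?y"
      unfolding commutator_relation using mem pc by (simp add: m_assoc)
    also have "\<dots> = ?y \<otimes>\<^bsub>G\<^esub> triple (0, 0, p)"
      using central_code[of p ?y] size_facts p_central mem carrier_G by simp
    finally show "?x \<otimes>\<^bsub>G\<^esub> ?y \<otimes>\<^bsub>G\<^esub> inv\<^bsub>G\<^esub> ?x = ?y \<otimes>\<^bsub>G\<^esub> ?z [^]\<^bsub>G\<^esub> (p ^ 1)" using zp by simp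
  qed
  then show ?thesis using upper unfolding GH by (simp add: power2_eq_square power3_eq_cube)
qed

text \<open>
  The subgroup \<open>K\<close> of the \<open>(0, b, 0)\<close> contains no central element besides \<open>\<one>\<close> and has index
  at most \<open>p ^ 2\<close>, which is also the exponent.
\<close>

lemma modular_min_quasi_perm_degree:
  assumes p: "Factorial_Ring.prime p"
  shows "min_quasi_perm_degree (heis p\<lparr>carrier := modular_set p\<rparr>) = p\<^sup>2"
proof -
  interpret heis_subgroup p "modular_set p" by unfold_locales (use p in auto)
  obtain k where k: "card (carrier G) = p ^ k" using card_G by blast
  have "p ^ Suc 1 \<le> min_quasi_perm_degree G"
    by (rule exponent_le_min_quasi_perm_degree[OF p fin k]) (simp add: exponent power2_eq_square)
  then have lower: "p\<^sup>2 \<le> min_quasi_perm_degree G" by (simp add: power2_eq_square)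
  define K where "K = (\<lambda>b. triple (0, b, 0)) ` {..<p}"
  have KS: "K \<subseteq> carrier G" unfolding K_def carrier_G using y_mem by auto
  have K: "subgroup K G"
  proof (rule finite_closed_imp_subgroup[OF fin KS])
    show "\<one>\<^bsub>G\<^esub> \<in> K" unfolding K_def one_G using size_facts by auto
    show "u \<otimes>\<^bsub>G\<^esub> v \<in> K" if "u \<in> K" "v \<in> K" for u v
      using that size_facts unfolding K_def by (auto simp: mult_code)
  qed
  have "has_quasi_perm_rep G (\<Sum>K\<leftarrow>[K]. card (rcosets\<^bsub>G\<^esub> K))"
  proof (rule has_quasi_perm_rep_of_subgroups[OF p fin k])
    show "subgroup L G" if "L \<in> set [K]" for L using that K by simp
    fix z assume "z \<in> carrier G" "z \<noteq> \<one>\<^bsub>G\<^esub>" "\<And>t. t \<in> carrier G \<Longrightarrow> z \<otimes>\<^bsub>G\<^esub> t = t \<otimes>\<^bsub>G\<^esub> z"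
    then have z: "z \<in> center_set" "z \<noteq> \<one>\<^bsub>G\<^esub>" unfolding center_set_def by blast+
    obtain c where c: "z = triple (0, 0, c)" by (rule center_code[OF z(1)])
    then have "z \<notin> K" using z(2) unfolding K_def one_G by (auto simp: triple_eq_iff)
    then show "\<exists>K\<in>set [K]. z \<notin> K" by simp
  qed
  then have le: "min_quasi_perm_degree G \<le> card (rcosets\<^bsub>G\<^esub> K)"
    using min_quasi_perm_degree_le by fastforce
  define rep where "rep c = triple (c mod p, 0, c)" for c
  have rep: "rep c \<in> carrier G" if "c < p\<^sup>2" for c
    unfolding carrier_G rep_def using that size_facts by (intro modular_setI) auto
  have "rcosets\<^bsub>G\<^esub> K \<subseteq> (\<lambda>c. K #>\<^bsub>G\<^esub> rep c) ` {..<p\<^sup>2}"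
  proof
    fix C assume "C \<in> rcosets\<^bsub>G\<^esub> K"
    then obtain u where u: "u \<in> modular_set p" "C = K #>\<^bsub>G\<^esub> u" unfolding RCOSETS_def carrier_G by auto
    then obtain b c where c: "u = triple (c mod p, b, c)" "b < p" "c < p\<^sup>2" unfolding modular_set_def by auto
    have "triple (0, b, 0) \<otimes>\<^bsub>G\<^esub> rep c = u" unfolding c(1) rep_def mult_code using c by simp
    then have "u \<in> K #>\<^bsub>G\<^esub> rep c" unfolding r_coset_def K_def using c(2) by force
    then have "C = K #>\<^bsub>G\<^esub> rep c" using repr_independence[OF _ rep[OF c(3)] K] u(2) by simp
    then show "C \<in> (\<lambda>c. K #>\<^bsub>G\<^esub> rep c) ` {..<p\<^sup>2}" using c by auto
  qed
  then have "card (rcosets\<^bsub>G\<^esub> K) \<le> card ((\<lambda>c. K #>\<^bsub>G\<^esub> rep c) ` {..<p\<^sup>2})" by (intro card_mono) auto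
  also have "\<dots> \<le> p\<^sup>2" using card_image_le[of "{..<p\<^sup>2}"] by fastforce
  finally show ?thesis using le lower unfolding G_def by simp
qed

theorem theorem3:
  fixes p :: nat
  assumes "Factorial_Ring.prime p"
  shows "(\<forall>(G :: ('a, 'b) monoid_scheme) b e r a.
            nonabelian_p_group p G \<and> group_exponent G = p ^ b \<and> Max (cd G) = p ^ e \<and>
            p_expansion p (min_quasi_perm_degree G) r a \<longrightarrow>
            b \<le> r \<and>
            (min_generators (center_group G) < p \<longrightarrow> b \<le> r \<and> r \<le> b + e)) \<and>
         (\<exists>(G :: nat monoid) b e r a.
            nonabelian_p_group p G \<and> group_exponent G = p ^ b \<and> Max (cd G) = p ^ e \<and>
            p_expansion p (min_quasi_perm_degree G) r a \<and>
            min_generators (center_group G) < p \<and> r = b) \<and>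
         (\<exists>(G :: nat monoid) b e r a.
            nonabelian_p_group p G \<and> group_exponent G = p ^ b \<and> Max (cd G) = p ^ e \<and>
            p_expansion p (min_quasi_perm_degree G) r a \<and>
            min_generators (center_group G) < p \<and> r = b + e)"
proof (intro conjI allI impI)
  note p = assms
  fix G :: "('a, 'b) monoid_scheme" and b e r a
  assume A: "nonabelian_p_group p G \<and> group_exponent G = p ^ b \<and> Max (cd G) = p ^ e \<and>
            p_expansion p (min_quasi_perm_degree G) r a"
  show "b \<le> r" "b \<le> r" using expansion_length_bounds(1)[OF p] A by blast+
  show "r \<le> b + e" if "min_generators (center_group G) < p"
    using expansion_length_bounds(2)[OF p _ _ _ _ that] A by blast
next
  have p1: "p > 1" using assms by (rule prime_gt_1_nat)
  interpret heis_subgroup p "modular_set p" by unfold_locales (use assms in auto)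
  have "p_expansion p (min_quasi_perm_degree G) 2 (\<lambda>i. if i = 2 then 1 else 0)"
    using p_expansion_power[OF p1, of 2] modular_min_quasi_perm_degree[OF assms] unfolding G_def by simp
  moreover have "Max (cd G) = p ^ 1" using Max_cd by simp
  moreover have "min_generators (center_group G) < p" using min_generators_le_1 p1 by linarith
  ultimately show "\<exists>(G :: nat monoid) b e r a.
            nonabelian_p_group p G \<and> group_exponent G = p ^ b \<and> Max (cd G) = p ^ e \<and>
            p_expansion p (min_quasi_perm_degree G) r a \<and>
            min_generators (center_group G) < p \<and> r = b"
    using nonabelian exponent by blast
next
  have p1: "p > 1" using assms by (rule prime_gt_1_nat)
  interpret heis_subgroup p "carrier (heis p)" by unfold_locales (use assms in auto)
  have "p_expansion p (min_quasi_perm_degree G) 3 (\<lambda>i. if i = 3 then 1 else 0)"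
    using p_expansion_power[OF p1, of 3] heis_min_quasi_perm_degree[OF assms] unfolding G_def by simp
  moreover have "Max (cd G) = p ^ 1" using Max_cd by simp
  moreover have "min_generators (center_group G) < p" using min_generators_le_1 p1 by linarith
  moreover have "(3::nat) = 2 + 1" by simp
  ultimately show "\<exists>(G :: nat monoid) b e r a.
            nonabelian_p_group p G \<and> group_exponent G = p ^ b \<and> Max (cd G) = p ^ e \<and>
            p_expansion p (min_quasi_perm_degree G) r a \<and>
            min_generators (center_group G) < p \<and> r = b + e"
    using nonabelian exponent by blast
qed

end
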